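(* Let $K$ be an infinite field and let $n\geq r$ be positive integers. Assume $\operatorname{char}K>r$ or $\operatorname{char}K=0$. Let $\underline{u}=(1,2,\dots,r)$. Then the Schur functor $F:\widetilde{S}(n,r)\text{-}\mathrm{Mod}\to K\widehat{\Sigma}_r\text{-}\mathrm{Mod}$, $W\mapsto \xi_{\underline{u},\underline{u}}W$, is an equivalence of categories.
   Context: Fix an infinite field $K$ and positive integers $n,r$. $\Sigma_r$ is the symmetric group on $r$ letters and $\widehat{\Sigma}_r=\Sigma_r\ltimes\mathbb{Z}^r$ is the extended affine Weyl group of type $A_{r-1}$. $I(\mathbb{Z},r)$ denotes the set of $r$-tuples $\underline{i}=(i_1,\dots,i_r)$ of integers, and $I(n,r)$ the subset of tuples with entries in $\{1,\dots,n\}$. $\widehat{\Sigma}_r$ acts on the right on $I(\mathbb{Z},r)$: $\Sigma_r$ acts by place permutation and $\varepsilon\in\mathbb{Z}^r$ acts by the shift $\underline{i}\varepsilon=\underline{i}+n\varepsilon$. It acts diagonally on $I(\mathbb{Z},r)\times I(\mathbb{Z},r)$; write $\sim$ for lying in the same $\widehat{\Sigma}_r$-orbit. To each pair $(\underline{i},\underline{j})$ associate a symbol $\xi_{\underline{i},\underline{j}}$, where $\xi_{\underline{i},\underline{j}}=\xi_{\underline{k},\underline{l}}$ if and only if $(\underline{i},\underline{j})\sim(\underline{k},\underline{l})$. The affine Schur algebra $\widetilde{S}(n,r)$ is the $K$-algebra with basis the set of these symbols and multiplication $\xi_{\underline{i},\underline{j}}\,\xi_{\underline{k},\underline{l}}=\sum_{(\underline{p},\underline{q})}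 Z(\underline{i},\underline{j},\underline{k},\underline{l},\underline{p},\underline{q})\,\xi_{\underline{p},\underline{q}}$, the sum over representatives of $\widehat{\Sigma}_r$-orbits on $I(\mathbb{Z},r)\times I(\mathbb{Z},r)$, where $Z(\underline{i},\underline{j},\underline{k},\underline{l},\underline{p},\underline{q})=\#\{\underline{s}\in I(\mathbb{Z},r)\mid (\underline{i},\underline{j})\sim(\underline{p},\underline{s}),\ (\underline{s},\underline{q})\sim(\underline{k},\underline{l})\}$. For $n\ge r$ and $\underline{u}=(1,\dots,r)\in I(n,r)$, the element $\xi_{\underline{u},\underline{u}}$ is an idempotent, and the centralizer algebra $\widetilde{S}(\underline{u})=\xi_{\underline{u},\underline{u}}\widetilde{S}(n,r)\xi_{\underline{u},\underline{u}}$ has basis $\{\xi_{\underline{u},\underline{u}w}\mid w\in\widehat{\Sigma}_r\}$ (distinct for distinct $w$) with $\xi_{\underline{u},\underline{u}w}\xi_{\underline{u},\underline{u}w'}=\xi_{\underline{u},\underline{u}w'w}$. It is therefore isomorphic to the group algebra $K\widehat{\Sigma}_r$ (via $w\mapsto \xi_{\underline{u},\underline{u}w^{-1}}$), and the two algebras are identified. $A\text{-}\mathrm{Mod}$ denotes the category of left $A$-modules; $\xi_{\underline{u},\underline{u}}W$ is a module over $\widetilde{S}(\underline{u})=K\widehat{\Sigma}_r$. *)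

theory Defs
  imports "HOL-Library.Poly_Mapping" "HOL-Computational_Algebra.Factorial_Ring"
    "HOL-Algebra.Sym_Groups" "HOL-Algebra.Module"
begin

section \<open>Categories, functors and equivalences\<close>

text \<open>
  Arrows are indexed by their source and target, so that the same raw value may be an arrow
  between several pairs of objects; composition and the action of a functor on arrows
  therefore take the objects as arguments.  \<open>Comp C X Y Z g f\<close> is the composite of
  \<open>f : X \<rightarrow> Y\<close> followed by \<open>g : Y \<rightarrow> Z\<close>.
\<close>

record ('o, 'a) cat =
  Obj :: "'o set"
  Arr :: "'o \<Rightarrow> 'o \<Rightarrow> 'a set"
  Ident :: "'o \<Rightarrow> 'a"
  Comp :: "'o \<Rightarrow> 'o \<Rightarrow> 'o \<Rightarrow> 'a \<Rightarrow> 'a \<Rightarrow> 'a"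

locale category =
  fixes C :: "('o, 'a) cat"
  assumes Ident_closed: "X \<in> Obj C \<Longrightarrow> Ident C X \<in> Arr C X X"
    and Comp_closed:
      "\<lbrakk>X \<in> Obj C; Y \<in> Obj C; Z \<in> Obj C; f \<in> Arr C X Y; g \<in> Arr C Y Z\<rbrakk>
        \<Longrightarrow> Comp C X Y Z g f \<in> Arr C X Z"
    and Comp_Ident_left:
      "\<lbrakk>X \<in> Obj C; Y \<in> Obj C; f \<in> Arr C X Y\<rbrakk> \<Longrightarrow> Comp C X Y Y (Ident C Y) f = f"
    and Comp_Ident_right:
      "\<lbrakk>X \<in> Obj C; Y \<in> Obj C; f \<in> Arr C X Y\<rbrakk> \<Longrightarrow> Comp C X X Y f (Ident C X) = f"
    and Comp_assoc:
      "\<lbrakk>W \<in> Obj C; X \<in> Obj C; Y \<in> Obj C; Z \<in> Obj C;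
        f \<in> Arr C W X; g \<in> Arr C X Y; h \<in> Arr C Y Z\<rbrakk>
        \<Longrightarrow> Comp C W Y Z h (Comp C W X Y g f) = Comp C W X Z (Comp C X Y Z h g) f"

definition iso_arrow :: "('o, 'a) cat \<Rightarrow> 'o \<Rightarrow> 'o \<Rightarrow> 'a \<Rightarrow> bool" where
  "iso_arrow C X Y f \<longleftrightarrow> f \<in> Arr C X Y \<and>
    (\<exists>g \<in> Arr C Y X. Comp C X Y X g f = Ident C X \<and> Comp C Y X Y f g = Ident C Y)"

record ('o, 'a, 'p, 'b) func =
  omap :: "'o \<Rightarrow> 'p"
  amap :: "'o \<Rightarrow> 'o \<Rightarrow> 'a \<Rightarrow> 'b"

locale cat_functor = dom: category C + cod: category D
  for C :: "('o, 'a) cat" and D :: "('p, 'b) cat" +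
  fixes F :: "('o, 'a, 'p, 'b) func"
  assumes omap_closed: "X \<in> Obj C \<Longrightarrow> omap F X \<in> Obj D"
    and amap_closed:
      "\<lbrakk>X \<in> Obj C; Y \<in> Obj C; f \<in> Arr C X Y\<rbrakk>
        \<Longrightarrow> amap F X Y f \<in> Arr D (omap F X) (omap F Y)"
    and amap_Ident: "X \<in> Obj C \<Longrightarrow> amap F X X (Ident C X) = Ident D (omap F X)"
    and amap_Comp:
      "\<lbrakk>X \<in> Obj C; Y \<in> Obj C; Z \<in> Obj C; f \<in> Arr C X Y; g \<in> Arr C Y Z\<rbrakk>
        \<Longrightarrow> amap F X Z (Comp C X Y Z g f) =
            Comp D (omap F X) (omap F Y) (omap F Z) (amap F Y Z g) (amap F X Y f)"

definition id_func :: "('o, 'a, 'o, 'a) func" where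
  "id_func = \<lparr>omap = (\<lambda>X. X), amap = (\<lambda>X Y f. f)\<rparr>"

definition comp_func ::
  "('p, 'b, 'q, 'c) func \<Rightarrow> ('o, 'a, 'p, 'b) func \<Rightarrow> ('o, 'a, 'q, 'c) func" where
  "comp_func G F =
    \<lparr>omap = (\<lambda>X. omap G (omap F X)),
     amap = (\<lambda>X Y f. amap G (omap F X) (omap F Y) (amap F X Y f))\<rparr>"

locale natural_iso = F: cat_functor C D F + G: cat_functor C D G
  for C :: "('o, 'a) cat" and D :: "('p, 'b) cat" and F G :: "('o, 'a, 'p, 'b) func" +
  fixes \<eta> :: "'o \<Rightarrow> 'b"
  assumes component_iso: "X \<in> Obj C \<Longrightarrow> iso_arrow D (omap F X) (omap G X) (\<eta> X)"
    and naturality: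
      "\<lbrakk>X \<in> Obj C; Y \<in> Obj C; f \<in> Arr C X Y\<rbrakk>
        \<Longrightarrow> Comp D (omap F X) (omap F Y) (omap G Y) (\<eta> Y) (amap F X Y f) =
            Comp D (omap F X) (omap G X) (omap G Y) (amap G X Y f) (\<eta> X)"

definition equivalence_of_categories ::
  "('o, 'a) cat \<Rightarrow> ('p, 'b) cat \<Rightarrow> ('o, 'a, 'p, 'b) func \<Rightarrow> bool" where
  "equivalence_of_categories C D F \<longleftrightarrow> cat_functor C D F \<and>
    (\<exists>G. cat_functor D C G \<and>
      (\<exists>\<eta>. natural_iso C C id_func (comp_func G F) \<eta>) \<and>
      (\<exists>\<epsilon>. natural_iso D D (comp_func F G) id_func \<epsilon>))"


section \<open>The category of left modules over a ring\<close>

text \<open>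
  The locale \<open>module\<close> requires a commutative ring of scalars, but its record type
  and its axioms make sense over any ring.  As for that locale, the fields \<open>mult\<close> and \<open>one\<close> of
  the record \<open>M\<close> play no role.
\<close>

locale left_module = R?: ring R + M?: abelian_group M
  for R :: "('r, 's) ring_scheme" (structure)
    and M :: "('r, 'm, 't) module_scheme" (structure) +
  assumes smult_closed:
      "\<lbrakk>a \<in> carrier R; x \<in> carrier M\<rbrakk> \<Longrightarrow> a \<odot>\<^bsub>M\<^esub> x \<in> carrier M"
    and smult_l_distr:
      "\<lbrakk>a \<in> carrier R; b \<in> carrier R; x \<in> carrier M\<rbrakk> \<Longrightarrow>
        (a \<oplus>\<^bsub>R\<^esub> b) \<odot>\<^bsub>M\<^esub> x = a \<odot>\<^bsub>M\<^esub> x \<oplus>\<^bsub>M\<^esub> b \<odot>\<^bsub>M\<^esub> x"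
    and smult_r_distr:
      "\<lbrakk>a \<in> carrier R; x \<in> carrier M; y \<in> carrier M\<rbrakk> \<Longrightarrow>
        a \<odot>\<^bsub>M\<^esub> (x \<oplus>\<^bsub>M\<^esub> y) = a \<odot>\<^bsub>M\<^esub> x \<oplus>\<^bsub>M\<^esub> a \<odot>\<^bsub>M\<^esub> y"
    and smult_assoc:
      "\<lbrakk>a \<in> carrier R; b \<in> carrier R; x \<in> carrier M\<rbrakk> \<Longrightarrow>
        (a \<otimes>\<^bsub>R\<^esub> b) \<odot>\<^bsub>M\<^esub> x = a \<odot>\<^bsub>M\<^esub> (b \<odot>\<^bsub>M\<^esub> x)"
    and smult_one: "x \<in> carrier M \<Longrightarrow> \<one>\<^bsub>R\<^esub> \<odot>\<^bsub>M\<^esub> x = x"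

text \<open>
  Homomorphisms are taken extensional, i.e. with the fixed value \<open>undefined\<close> outside the
  carrier, so that equality of arrows is equality on the carrier.
\<close>

definition module_homs ::
  "('r, 's) ring_scheme \<Rightarrow> ('r, 'm, 't) module_scheme \<Rightarrow> ('r, 'm, 't) module_scheme
    \<Rightarrow> ('m \<Rightarrow> 'm) set" where
  "module_homs R M N =
    {f \<in> carrier M \<rightarrow>\<^sub>E carrier N.
      (\<forall>x \<in> carrier M. \<forall>y \<in> carrier M. f (x \<oplus>\<^bsub>M\<^esub> y) = f x \<oplus>\<^bsub>N\<^esub> f y) \<and>
      (\<forall>a \<in> carrier R. \<forall>x \<in> carrier M. f (a \<odot>\<^bsub>M\<^esub> x) = a \<odot>\<^bsub>N\<^esub> f x)}"

text \<open>
  All left \<open>R\<close>-modules whose carrier is a subset of the type \<open>'m\<close>; the type plays the role of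
  the universe.
\<close>

definition Left_Mod :: "('r, 's) ring_scheme \<Rightarrow> (('r, 'm) module, 'm \<Rightarrow> 'm) cat" where
  "Left_Mod R =
    \<lparr>Obj = {M. left_module R M},
     Arr = module_homs R,
     Ident = (\<lambda>M. \<lambda>x \<in> carrier M. x),
     Comp = (\<lambda>L M N g f. compose (carrier L) g f)\<rparr>"


section \<open>The extended affine Weyl group and its group algebra\<close>

text \<open>The set \<open>I(\<int>, r)\<close>, its subset \<open>I(n, r)\<close> and the tuple \<open>u = (1, \<dots>, r)\<close>.\<close>

definition tuples :: "nat \<Rightarrow> (nat \<Rightarrow> int) set" where
  "tuples r = {1..r} \<rightarrow>\<^sub>E UNIV"

definition bounded_tuples :: "nat \<Rightarrow> nat \<Rightarrow> (nat \<Rightarrow> int) set" where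
  "bounded_tuples n r = {1..r} \<rightarrow>\<^sub>E {1..int n}"

definition u_tuple :: "nat \<Rightarrow> nat \<Rightarrow> int" where
  "u_tuple r = (\<lambda>t \<in> {1..r}. int t)"

text \<open>
  The pair \<open>(\<sigma>, \<epsilon>)\<close> stands for the product \<open>\<sigma>\<epsilon>\<close>, so it acts from the right by first permuting
  places and then shifting.  The multiplication is the one making this a right action:
  \<open>(i \<circ> \<sigma> + n\<epsilon>) \<circ> \<tau> + n\<delta> = i \<circ> (\<sigma> \<circ> \<tau>) + n(\<epsilon> \<circ> \<tau> + \<delta>)\<close>.
\<close>

type_synonym weyl = "(nat \<Rightarrow> nat) \<times> (nat \<Rightarrow> int)"

definition ext_affine_weyl :: "nat \<Rightarrow> weyl monoid" where
  "ext_affine_weyl r =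
    \<lparr>carrier = carrier (sym_group r) \<times> tuples r,
     mult = (\<lambda>(\<sigma>, \<epsilon>) (\<tau>, \<delta>). (\<sigma> \<otimes>\<^bsub>sym_group r\<^esub> \<tau>, \<lambda>t \<in> {1..r}. \<epsilon> (\<tau> t) + \<delta> t)),
     one = (\<one>\<^bsub>sym_group r\<^esub>, \<lambda>t \<in> {1..r}. 0)\<rparr>"

definition act :: "nat \<Rightarrow> nat \<Rightarrow> (nat \<Rightarrow> int) \<Rightarrow> weyl \<Rightarrow> nat \<Rightarrow> int" where
  "act n r i w = (\<lambda>t \<in> {1..r}. i (fst w t) + int n * snd w t)"

definition group_algebra :: "('g, 's) monoid_scheme \<Rightarrow> ('g \<Rightarrow>\<^sub>0 'k::field) ring" where
  "group_algebra G =
    \<lparr>carrier = {f. Poly_Mapping.keys f \<subseteq> carrier G},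
     mult = (\<lambda>f g. \<Sum>x \<in> Poly_Mapping.keys f. \<Sum>y \<in> Poly_Mapping.keys g.
       Poly_Mapping.single (x \<otimes>\<^bsub>G\<^esub> y) (Poly_Mapping.lookup f x * Poly_Mapping.lookup g y)),
     one = Poly_Mapping.single \<one>\<^bsub>G\<^esub> 1,
     zero = 0,
     add = (+)\<rparr>"


section \<open>The affine Schur algebra\<close>

type_synonym tuple_pair = "(nat \<Rightarrow> int) \<times> (nat \<Rightarrow> int)"

definition same_orbit :: "nat \<Rightarrow> nat \<Rightarrow> (tuple_pair \<times> tuple_pair) set" where
  "same_orbit n r =
    {((i, j), (k, l)). i \<in> tuples r \<and> j \<in> tuples r \<and>
      (\<exists>w \<in> carrier (ext_affine_weyl r). k = act n r i w \<and> l = act n r j w)}"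

definition pair_orbits :: "nat \<Rightarrow> nat \<Rightarrow> tuple_pair set set" where
  "pair_orbits n r = (tuples r \<times> tuples r) // same_orbit n r"

definition Z_coeff ::
  "nat \<Rightarrow> nat \<Rightarrow> tuple_pair \<Rightarrow> tuple_pair \<Rightarrow> tuple_pair \<Rightarrow> nat" where
  "Z_coeff n r = (\<lambda>(i, j) (k, l) (p, q).
    card {s \<in> tuples r.
      ((i, j), (p, s)) \<in> same_orbit n r \<and> ((s, q), (k, l)) \<in> same_orbit n r})"

definition orbit_rep :: "tuple_pair set \<Rightarrow> tuple_pair" where
  "orbit_rep A = (SOME x. x \<in> A)"

text \<open>The symbol \<open>\<xi>\<^sub>i\<^sub>j\<close> is the basis vector belonging to the orbit of \<open>(i, j)\<close>.\<close>

definition \<xi> ::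
  "nat \<Rightarrow> nat \<Rightarrow> (nat \<Rightarrow> int) \<Rightarrow> (nat \<Rightarrow> int) \<Rightarrow> tuple_pair set \<Rightarrow>\<^sub>0 'k::field" where
  "\<xi> n r i j = Poly_Mapping.single (same_orbit n r `` {(i, j)}) 1"

text \<open>
  Only finitely many orbits \<open>C\<close> have a nonzero coefficient in a given product, and the
  coefficient does not depend on the chosen representatives.  The unit is the sum of the
  distinct elements \<open>\<xi>\<^sub>i\<^sub>i\<close>; every diagonal orbit meets \<open>I(n, r) \<times> I(n, r)\<close>, so it
  suffices to let \<open>i\<close> range over the finite set \<open>I(n, r)\<close>.
\<close>

definition affine_schur :: "nat \<Rightarrow> nat \<Rightarrow> (tuple_pair set \<Rightarrow>\<^sub>0 'k::field) ring" where
  "affine_schur n r =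
    \<lparr>carrier = {f. Poly_Mapping.keys f \<subseteq> pair_orbits n r},
     mult = (\<lambda>f g. \<Sum>A \<in> Poly_Mapping.keys f. \<Sum>B \<in> Poly_Mapping.keys g.
       \<Sum>C \<in> {C \<in> pair_orbits n r. Z_coeff n r (orbit_rep A) (orbit_rep B) (orbit_rep C) \<noteq> 0}.
         Poly_Mapping.single C
           (Poly_Mapping.lookup f A * Poly_Mapping.lookup g B *
            of_nat (Z_coeff n r (orbit_rep A) (orbit_rep B) (orbit_rep C)))),
     one = (\<Sum>e \<in> (\<lambda>i. \<xi> n r i i) ` bounded_tuples n r. e),
     zero = 0,
     add = (+)\<rparr>"


section \<open>The Schur functor\<close>

text \<open>
  The identification of the group algebra with \<open>\<xi>\<^sub>u\<^sub>u S \<xi>\<^sub>u\<^sub>u\<close>: the linear extension of the map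
  sending a group element \<open>w\<close> to \<open>\<xi>\<close> at \<open>(u, u w\<^sup>-\<^sup>1)\<close>.
\<close>

definition group_to_schur ::
  "nat \<Rightarrow> nat \<Rightarrow> (weyl \<Rightarrow>\<^sub>0 'k::field) \<Rightarrow> (tuple_pair set \<Rightarrow>\<^sub>0 'k)" where
  "group_to_schur n r f =
    (\<Sum>w \<in> Poly_Mapping.keys f.
      Poly_Mapping.map ((*) (Poly_Mapping.lookup f w))
        (\<xi> n r (u_tuple r) (act n r (u_tuple r) (inv\<^bsub>ext_affine_weyl r\<^esub> w))))"

definition schur_omap ::
  "nat \<Rightarrow> nat \<Rightarrow> (tuple_pair set \<Rightarrow>\<^sub>0 'k::field, 'm) module \<Rightarrow> (weyl \<Rightarrow>\<^sub>0 'k, 'm) module" where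
  "schur_omap n r W =
    \<lparr>carrier = (\<lambda>x. \<xi> n r (u_tuple r) (u_tuple r) \<odot>\<^bsub>W\<^esub> x) ` carrier W,
     mult = mult W, one = one W, zero = zero W, add = add W,
     smult = (\<lambda>a x. group_to_schur n r a \<odot>\<^bsub>W\<^esub> x)\<rparr>"

definition schur_functor ::
  "nat \<Rightarrow> nat \<Rightarrow>
    ((tuple_pair set \<Rightarrow>\<^sub>0 'k::field, 'm) module, 'm \<Rightarrow> 'm, (weyl \<Rightarrow>\<^sub>0 'k, 'm) module, 'm \<Rightarrow> 'm) func"
  where
  "schur_functor n r =
    \<lparr>omap = schur_omap n r,
     amap = (\<lambda>W W' f. restrict f (carrier (schur_omap n r W)))\<rparr>"

end

theory Submission
  imports Defs "HOL-Library.Equipollence"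
begin

text \<open>
  Write \<open>S\<close> for the affine Schur algebra and \<open>e = \<xi>\<^sub>u\<^sub>u\<close>.  Passing from modules over \<open>S\<close> to modules over
  \<open>eSe\<close> by \<open>W \<mapsto> eW\<close> is an equivalence as soon as \<open>e\<close> is full, that is \<open>SeS = S\<close>; this is the classical
  Morita argument, carried out for an arbitrary ring in \<open>equivalence_corner\<close>.  Fullness is used in the
  form \<open>1 = \<Sum>\<^sub>k a\<^sub>k b\<^sub>k\<close> with \<open>a\<^sub>k \<in> Se\<close> and \<open>b\<^sub>k \<in> eS\<close>.  It makes \<open>W\<close> recoverable from \<open>eW\<close> through
  \<open>x = \<Sum>\<^sub>k a\<^sub>k (b\<^sub>k x)\<close>, whence the functor is full and faithful, and it lets every module over \<open>eSe\<close> be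
  induced to \<open>S\<close>.

  To see that \<open>e\<close> is full, regard elements of \<open>S\<close> as kernels on pairs of tuples that are invariant under
  the Weyl group; the product is then matrix multiplication (\<open>val_mult\<close>), which also shows that \<open>S\<close> is a
  ring.  Because \<open>r \<le> n\<close>, the stabiliser of \<open>u\<close> is trivial.  On the one hand this identifies \<open>eSe\<close>
  with the group algebra (\<open>\<psi>_bij\<close>, \<open>\<psi>_mult\<close>).  On the other hand \<open>\<xi>\<^sub>i\<^sub>u \<xi>\<^sub>u\<^sub>i\<close> is a diagonal kernel, with
  value at \<open>(p, p)\<close> the number of group elements moving \<open>i\<close> to \<open>p\<close>.  Summed over all \<open>i\<close> in \<open>I(n, r)\<close> these
  numbers give the number of group elements moving \<open>p\<close> into \<open>I(n, r)\<close>, and there is exactly one of these for each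
  permutation.  Hence \<open>\<Sum>\<^sub>i \<xi>\<^sub>i\<^sub>u \<xi>\<^sub>u\<^sub>i = r! \<cdot> 1\<close> (\<open>card_translates_into_box\<close>, \<open>sum_col_row\<close>), and \<open>r!\<close>
  is invertible in \<open>K\<close> by the assumption on the characteristic.

  The category of modules is taken over a fixed type, so the induced module, a set of vectors with
  entries in the given module, has to be embedded into that type.  A nonzero module over the infinite
  field \<open>K\<close> is infinite, hence as large as its finite powers, and there is enough room.
\<close>

section \<open>Fully faithful and essentially surjective functors\<close>

lemma category_id_func: "category C \<Longrightarrow> cat_functor C C id_func"
  unfolding cat_functor_def cat_functor_axioms_def by (simp add: id_func_def)

lemma cat_functor_comp_func:
  assumes "cat_functor C D F" and "cat_functor D E G"
  shows "cat_functor C E (comp_func G F)"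
proof -
  interpret F: cat_functor C D F by fact
  interpret G: cat_functor D E G by fact
  show ?thesis
    by unfold_locales
      (simp_all add: comp_func_def F.omap_closed G.omap_closed F.amap_closed G.amap_closed
        F.amap_Ident G.amap_Ident F.amap_Comp G.amap_Comp)
qed

locale fully_faithful = cat_functor +
  assumes bij_amap: "\<lbrakk>X \<in> Obj C; Y \<in> Obj C\<rbrakk>
    \<Longrightarrow> bij_betw (amap F X Y) (Arr C X Y) (Arr D (omap F X) (omap F Y))"
begin

definition lift_arrow :: "'a \<Rightarrow> 'a \<Rightarrow> 'd \<Rightarrow> 'b" where
  "lift_arrow X Y = inv_into (Arr C X Y) (amap F X Y)"

lemma lift_arrow:
  assumes "X \<in> Obj C" "Y \<in> Obj C" "h \<in> Arr D (omap F X) (omap F Y)"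
  shows lift_arrow_closed: "lift_arrow X Y h \<in> Arr C X Y"
    and amap_lift_arrow: "amap F X Y (lift_arrow X Y h) = h"
  using bij_amap[OF assms(1,2)] assms(3) unfolding lift_arrow_def bij_betw_def
  by (auto intro: inv_into_into f_inv_into_f)

lemma amap_eqD:
  assumes "X \<in> Obj C" "Y \<in> Obj C" "f \<in> Arr C X Y" "g \<in> Arr C X Y" "amap F X Y f = amap F X Y g"
  shows "f = g"
  using bij_amap[OF assms(1,2)] assms(3-5) by (auto simp: bij_betw_def inj_on_def)

end

text \<open>
  Choose for each \<open>V\<close> an object \<open>T V\<close> with \<open>F (T V) \<cong> V\<close>.  Conjugating an arrow by these
  isomorphisms and lifting it through \<open>F\<close> turns \<open>T\<close> into a functor; the chosen isomorphisms are the
  counit, and the lifts of their inverses are the unit.  Every identity between arrows of \<open>C\<close>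
  is checked after applying the faithful functor \<open>F\<close>.
\<close>

theorem (in fully_faithful) equivalence_if_essentially_surjective:
  assumes ess: "\<And>V. V \<in> Obj D \<Longrightarrow> \<exists>W \<in> Obj C. \<exists>h. iso_arrow D (omap F W) V h"
  shows "equivalence_of_categories C D F"
proof -
  obtain T h where T: "\<And>V. V \<in> Obj D \<Longrightarrow> T V \<in> Obj C"
    and h_iso: "\<And>V. V \<in> Obj D \<Longrightarrow> iso_arrow D (omap F (T V)) V (h V)"
    using ess by metis
  obtain k where k: "\<And>V. V \<in> Obj D \<Longrightarrow> k V \<in> Arr D V (omap F (T V))"
    and kh: "\<And>V. V \<in> Obj D \<Longrightarrow>
      Comp D (omap F (T V)) V (omap F (T V)) (k V) (h V) = Ident D (omap F (T V))"
    and hk: "\<And>V. V \<in> Obj D \<Longrightarrow> Comp D V (omap F (T V)) V (h V) (k V) = Ident D V"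
    using h_iso unfolding iso_arrow_def by metis
  have h: "\<And>V. V \<in> Obj D \<Longrightarrow> h V \<in> Arr D (omap F (T V)) V"
    using h_iso unfolding iso_arrow_def by blast
  note obj = T omap_closed
  \<comment> \<open>the arrow \<open>f\<close> conjugated by the chosen isomorphisms; this is the image under \<open>F\<close> of the lift\<close>
  define c where "c V V' f = Comp D (omap F (T V)) V' (omap F (T V')) (k V')
    (Comp D (omap F (T V)) V V' f (h V))" for V V' f
  have c: "c V V' f \<in> Arr D (omap F (T V)) (omap F (T V'))"
    if "V \<in> Obj D" "V' \<in> Obj D" "f \<in> Arr D V V'" for V V' f
    unfolding c_def using that h k obj by (intro cod.Comp_closed) auto
  have hc: "Comp D (omap F (T V)) (omap F (T V')) V' (h V') (c V V' f) =
      Comp D (omap F (T V)) V V' f (h V)" (is "?l = ?r")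
    if V: "V \<in> Obj D" "V' \<in> Obj D" "f \<in> Arr D V V'" for V V' f
  proof -
    have 1: "?r \<in> Arr D (omap F (T V)) V'"
      using that h obj by (intro cod.Comp_closed) auto
    have "?l = Comp D (omap F (T V)) V' V' (Comp D V' (omap F (T V')) V' (h V') (k V')) ?r"
      unfolding c_def using V h k obj 1 by (intro cod.Comp_assoc) auto
    then show ?thesis using V obj 1 by (simp add: hk cod.Comp_Ident_left)
  qed
  have ck: "Comp D V (omap F (T V)) (omap F (T V')) (c V V' f) (k V) =
      Comp D V V' (omap F (T V')) (k V') f" (is "?l = ?r")
    if V: "V \<in> Obj D" "V' \<in> Obj D" "f \<in> Arr D V V'" for V V' f
  proof -
    have 1: "Comp D (omap F (T V)) V V' f (h V) \<in> Arr D (omap F (T V)) V'"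
      using that h obj by (intro cod.Comp_closed) auto
    have "?l = Comp D V V' (omap F (T V')) (k V')
        (Comp D V (omap F (T V)) V' (Comp D (omap F (T V)) V V' f (h V)) (k V))"
      unfolding c_def using V h k obj 1 by (intro cod.Comp_assoc[symmetric]) auto
    also have "Comp D V (omap F (T V)) V' (Comp D (omap F (T V)) V V' f (h V)) (k V) =
        Comp D V V V' f (Comp D V (omap F (T V)) V (h V) (k V))"
      using V h k obj by (intro cod.Comp_assoc[symmetric]) auto
    finally show ?thesis using V obj by (simp add: hk cod.Comp_Ident_right)
  qed
  have cc: "c V V'' (Comp D V V' V'' g f) =
      Comp D (omap F (T V)) (omap F (T V')) (omap F (T V'')) (c V' V'' g) (c V V' f)"
    if V: "V \<in> Obj D" "V' \<in> Obj D" "V'' \<in> Obj D" "f \<in> Arr D V V'" "g \<in> Arr D V' V''" for V V' V'' f g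
  proof -
    let ?f = "Comp D (omap F (T V)) V V' f (h V)"
    have 1: "?f \<in> Arr D (omap F (T V)) V'"
      using V h obj by (intro cod.Comp_closed) auto
    have "c V V'' (Comp D V V' V'' g f) =
        Comp D (omap F (T V)) V'' (omap F (T V'')) (k V'') (Comp D (omap F (T V)) V' V'' g ?f)"
      unfolding c_def using V h obj by (subst cod.Comp_assoc[symmetric]) auto
    also have "\<dots> = Comp D (omap F (T V)) V' (omap F (T V''))
        (Comp D V' V'' (omap F (T V'')) (k V'') g) ?f"
      using V h k obj 1 by (intro cod.Comp_assoc) auto
    also have "Comp D V' V'' (omap F (T V'')) (k V'') g =
        Comp D V' (omap F (T V')) (omap F (T V'')) (c V' V'' g) (k V')"
      using V by (simp add: ck)
    also have "Comp D (omap F (T V)) V' (omap F (T V'')) \<dots> ?f =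
        Comp D (omap F (T V)) (omap F (T V')) (omap F (T V'')) (c V' V'' g)
          (Comp D (omap F (T V)) V' (omap F (T V')) (k V') ?f)"
      using V h k obj 1 c by (intro cod.Comp_assoc[symmetric]) auto
    finally show ?thesis unfolding c_def[of V V' f] .
  qed
  define G where "G = \<lparr>omap = T, amap = (\<lambda>V V' f. lift_arrow (T V) (T V') (c V V' f))\<rparr>"
  have G_obj: "omap G V = T V" for V by (simp add: G_def)
  have G_arr: "amap G V V' f \<in> Arr C (T V) (T V')"
    and FG_arr: "amap F (T V) (T V') (amap G V V' f) = c V V' f"
    if "V \<in> Obj D" "V' \<in> Obj D" "f \<in> Arr D V V'" for V V' f
    using that T c by (simp_all add: G_def lift_arrow)
  have G: "cat_functor D C G"
  proof unfold_locales
    fix V assume V: "V \<in> Obj D"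
    then show "omap G V \<in> Obj C" by (simp add: G_obj T)
    have "c V V (Ident D V) = Ident D (omap F (T V))"
      using V obj h by (simp add: c_def cod.Comp_Ident_left kh)
    then show "amap G V V (Ident D V) = Ident C (omap G V)"
      using V T by (intro amap_eqD[of "T V" "T V"])
        (auto simp: G_obj G_arr FG_arr amap_Ident cod.Ident_closed dom.Ident_closed)
  next
    fix V V' f assume "V \<in> Obj D" "V' \<in> Obj D" "f \<in> Arr D V V'"
    then show "amap G V V' f \<in> Arr C (omap G V) (omap G V')"
      by (simp add: G_obj G_arr)
  next
    fix V V' V'' f g
    assume V: "V \<in> Obj D" "V' \<in> Obj D" "V'' \<in> Obj D" "f \<in> Arr D V V'" "g \<in> Arr D V' V''"
    have gf: "Comp D V V' V'' g f \<in> Arr D V V''" using V by (intro cod.Comp_closed)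
    show "amap G V V'' (Comp D V V' V'' g f) =
        Comp C (omap G V) (omap G V') (omap G V'') (amap G V' V'' g) (amap G V V' f)"
      unfolding G_obj
    proof (rule amap_eqD[of "T V" "T V''"])
      show "Comp C (T V) (T V') (T V'') (amap G V' V'' g) (amap G V V' f) \<in> Arr C (T V) (T V'')"
        using V T by (intro dom.Comp_closed) (auto simp: G_arr)
      show "amap F (T V) (T V'') (amap G V V'' (Comp D V V' V'' g f)) =
          amap F (T V) (T V'') (Comp C (T V) (T V') (T V'') (amap G V' V'' g) (amap G V V' f))"
        using V gf T by (simp add: FG_arr amap_Comp G_arr cc)
    qed (use V gf T G_arr in auto)
  qed
  have eps: "natural_iso D D (comp_func F G) id_func h"
  proof (intro natural_iso.intro natural_iso_axioms.intro)
    show "cat_functor D D (comp_func F G)" by (rule cat_functor_comp_func[OF G cat_functor_axioms])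
    show "cat_functor D D id_func" by (rule category_id_func[OF cod.category_axioms])
    fix V assume "V \<in> Obj D"
    then show "iso_arrow D (omap (comp_func F G) V) (omap id_func V) (h V)"
      using h_iso by (simp add: comp_func_def id_func_def G_obj)
  next
    fix V V' f assume "V \<in> Obj D" "V' \<in> Obj D" "f \<in> Arr D V V'"
    then show "Comp D (omap (comp_func F G) V) (omap (comp_func F G) V') (omap id_func V') (h V')
        (amap (comp_func F G) V V' f) =
      Comp D (omap (comp_func F G) V) (omap id_func V) (omap id_func V') (amap id_func V V' f) (h V)"
      by (simp add: comp_func_def id_func_def G_obj FG_arr hc)
  qed
  define \<eta> where "\<eta> X = lift_arrow X (T (omap F X)) (k (omap F X))" for X
  have \<eta>: "\<eta> X \<in> Arr C X (T (omap F X))" "amap F X (T (omap F X)) (\<eta> X) = k (omap F X)"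
    if "X \<in> Obj C" for X
    using that obj k by (simp_all add: \<eta>_def lift_arrow)
  have eta: "natural_iso C C id_func (comp_func G F) \<eta>"
  proof (intro natural_iso.intro natural_iso_axioms.intro)
    show "cat_functor C C (comp_func G F)" by (rule cat_functor_comp_func[OF cat_functor_axioms G])
    show "cat_functor C C id_func" by (rule category_id_func[OF dom.category_axioms])
    fix X assume X: "X \<in> Obj C"
    let ?Y = "T (omap F X)"
    have Y: "?Y \<in> Obj C" using X obj by simp
    define \<theta> where "\<theta> = lift_arrow ?Y X (h (omap F X))"
    have \<theta>: "\<theta> \<in> Arr C ?Y X" "amap F ?Y X \<theta> = h (omap F X)"
      using X obj h by (simp_all add: \<theta>_def lift_arrow)
    have "Comp C X ?Y X \<theta> (\<eta> X) = Ident C X"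
      using X Y \<theta> \<eta> obj by (intro amap_eqD[of X X])
        (simp_all add: dom.Comp_closed dom.Ident_closed amap_Comp amap_Ident hk)
    moreover have "Comp C ?Y X ?Y (\<eta> X) \<theta> = Ident C ?Y"
      using X Y \<theta> \<eta> obj by (intro amap_eqD[of ?Y ?Y])
        (simp_all add: dom.Comp_closed dom.Ident_closed amap_Comp amap_Ident kh)
    ultimately have "iso_arrow C X ?Y (\<eta> X)"
      using X \<theta> \<eta> unfolding iso_arrow_def by auto
    then show "iso_arrow C (omap id_func X) (omap (comp_func G F) X) (\<eta> X)"
      by (simp add: id_func_def comp_func_def G_obj)
  next
    fix X Y f assume X: "X \<in> Obj C" and Y: "Y \<in> Obj C" and f: "f \<in> Arr C X Y"
    let ?X = "T (omap F X)" and ?Y = "T (omap F Y)"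
    have Ff: "amap F X Y f \<in> Arr D (omap F X) (omap F Y)" using X Y f by (rule amap_closed)
    have o: "?X \<in> Obj C" "?Y \<in> Obj C" "omap F X \<in> Obj D" "omap F Y \<in> Obj D"
      using X Y obj by auto
    have "Comp C X Y ?Y (\<eta> Y) f = Comp C X ?X ?Y (amap G (omap F X) (omap F Y) (amap F X Y f)) (\<eta> X)"
    proof (rule amap_eqD[of X ?Y])
      show "amap F X ?Y (Comp C X Y ?Y (\<eta> Y) f) =
        amap F X ?Y (Comp C X ?X ?Y (amap G (omap F X) (omap F Y) (amap F X Y f)) (\<eta> X))"
        using X Y f Ff o \<eta> by (simp add: amap_Comp G_arr FG_arr ck)
    qed (use X Y f Ff o \<eta> G_arr in \<open>auto intro!: dom.Comp_closed\<close>)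
    then show "Comp C (omap id_func X) (omap id_func Y) (omap (comp_func G F) Y) (\<eta> Y)
        (amap id_func X Y f) =
      Comp C (omap id_func X) (omap (comp_func G F) X) (omap (comp_func G F) Y)
        (amap (comp_func G F) X Y f) (\<eta> X)"
      by (simp add: id_func_def comp_func_def G_obj)
  qed
  show ?thesis
    unfolding equivalence_of_categories_def using cat_functor_axioms G eps eta by blast
qed

section \<open>Left modules and their category\<close>

text \<open>
  Covers scalar multiplication, in either of its arguments, as well as module homomorphisms.
\<close>

lemma finsum_hom:
  assumes "abelian_group M" "abelian_group N" and f: "f \<in> carrier M \<rightarrow> carrier N"
    and add: "\<And>x y. \<lbrakk>x \<in> carrier M; y \<in> carrier M\<rbrakk> \<Longrightarrow> f (x \<oplus>\<^bsub>M\<^esub> y) = f x \<oplus>\<^bsub>N\<^esub> f y"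
    and I: "finite I" and g: "g \<in> I \<rightarrow> carrier M"
  shows "f (finsum M g I) = (\<Oplus>\<^bsub>N\<^esub>i\<in>I. f (g i))"
proof -
  interpret M: abelian_group M by fact
  interpret N: abelian_group N by fact
  have "f \<zero>\<^bsub>M\<^esub> \<oplus>\<^bsub>N\<^esub> f \<zero>\<^bsub>M\<^esub> = f \<zero>\<^bsub>M\<^esub>" using add[of "\<zero>\<^bsub>M\<^esub>" "\<zero>\<^bsub>M\<^esub>"] by simp
  moreover have "f \<zero>\<^bsub>M\<^esub> \<in> carrier N" using f by auto
  ultimately have zero: "f \<zero>\<^bsub>M\<^esub> = \<zero>\<^bsub>N\<^esub>" using N.add.l_cancel_one by simp
  from I g show ?thesis
  proof (induction I)
    case (insert i I)
    then have "(\<lambda>i. f (g i)) \<in> I \<rightarrow> carrier N" "f (g i) \<in> carrier N"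
      "g \<in> I \<rightarrow> carrier M" "g i \<in> carrier M" using f by auto
    then show ?case using insert by (simp add: add)
  qed (simp add: zero)
qed

lemma (in abelian_group) finsum_swap:
  assumes "finite I" "finite J" and "\<And>i j. \<lbrakk>i \<in> I; j \<in> J\<rbrakk> \<Longrightarrow> f i j \<in> carrier G"
  shows "(\<Oplus>i\<in>I. \<Oplus>j\<in>J. f i j) = (\<Oplus>j\<in>J. \<Oplus>i\<in>I. f i j)"
  using assms(1,3)
proof (induction I)
  case (insert i I)
  have 1: "(\<lambda>j. f i j) \<in> J \<rightarrow> carrier G" "(\<lambda>j. \<Oplus>i\<in>I. f i j) \<in> J \<rightarrow> carrier G"
    using insert by (auto intro!: finsum_closed)
  have "(\<Oplus>i\<in>insert i I. \<Oplus>j\<in>J. f i j) = (\<Oplus>j\<in>J. f i j) \<oplus> (\<Oplus>i\<in>I. \<Oplus>j\<in>J. f i j)"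
    using insert by (intro finsum_insert) (auto intro!: finsum_closed)
  also have "(\<Oplus>i\<in>I. \<Oplus>j\<in>J. f i j) = (\<Oplus>j\<in>J. \<Oplus>i\<in>I. f i j)" using insert by simp
  also have "(\<Oplus>j\<in>J. f i j) \<oplus> (\<Oplus>j\<in>J. \<Oplus>i\<in>I. f i j) = (\<Oplus>j\<in>J. f i j \<oplus> (\<Oplus>i\<in>I. f i j))"
    using 1 by (rule finsum_addf[symmetric])
  also have "\<dots> = (\<Oplus>j\<in>J. \<Oplus>i\<in>insert i I. f i j)"
    using insert 1 by (intro finsum_cong') auto
  finally show ?case .
qed simp

context left_module
begin

lemma smult_r_null: "a \<in> carrier R \<Longrightarrow> a \<odot>\<^bsub>M\<^esub> \<zero>\<^bsub>M\<^esub> = \<zero>\<^bsub>M\<^esub>"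
  using smult_r_distr[of a "\<zero>\<^bsub>M\<^esub>" "\<zero>\<^bsub>M\<^esub>"] smult_closed[of a "\<zero>\<^bsub>M\<^esub>"] by (simp add: M.add.l_cancel_one)

lemma smult_l_null: "x \<in> carrier M \<Longrightarrow> \<zero>\<^bsub>R\<^esub> \<odot>\<^bsub>M\<^esub> x = \<zero>\<^bsub>M\<^esub>"
  using smult_l_distr[of "\<zero>\<^bsub>R\<^esub>" "\<zero>\<^bsub>R\<^esub>" x] smult_closed[of "\<zero>\<^bsub>R\<^esub>" x] by (simp add: M.add.l_cancel_one)

lemma smult_finsum_right:
  assumes "finite I" "a \<in> carrier R" "g \<in> I \<rightarrow> carrier M"
  shows "a \<odot>\<^bsub>M\<^esub> finsum M g I = (\<Oplus>\<^bsub>M\<^esub>i\<in>I. a \<odot>\<^bsub>M\<^esub> g i)"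
  using assms by (intro finsum_hom) (auto simp: smult_closed smult_r_distr M.abelian_group_axioms)

lemma smult_finsum_left:
  assumes "finite I" "x \<in> carrier M" "g \<in> I \<rightarrow> carrier R"
  shows "finsum R g I \<odot>\<^bsub>M\<^esub> x = (\<Oplus>\<^bsub>M\<^esub>i\<in>I. g i \<odot>\<^bsub>M\<^esub> x)"
  using assms by (intro finsum_hom[where f = "\<lambda>a. a \<odot>\<^bsub>M\<^esub> x"])
    (auto simp: smult_closed smult_l_distr M.abelian_group_axioms R.abelian_group_axioms)

end

lemma module_homsD:
  assumes "f \<in> module_homs R M N"
  shows "x \<in> carrier M \<Longrightarrow> f x \<in> carrier N"
    and "\<lbrakk>x \<in> carrier M; y \<in> carrier M\<rbrakk> \<Longrightarrow> f (x \<oplus>\<^bsub>M\<^esub> y) = f x \<oplus>\<^bsub>N\<^esub> f y"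
    and "\<lbrakk>a \<in> carrier R; x \<in> carrier M\<rbrakk> \<Longrightarrow> f (a \<odot>\<^bsub>M\<^esub> x) = a \<odot>\<^bsub>N\<^esub> f x"
    and "f \<in> extensional (carrier M)"
  using assms by (auto simp: module_homs_def PiE_def)

lemma module_homsI:
  assumes "\<And>x. x \<in> carrier M \<Longrightarrow> f x \<in> carrier N"
    and "\<And>x y. \<lbrakk>x \<in> carrier M; y \<in> carrier M\<rbrakk> \<Longrightarrow> f (x \<oplus>\<^bsub>M\<^esub> y) = f x \<oplus>\<^bsub>N\<^esub> f y"
    and "\<And>a x. \<lbrakk>a \<in> carrier R; x \<in> carrier M\<rbrakk> \<Longrightarrow> f (a \<odot>\<^bsub>M\<^esub> x) = a \<odot>\<^bsub>N\<^esub> f x"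
    and "f \<in> extensional (carrier M)"
  shows "f \<in> module_homs R M N"
  using assms by (auto simp: module_homs_def PiE_def)

lemma Left_Mod_simps [simp]:
  "M \<in> Obj (Left_Mod R) \<longleftrightarrow> left_module R M"
  "Arr (Left_Mod R) = module_homs R"
  "Ident (Left_Mod R) M = (\<lambda>x \<in> carrier M. x)"
  "Comp (Left_Mod R) L M N g f = compose (carrier L) g f"
  by (simp_all add: Left_Mod_def)

lemma left_moduleD:
  assumes "left_module R M"
  shows "\<lbrakk>x \<in> carrier M; y \<in> carrier M\<rbrakk> \<Longrightarrow> x \<oplus>\<^bsub>M\<^esub> y \<in> carrier M"
    and "\<lbrakk>a \<in> carrier R; x \<in> carrier M\<rbrakk> \<Longrightarrow> a \<odot>\<^bsub>M\<^esub> x \<in> carrier M"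
proof -
  interpret left_module R M by fact
  show "\<lbrakk>x \<in> carrier M; y \<in> carrier M\<rbrakk> \<Longrightarrow> x \<oplus>\<^bsub>M\<^esub> y \<in> carrier M"
    "\<lbrakk>a \<in> carrier R; x \<in> carrier M\<rbrakk> \<Longrightarrow> a \<odot>\<^bsub>M\<^esub> x \<in> carrier M"
    by (auto simp: smult_closed)
qed

lemma category_Left_Mod:
  fixes R :: "('a, 's) ring_scheme"
  shows "category (Left_Mod R :: (('a, 'c) module, 'c \<Rightarrow> 'c) cat)"
proof unfold_locales
  fix L M N :: "('a, 'c) module" and f g
  assume "L \<in> Obj (Left_Mod R)" and M: "f \<in> Arr (Left_Mod R) L M" "g \<in> Arr (Left_Mod R) M N"
  then have L: "left_module R L" by simp
  from M have f: "f \<in> module_homs R L M" and g: "g \<in> module_homs R M N" by simp_all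
  show "Comp (Left_Mod R) L M N g f \<in> Arr (Left_Mod R) L N"
    unfolding Left_Mod_simps
    by (intro module_homsI)
      (auto simp: compose_eq module_homsD[OF f] module_homsD[OF g] left_moduleD[OF L])
next
  fix K L M N :: "('a, 'c) module" and f g h
  assume "f \<in> Arr (Left_Mod R) K L"
  then have "f \<in> carrier K \<rightarrow> carrier L" by (auto simp: module_homsD)
  then show "Comp (Left_Mod R) K M N h (Comp (Left_Mod R) K L M g f) =
      Comp (Left_Mod R) K L N (Comp (Left_Mod R) L M N h g) f"
    by (auto simp: compose_def fun_eq_iff)
next
  fix L M :: "('a, 'c) module" and f
  assume f: "f \<in> Arr (Left_Mod R) L M"
  then have f': "f \<in> extensional (carrier L)" "f \<in> carrier L \<rightarrow> carrier M"
    by (auto simp: module_homsD)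
  show "Comp (Left_Mod R) L M M (Ident (Left_Mod R) M) f = f"
    unfolding Left_Mod_simps by (rule Id_compose[OF f'(2,1)])
  show "Comp (Left_Mod R) L L M f (Ident (Left_Mod R) L) = f"
    unfolding Left_Mod_simps using f' by (auto simp: compose_def fun_eq_iff extensional_def)
next
  fix L :: "('a, 'c) module"
  assume "L \<in> Obj (Left_Mod R)"
  then show "Ident (Left_Mod R) L \<in> Arr (Left_Mod R) L L"
    by (auto intro!: module_homsI simp: left_moduleD)
qed

lemma iso_arrow_inverse_of_bij_hom:
  assumes M: "left_module R M" and f: "f \<in> module_homs R M N"
    and bij: "bij_betw f (carrier M) (carrier N)"
  shows "\<exists>g. iso_arrow (Left_Mod R) N M g"
proof -
  define g where "g = restrict (inv_into (carrier M) f) (carrier N)"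
  have gM: "g y \<in> carrier M" and fg: "f (g y) = y" if "y \<in> carrier N" for y
    using that bij by (auto simp: g_def bij_betw_def f_inv_into_f inv_into_into)
  have gf: "g (f x) = x" if "x \<in> carrier M" for x
    using that bij by (auto simp: g_def bij_betw_def inv_into_f_f)
  have g_eq: "g y = x" if "f x = y" "x \<in> carrier M" for x y
    using gf that by auto
  have "g \<in> module_homs R N M"
  proof (rule module_homsI)
    show "g (x \<oplus>\<^bsub>N\<^esub> y) = g x \<oplus>\<^bsub>M\<^esub> g y" if "x \<in> carrier N" "y \<in> carrier N" for x y
      using that by (intro g_eq) (auto simp: module_homsD[OF f] gM fg left_moduleD[OF M])
    show "g (a \<odot>\<^bsub>N\<^esub> x) = a \<odot>\<^bsub>M\<^esub> g x" if "a \<in> carrier R" "x \<in> carrier N" for a x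
      using that by (intro g_eq) (auto simp: module_homsD[OF f] gM fg left_moduleD[OF M])
  qed (auto simp: gM, auto simp: g_def)
  moreover have "compose (carrier M) g f = (\<lambda>x\<in>carrier M. x)"
    by (auto simp: compose_def fun_eq_iff gf)
  moreover have "compose (carrier N) f g = (\<lambda>x\<in>carrier N. x)"
    by (auto simp: compose_def fun_eq_iff fg)
  ultimately show ?thesis
    using f unfolding iso_arrow_def by auto
qed

text \<open>
  The induced module is constructed on vectors, whereas all objects of the module category have
  their carrier in one type; an injection of the vectors into that type moves the structure.
\<close>

definition transport_module :: "('x \<Rightarrow> 'm) \<Rightarrow> ('r, 'x) module \<Rightarrow> ('r, 'm) module" where
  "transport_module j M = (let i = inv_into (carrier M) j in
    \<lparr>carrier = j ` carrier M, mult = undefined, one = undefined, zero = j \<zero>\<^bsub>M\<^esub>,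
     add = (\<lambda>x y. j (i x \<oplus>\<^bsub>M\<^esub> i y)), smult = (\<lambda>a x. j (a \<odot>\<^bsub>M\<^esub> i x))\<rparr>)"

lemma transport_module_simps:
  assumes "inj_on j (carrier M)"
  shows "carrier (transport_module j M) = j ` carrier M"
    and "\<zero>\<^bsub>transport_module j M\<^esub> = j \<zero>\<^bsub>M\<^esub>"
    and "\<lbrakk>x \<in> carrier M; y \<in> carrier M\<rbrakk> \<Longrightarrow> j x \<oplus>\<^bsub>transport_module j M\<^esub> j y = j (x \<oplus>\<^bsub>M\<^esub> y)"
    and "x \<in> carrier M \<Longrightarrow> a \<odot>\<^bsub>transport_module j M\<^esub> j x = j (a \<odot>\<^bsub>M\<^esub> x)"
  using assms by (auto simp: transport_module_def Let_def)

lemma left_module_transport: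
  assumes "left_module R M" and j: "inj_on j (carrier M)"
  shows "left_module R (transport_module j M)"
proof -
  interpret left_module R M by fact
  note s = transport_module_simps[OF j]
  show ?thesis
  proof (intro left_module.intro left_module_axioms.intro R.ring_axioms abelian_groupI)
    fix x assume "x \<in> carrier (transport_module j M)"
    then obtain x' where "x = j x'" "x' \<in> carrier M" by (auto simp: s)
    then show "\<exists>y\<in>carrier (transport_module j M). y \<oplus>\<^bsub>transport_module j M\<^esub> x = \<zero>\<^bsub>transport_module j M\<^esub>"
      by (intro bexI[of _ "j (\<ominus>\<^bsub>M\<^esub> x')"]) (auto simp: s M.l_neg)
  qed (auto simp: s smult_closed M.a_ac smult_l_distr smult_r_distr smult_assoc smult_one)
qed

section \<open>Full idempotents\<close>

text \<open>
  The equation \<open>sum_ab\<close> is a witness for \<open>ReR = R\<close>, i.e. for the idempotent \<open>e\<close> being full: the \<open>a\<^sub>k\<close> lie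
  in \<open>Re\<close> and the \<open>b\<^sub>k\<close> in \<open>eR\<close>.  The algebra \<open>B\<close> is only known through its bijection with \<open>eRe\<close>, from which it
  inherits the ring axioms.
\<close>

locale full_corner = R?: ring R for R :: "('r, 's) ring_scheme" (structure) +
  fixes B :: "('b, 't) ring_scheme" and \<psi> :: "'b \<Rightarrow> 'r" and e :: 'r
    and I :: "'i set" and a b :: "'i \<Rightarrow> 'r"
  assumes e_closed: "e \<in> carrier R" and e_idem: "e \<otimes> e = e"
    and \<psi>_bij: "bij_betw \<psi> (carrier B) {x \<in> carrier R. e \<otimes> x = x \<and> x \<otimes> e = x}"
    and B_closed: "\<one>\<^bsub>B\<^esub> \<in> carrier B" "\<zero>\<^bsub>B\<^esub> \<in> carrier B"
      "\<And>x y. \<lbrakk>x \<in> carrier B; y \<in> carrier B\<rbrakk> \<Longrightarrow> x \<oplus>\<^bsub>B\<^esub> y \<in> carrier B"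
      "\<And>x y. \<lbrakk>x \<in> carrier B; y \<in> carrier B\<rbrakk> \<Longrightarrow> x \<otimes>\<^bsub>B\<^esub> y \<in> carrier B"
    and \<psi>_one: "\<psi> \<one>\<^bsub>B\<^esub> = e" and \<psi>_zero: "\<psi> \<zero>\<^bsub>B\<^esub> = \<zero>"
    and \<psi>_add: "\<And>x y. \<lbrakk>x \<in> carrier B; y \<in> carrier B\<rbrakk> \<Longrightarrow> \<psi> (x \<oplus>\<^bsub>B\<^esub> y) = \<psi> x \<oplus> \<psi> y"
    and \<psi>_mult: "\<And>x y. \<lbrakk>x \<in> carrier B; y \<in> carrier B\<rbrakk> \<Longrightarrow> \<psi> (x \<otimes>\<^bsub>B\<^esub> y) = \<psi> x \<otimes> \<psi> y"
    and finite_I: "finite I"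
    and a_R: "\<And>k. k \<in> I \<Longrightarrow> a k \<in> carrier R" and a_e: "\<And>k. k \<in> I \<Longrightarrow> a k \<otimes> e = a k"
    and b_R: "\<And>k. k \<in> I \<Longrightarrow> b k \<in> carrier R" and e_b: "\<And>k. k \<in> I \<Longrightarrow> e \<otimes> b k = b k"
    and sum_ab: "(\<Oplus>k\<in>I. a k \<otimes> b k) = \<one>"
begin

definition corner :: "'r set" where
  "corner = {x \<in> carrier R. e \<otimes> x = x \<and> x \<otimes> e = x}"

lemma cornerD: "x \<in> corner \<Longrightarrow> x \<in> carrier R" "x \<in> corner \<Longrightarrow> e \<otimes> x = x" "x \<in> corner \<Longrightarrow> x \<otimes> e = x"
  by (auto simp: corner_def)

lemma corner_closed:
  "e \<in> corner" "\<zero> \<in> corner" "\<lbrakk>x \<in> corner; y \<in> corner\<rbrakk> \<Longrightarrow> x \<otimes> y \<in> corner"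
  "\<lbrakk>x \<in> corner; y \<in> corner\<rbrakk> \<Longrightarrow> x \<oplus> y \<in> corner" "x \<in> corner \<Longrightarrow> \<ominus> x \<in> corner"
  using e_closed by (auto simp: corner_def e_idem R.l_distr R.r_distr R.l_minus R.r_minus)
    (metis R.m_assoc)+

lemma corner_sandwich:
  assumes x: "x \<in> carrier R" "e \<otimes> x = x" and y: "y \<in> carrier R" "y \<otimes> e = y"
  shows "x \<otimes> y \<in> corner"
  unfolding corner_def
proof (intro CollectI conjI)
  show "e \<otimes> (x \<otimes> y) = x \<otimes> y" using x y e_closed by (simp flip: R.m_assoc)
  show "x \<otimes> y \<otimes> e = x \<otimes> y" using x y e_closed by (simp add: R.m_assoc)
qed (use x y in auto)

lemma \<psi>_closed: "x \<in> carrier B \<Longrightarrow> \<psi> x \<in> corner"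
  using \<psi>_bij by (auto simp: corner_def bij_betw_def)

lemma \<psi>_eqD: "\<lbrakk>\<psi> x = \<psi> y; x \<in> carrier B; y \<in> carrier B\<rbrakk> \<Longrightarrow> x = y"
  using \<psi>_bij by (auto simp: bij_betw_def inj_on_def)

lemma \<psi>_surj: "x \<in> corner \<Longrightarrow> \<exists>y \<in> carrier B. \<psi> y = x"
  using \<psi>_bij unfolding corner_def bij_betw_def by (metis (no_types, lifting) imageE)

lemma \<psi>_R: "x \<in> carrier B \<Longrightarrow> \<psi> x \<in> carrier R"
  using \<psi>_closed cornerD by blast

lemma ring_B: "ring B"
proof (intro ringI abelian_groupI monoidI)
  fix x assume x: "x \<in> carrier B"
  obtain y where "y \<in> carrier B" "\<psi> y = \<ominus> \<psi> x"
    using \<psi>_surj corner_closed \<psi>_closed x by metis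
  then show "\<exists>y\<in>carrier B. y \<oplus>\<^bsub>B\<^esub> x = \<zero>\<^bsub>B\<^esub>"
    using x by (intro bexI[of _ y] \<psi>_eqD) (auto simp: \<psi>_add \<psi>_zero B_closed \<psi>_R R.l_neg)
qed (auto intro!: \<psi>_eqD B_closed
    simp: \<psi>_add \<psi>_mult \<psi>_zero \<psi>_one B_closed \<psi>_R R.l_distr R.r_distr R.m_assoc R.a_ac
      cornerD[OF \<psi>_closed])

definition corner_omap :: "('r, 'm) module \<Rightarrow> ('b, 'm) module" where
  "corner_omap W =
    \<lparr>carrier = (\<lambda>x. e \<odot>\<^bsub>W\<^esub> x) ` carrier W, mult = mult W, one = one W, zero = zero W, add = add W,
     smult = (\<lambda>c x. \<psi> c \<odot>\<^bsub>W\<^esub> x)\<rparr>"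

definition corner_functor :: "(('r, 'm) module, 'm \<Rightarrow> 'm, ('b, 'm) module, 'm \<Rightarrow> 'm) func" where
  "corner_functor =
    \<lparr>omap = corner_omap, amap = (\<lambda>W W' f. restrict f (carrier (corner_omap W)))\<rparr>"

lemma corner_omap_simps:
  "\<zero>\<^bsub>corner_omap W\<^esub> = \<zero>\<^bsub>W\<^esub>" "x \<oplus>\<^bsub>corner_omap W\<^esub> y = x \<oplus>\<^bsub>W\<^esub> y"
  "c \<odot>\<^bsub>corner_omap W\<^esub> x = \<psi> c \<odot>\<^bsub>W\<^esub> x"
  by (simp_all add: corner_omap_def)

lemma carrier_corner_omap:
  assumes "left_module R W"
  shows "carrier (corner_omap W) = {x \<in> carrier W. e \<odot>\<^bsub>W\<^esub> x = x}"
proof -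
  interpret W: left_module R W by fact
  show ?thesis
    by (auto simp: corner_omap_def W.smult_closed e_closed e_idem simp flip: W.smult_assoc)
      (metis imageI)
qed

lemma corner_smult_closed:
  assumes "left_module R W" "x \<in> carrier W" "s \<in> carrier R" "e \<otimes> s = s"
  shows "s \<odot>\<^bsub>W\<^esub> x \<in> carrier (corner_omap W)"
proof -
  interpret W: left_module R W by fact
  show ?thesis
    using assms by (auto simp: carrier_corner_omap W.smult_closed e_closed simp flip: W.smult_assoc)
qed

lemma left_module_corner_omap:
  assumes "left_module R W"
  shows "left_module B (corner_omap W)"
proof -
  interpret W: left_module R W by fact
  note [simp] = carrier_corner_omap[OF assms] corner_omap_simps
  show ?thesis
  proof (intro left_module.intro left_module_axioms.intro abelian_groupI ring_B)
    fix x assume x: "x \<in> carrier (corner_omap W)"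
    have "(\<ominus> e) \<odot>\<^bsub>W\<^esub> x \<in> carrier (corner_omap W)"
      using x e_closed by (intro corner_smult_closed assms) (auto simp: R.r_minus e_idem)
    moreover have "(\<ominus> e) \<odot>\<^bsub>W\<^esub> x \<oplus>\<^bsub>W\<^esub> e \<odot>\<^bsub>W\<^esub> x = (\<ominus> e \<oplus> e) \<odot>\<^bsub>W\<^esub> x"
      using x e_closed by (intro W.smult_l_distr[symmetric]) auto
    then have "(\<ominus> e) \<odot>\<^bsub>W\<^esub> x \<oplus>\<^bsub>W\<^esub> x = \<zero>\<^bsub>W\<^esub>"
      using x e_closed by (simp add: R.l_neg W.smult_l_null)
    ultimately show "\<exists>y\<in>carrier (corner_omap W). y \<oplus>\<^bsub>corner_omap W\<^esub> x = \<zero>\<^bsub>corner_omap W\<^esub>"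
      using x by auto
  next
    fix c x assume "c \<in> carrier B" "x \<in> carrier (corner_omap W)"
    then show "c \<odot>\<^bsub>corner_omap W\<^esub> x \<in> carrier (corner_omap W)"
      using corner_smult_closed[OF assms] cornerD \<psi>_closed by auto
  qed (auto simp: W.a_ac W.smult_r_null e_closed W.smult_r_distr \<psi>_add \<psi>_mult \<psi>_one \<psi>_R
      W.smult_l_distr W.smult_assoc)
qed

lemma finsum_corner_omap:
  assumes W: "left_module R W" and g: "g \<in> J \<rightarrow> carrier (corner_omap W)"
  shows "finsum (corner_omap W) g J = finsum W g J"
proof (cases "finite J")
  case True
  then show ?thesis
    using finsum_hom[OF left_module.axioms(2)[OF left_module_corner_omap[OF W]]
        left_module.axioms(2)[OF W], of "\<lambda>x. x" J g] g
    by (simp add: carrier_corner_omap[OF W] corner_omap_simps Pi_def)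
next
  case False
  interpret W: left_module R W by fact
  interpret FW: left_module B "corner_omap W" by (rule left_module_corner_omap) fact
  show ?thesis using False by (simp add: corner_omap_simps)
qed

lemma corner_amap:
  "amap corner_functor W W' f = restrict f (carrier (corner_omap W))"
  by (simp add: corner_functor_def)

lemma omap_corner_functor: "omap corner_functor = corner_omap"
  by (simp add: corner_functor_def)

lemma corner_amap_hom:
  assumes W: "left_module R W" and "left_module R W'" and f: "f \<in> module_homs R W W'"
  shows "restrict f (carrier (corner_omap W)) \<in> module_homs B (corner_omap W) (corner_omap W')"
proof (rule module_homsI)
  interpret FW: left_module B "corner_omap W" by (rule left_module_corner_omap) fact
  note s = carrier_corner_omap[OF assms(1)] carrier_corner_omap[OF assms(2)] corner_omap_simps
  fix x assume x: "x \<in> carrier (corner_omap W)"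
  show "restrict f (carrier (corner_omap W)) x \<in> carrier (corner_omap W')"
    using x by (auto simp: s module_homsD(1)[OF f] e_closed simp flip: module_homsD(3)[OF f])
  show "restrict f (carrier (corner_omap W)) (x \<oplus>\<^bsub>corner_omap W\<^esub> y) =
      restrict f (carrier (corner_omap W)) x \<oplus>\<^bsub>corner_omap W'\<^esub> restrict f (carrier (corner_omap W)) y"
    if "y \<in> carrier (corner_omap W)" for y
    using FW.a_closed[OF x that] x that by (auto simp: s module_homsD[OF f])
  show "restrict f (carrier (corner_omap W)) (c \<odot>\<^bsub>corner_omap W\<^esub> x) =
      c \<odot>\<^bsub>corner_omap W'\<^esub> restrict f (carrier (corner_omap W)) x"
    if "c \<in> carrier B" for c
    using FW.smult_closed[OF that x] x that by (auto simp: s module_homsD[OF f] \<psi>_R)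
qed simp

lemma cat_functor_corner:
  "cat_functor (Left_Mod R) (Left_Mod B)
    (corner_functor :: (('r, 'm) module, 'm \<Rightarrow> 'm, ('b, 'm) module, 'm \<Rightarrow> 'm) func)"
proof (intro cat_functor.intro cat_functor_axioms.intro category_Left_Mod)
  fix W :: "('r, 'm) module" assume W: "W \<in> Obj (Left_Mod R)"
  then show "omap corner_functor W \<in> Obj (Left_Mod B)"
    by (simp add: omap_corner_functor left_module_corner_omap)
  show "amap corner_functor W W (Ident (Left_Mod R) W) = Ident (Left_Mod B) (omap corner_functor W)"
    using W by (auto simp: corner_amap omap_corner_functor fun_eq_iff carrier_corner_omap)
next
  fix W W' :: "('r, 'm) module" and f
  assume "W \<in> Obj (Left_Mod R)" "W' \<in> Obj (Left_Mod R)" "f \<in> Arr (Left_Mod R) W W'"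
  then show "amap corner_functor W W' f \<in> Arr (Left_Mod B) (omap corner_functor W) (omap corner_functor W')"
    by (simp add: corner_amap omap_corner_functor corner_amap_hom)
next
  fix W W' W'' :: "('r, 'm) module" and f g
  assume *: "W \<in> Obj (Left_Mod R)" "W' \<in> Obj (Left_Mod R)" "f \<in> Arr (Left_Mod R) W W'"
  then have "restrict f (carrier (corner_omap W)) \<in> module_homs B (corner_omap W) (corner_omap W')"
    by (simp add: corner_amap_hom)
  from module_homsD(1)[OF this] *
  show "amap corner_functor W W'' (Comp (Left_Mod R) W W' W'' g f) =
      Comp (Left_Mod B) (omap corner_functor W) (omap corner_functor W') (omap corner_functor W'')
        (amap corner_functor W' W'' g) (amap corner_functor W W' f)"
    by (auto simp: corner_amap omap_corner_functor compose_def fun_eq_iff carrier_corner_omap)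
qed

text \<open>
  Every element of a module is recovered from its components \<open>b\<^sub>k x\<close> in the corner.  Both halves of
  full faithfulness rest on this.
\<close>

lemma module_decomposition:
  assumes "left_module R W" "x \<in> carrier W"
  shows "(\<Oplus>\<^bsub>W\<^esub>k\<in>I. a k \<odot>\<^bsub>W\<^esub> (b k \<odot>\<^bsub>W\<^esub> x)) = x"
proof -
  interpret W: left_module R W by fact
  have "x = (\<Oplus>k\<in>I. a k \<otimes> b k) \<odot>\<^bsub>W\<^esub> x" by (simp add: sum_ab W.smult_one assms)
  also have "\<dots> = (\<Oplus>\<^bsub>W\<^esub>k\<in>I. (a k \<otimes> b k) \<odot>\<^bsub>W\<^esub> x)"
    using assms a_R b_R finite_I by (intro W.smult_finsum_left) auto
  also have "\<dots> = (\<Oplus>\<^bsub>W\<^esub>k\<in>I. a k \<odot>\<^bsub>W\<^esub> (b k \<odot>\<^bsub>W\<^esub> x))"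
    using assms a_R b_R by (intro W.finsum_cong') (auto simp: W.smult_closed W.smult_assoc)
  finally show ?thesis by simp
qed

lemma hom_eq_if_eq_on_corner:
  assumes W: "left_module R W" and W': "left_module R W'"
    and f: "f \<in> module_homs R W W'" and g: "g \<in> module_homs R W W'"
    and eq: "\<And>x. x \<in> carrier (corner_omap W) \<Longrightarrow> f x = g x"
  shows "f = g"
proof -
  interpret W: left_module R W by fact
  interpret W': left_module R W' by fact
  have *: "h x = (\<Oplus>\<^bsub>W'\<^esub>k\<in>I. a k \<odot>\<^bsub>W'\<^esub> h (b k \<odot>\<^bsub>W\<^esub> x))"
    if h: "h \<in> module_homs R W W'" and x: "x \<in> carrier W" for h x
  proof -
    have "h (\<Oplus>\<^bsub>W\<^esub>k\<in>I. a k \<odot>\<^bsub>W\<^esub> (b k \<odot>\<^bsub>W\<^esub> x)) = (\<Oplus>\<^bsub>W'\<^esub>k\<in>I. h (a k \<odot>\<^bsub>W\<^esub> (b k \<odot>\<^bsub>W\<^esub> x)))"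
      using x a_R b_R finite_I
      by (intro finsum_hom W.M.abelian_group_axioms W'.M.abelian_group_axioms)
        (auto simp: module_homsD[OF h] W.smult_closed)
    also have "\<dots> = (\<Oplus>\<^bsub>W'\<^esub>k\<in>I. a k \<odot>\<^bsub>W'\<^esub> h (b k \<odot>\<^bsub>W\<^esub> x))"
      using x a_R b_R
      by (intro W'.finsum_cong') (auto simp: module_homsD[OF h] W.smult_closed W'.smult_closed)
    finally show ?thesis using module_decomposition[OF W x] by simp
  qed
  have "f x = g x" if x: "x \<in> carrier W" for x
    using eq corner_smult_closed[OF W x b_R e_b] x b_R a_R module_homsD(1)[OF g]
    by (subst *[OF f x], subst *[OF g x], intro W'.finsum_cong')
      (auto simp: W'.smult_closed W.smult_closed)
  with module_homsD(4)[OF f] module_homsD(4)[OF g] show ?thesis by (rule extensionalityI)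
qed

text \<open>
  The decomposition forces the extension to be \<open>f x = \<Sum>\<^sub>k a\<^sub>k g (b\<^sub>k x)\<close>.  It commutes with \<open>c\<close> because
  \<open>b\<^sub>k c x = \<Sum>\<^sub>l (b\<^sub>k c a\<^sub>l) (b\<^sub>l x)\<close> with coefficients \<open>b\<^sub>k c a\<^sub>l\<close> in \<open>eRe\<close>, which can be pulled out of \<open>g\<close>; hence
  \<open>g (b\<^sub>k c x) = b\<^sub>k (c (f x))\<close>, and the decomposition of \<open>c (f x)\<close> finishes the argument.
\<close>

lemma hom_extends_from_corner:
  assumes W: "left_module R W" and W': "left_module R W'"
    and g: "g \<in> module_homs B (corner_omap W) (corner_omap W')"
  shows "\<exists>f \<in> module_homs R W W'. restrict f (carrier (corner_omap W)) = g"
proof -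
  interpret W: left_module R W by fact
  interpret W': left_module R W' by fact
  note s = carrier_corner_omap[OF W] carrier_corner_omap[OF W'] corner_omap_simps
  have g_corner: "g (c \<odot>\<^bsub>W\<^esub> x) = c \<odot>\<^bsub>W'\<^esub> g x"
    if "c \<in> corner" "x \<in> carrier (corner_omap W)" for c x
    using \<psi>_surj[OF that(1)] module_homsD(3)[OF g _ that(2)] by (auto simp: corner_omap_simps)
  have gW': "g x \<in> carrier W'" if "x \<in> carrier (corner_omap W)" for x
    using module_homsD(1)[OF g that] s by auto
  have b_x: "b k \<odot>\<^bsub>W\<^esub> x \<in> carrier (corner_omap W)" if "k \<in> I" "x \<in> carrier W" for k x
    using that by (intro corner_smult_closed W b_R e_b)
  have gb: "g (b k \<odot>\<^bsub>W\<^esub> x) \<in> carrier W'" if "k \<in> I" "x \<in> carrier W" for k x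
    using that b_x gW' by blast
  define f where "f = (\<lambda>x\<in>carrier W. \<Oplus>\<^bsub>W'\<^esub>k\<in>I. a k \<odot>\<^bsub>W'\<^esub> g (b k \<odot>\<^bsub>W\<^esub> x))"
  have f_closed: "f x \<in> carrier W'" if "x \<in> carrier W" for x
    using that gb a_R by (auto simp: f_def intro!: W'.finsum_closed W'.smult_closed)
  have f_smult: "f (c \<odot>\<^bsub>W\<^esub> x) = c \<odot>\<^bsub>W'\<^esub> f x" if c: "c \<in> carrier R" and x: "x \<in> carrier W" for c x
  proof -
    have g_b_c: "g (b k \<odot>\<^bsub>W\<^esub> (c \<odot>\<^bsub>W\<^esub> x)) = b k \<odot>\<^bsub>W'\<^esub> (c \<odot>\<^bsub>W'\<^esub> f x)" if k: "k \<in> I" for k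
    proof -
      have bca: "b k \<otimes> c \<otimes> a l \<in> corner" if "l \<in> I" for l
        using that k c b_R[OF k] a_R e_b[OF k] a_e e_closed
        by (intro corner_sandwich) (auto simp flip: R.m_assoc)
      have bcabx: "b k \<otimes> c \<otimes> a l \<odot>\<^bsub>W\<^esub> (b l \<odot>\<^bsub>W\<^esub> x) \<in> carrier (corner_omap W)" if "l \<in> I" for l
        using that x bca cornerD b_R by (intro corner_smult_closed W) (auto simp: W.smult_closed)
      have "b k \<odot>\<^bsub>W\<^esub> (c \<odot>\<^bsub>W\<^esub> x) =
          (b k \<otimes> c) \<odot>\<^bsub>W\<^esub> (\<Oplus>\<^bsub>W\<^esub>l\<in>I. a l \<odot>\<^bsub>W\<^esub> (b l \<odot>\<^bsub>W\<^esub> x))"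
        using k c x b_R by (simp add: module_decomposition[OF W] W.smult_assoc)
      also have "\<dots> = (\<Oplus>\<^bsub>W\<^esub>l\<in>I. (b k \<otimes> c) \<odot>\<^bsub>W\<^esub> (a l \<odot>\<^bsub>W\<^esub> (b l \<odot>\<^bsub>W\<^esub> x)))"
        using k c x b_R a_R finite_I
        by (intro W.smult_finsum_right) (auto simp: W.smult_closed)
      also have "\<dots> = (\<Oplus>\<^bsub>W\<^esub>l\<in>I. b k \<otimes> c \<otimes> a l \<odot>\<^bsub>W\<^esub> (b l \<odot>\<^bsub>W\<^esub> x))"
        using k c x b_R a_R
        by (intro W.finsum_cong') (auto simp: W.smult_closed W.smult_assoc)
      also have "\<dots> = (\<Oplus>\<^bsub>corner_omap W\<^esub>l\<in>I. b k \<otimes> c \<otimes> a l \<odot>\<^bsub>W\<^esub> (b l \<odot>\<^bsub>W\<^esub> x))"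
        using bcabx by (intro finsum_corner_omap[symmetric] W) auto
      finally have "g (b k \<odot>\<^bsub>W\<^esub> (c \<odot>\<^bsub>W\<^esub> x)) =
          g (\<Oplus>\<^bsub>corner_omap W\<^esub>l\<in>I. b k \<otimes> c \<otimes> a l \<odot>\<^bsub>W\<^esub> (b l \<odot>\<^bsub>W\<^esub> x))" by simp
      also have "\<dots> = (\<Oplus>\<^bsub>corner_omap W'\<^esub>l\<in>I. g (b k \<otimes> c \<otimes> a l \<odot>\<^bsub>W\<^esub> (b l \<odot>\<^bsub>W\<^esub> x)))"
        using bcabx finite_I
        by (intro finsum_hom left_module.axioms(2)[OF left_module_corner_omap] W W')
          (auto simp: module_homsD[OF g])
      also have "\<dots> = (\<Oplus>\<^bsub>W'\<^esub>l\<in>I. g (b k \<otimes> c \<otimes> a l \<odot>\<^bsub>W\<^esub> (b l \<odot>\<^bsub>W\<^esub> x)))"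
        using bcabx by (intro finsum_corner_omap W') (auto simp: module_homsD[OF g])
      also have "\<dots> = (\<Oplus>\<^bsub>W'\<^esub>l\<in>I. (b k \<otimes> c) \<odot>\<^bsub>W'\<^esub> (a l \<odot>\<^bsub>W'\<^esub> g (b l \<odot>\<^bsub>W\<^esub> x)))"
        using bca k c x b_R a_R
        by (intro W'.finsum_cong') (auto simp: g_corner b_x gb W'.smult_closed W'.smult_assoc)
      also have "\<dots> = (b k \<otimes> c) \<odot>\<^bsub>W'\<^esub> f x"
        using k c x b_R a_R finite_I
        by (simp add: f_def, intro W'.smult_finsum_right[symmetric]) (auto simp: gb W'.smult_closed)
      also have "\<dots> = b k \<odot>\<^bsub>W'\<^esub> (c \<odot>\<^bsub>W'\<^esub> f x)"
        using k c x b_R by (simp add: W'.smult_assoc f_closed)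
      finally show ?thesis .
    qed
    have "f (c \<odot>\<^bsub>W\<^esub> x) = (\<Oplus>\<^bsub>W'\<^esub>k\<in>I. a k \<odot>\<^bsub>W'\<^esub> (b k \<odot>\<^bsub>W'\<^esub> (c \<odot>\<^bsub>W'\<^esub> f x)))"
      using c x a_R b_R
      by (auto simp: f_def[THEN fun_cong, of "c \<odot>\<^bsub>W\<^esub> x"] W.smult_closed g_b_c f_closed W'.smult_closed
          intro!: W'.finsum_cong')
    also have "\<dots> = c \<odot>\<^bsub>W'\<^esub> f x"
      using c x by (intro module_decomposition W') (auto simp: f_closed W'.smult_closed)
    finally show ?thesis .
  qed
  have f_add: "f (x \<oplus>\<^bsub>W\<^esub> y) = f x \<oplus>\<^bsub>W'\<^esub> f y" if x: "x \<in> carrier W" and y: "y \<in> carrier W" for x y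
  proof -
    have "g (b k \<odot>\<^bsub>W\<^esub> (x \<oplus>\<^bsub>W\<^esub> y)) = g (b k \<odot>\<^bsub>W\<^esub> x) \<oplus>\<^bsub>W'\<^esub> g (b k \<odot>\<^bsub>W\<^esub> y)" if "k \<in> I" for k
      using module_homsD(2)[OF g b_x[OF that x] b_x[OF that y]] that x y b_R
      by (simp add: W.smult_r_distr corner_omap_simps)
    then have "f (x \<oplus>\<^bsub>W\<^esub> y) =
        (\<Oplus>\<^bsub>W'\<^esub>k\<in>I. a k \<odot>\<^bsub>W'\<^esub> g (b k \<odot>\<^bsub>W\<^esub> x) \<oplus>\<^bsub>W'\<^esub> a k \<odot>\<^bsub>W'\<^esub> g (b k \<odot>\<^bsub>W\<^esub> y))"
      using x y a_R gb W.a_closed[OF x y]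
      by (simp add: f_def, intro W'.finsum_cong') (auto simp: W'.smult_closed W'.smult_r_distr)
    also have "\<dots> = f x \<oplus>\<^bsub>W'\<^esub> f y"
      using x y a_R gb by (simp add: f_def, intro W'.finsum_addf) (auto simp: W'.smult_closed)
    finally show ?thesis .
  qed
  have "f \<in> module_homs R W W'"
    using f_closed f_add f_smult by (intro module_homsI) (auto simp: f_def)
  moreover have "restrict f (carrier (corner_omap W)) = g"
  proof (rule extensionalityI)
    fix x assume x: "x \<in> carrier (corner_omap W)"
    then have xW: "x \<in> carrier W" and ex: "e \<odot>\<^bsub>W\<^esub> x = x" and gx: "e \<odot>\<^bsub>W'\<^esub> g x = g x"
      using module_homsD(1)[OF g x] by (auto simp: s)
    have "g (b k \<odot>\<^bsub>W\<^esub> x) = b k \<odot>\<^bsub>W'\<^esub> g x" if k: "k \<in> I" for k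
    proof -
      have "b k \<otimes> e \<in> corner"
        using b_R[OF k] e_b[OF k] e_closed e_idem by (intro corner_sandwich) auto
      then have "g ((b k \<otimes> e) \<odot>\<^bsub>W\<^esub> x) = (b k \<otimes> e) \<odot>\<^bsub>W'\<^esub> g x" using x by (rule g_corner)
      then show ?thesis
        using xW gW'[OF x] b_R[OF k] e_closed by (simp add: W.smult_assoc W'.smult_assoc ex gx)
    qed
    then have "f x = (\<Oplus>\<^bsub>W'\<^esub>k\<in>I. a k \<odot>\<^bsub>W'\<^esub> (b k \<odot>\<^bsub>W'\<^esub> g x))"
      using xW gW'[OF x] a_R b_R
      by (auto simp: f_def W'.smult_closed intro!: W'.finsum_cong')
    also have "\<dots> = g x" using gW'[OF x] by (intro module_decomposition W')
    finally show "restrict f (carrier (corner_omap W)) x = g x" using x by simp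
  qed (use module_homsD(4)[OF g] in auto)
  ultimately show ?thesis by blast
qed


lemma fully_faithful_corner:
  "fully_faithful (Left_Mod R) (Left_Mod B)
    (corner_functor :: (('r, 'm) module, 'm \<Rightarrow> 'm, ('b, 'm) module, 'm \<Rightarrow> 'm) func)"
proof (intro fully_faithful.intro fully_faithful_axioms.intro cat_functor_corner)
  fix W W' :: "('r, 'm) module"
  assume *: "W \<in> Obj (Left_Mod R)" "W' \<in> Obj (Left_Mod R)"
  show "bij_betw (amap corner_functor W W') (Arr (Left_Mod R) W W')
      (Arr (Left_Mod B) (omap corner_functor W) (omap corner_functor W'))"
    unfolding bij_betw_def
  proof (intro conjI inj_onI equalityI subsetI)
    fix f g assume "f \<in> Arr (Left_Mod R) W W'" "g \<in> Arr (Left_Mod R) W W'"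
      and "amap corner_functor W W' f = amap corner_functor W W' g"
    then show "f = g"
      using * by (intro hom_eq_if_eq_on_corner[of W W']) (auto simp: corner_amap restrict_def fun_eq_iff, metis)
  next
    fix g assume "g \<in> amap corner_functor W W' ` Arr (Left_Mod R) W W'"
    then show "g \<in> Arr (Left_Mod B) (omap corner_functor W) (omap corner_functor W')"
      using * by (auto simp: corner_amap omap_corner_functor corner_amap_hom)
  next
    fix g assume "g \<in> Arr (Left_Mod B) (omap corner_functor W) (omap corner_functor W')"
    then show "g \<in> amap corner_functor W W' ` Arr (Left_Mod R) W W'"
      using * hom_extends_from_corner[of W W' g]
      by (auto simp: corner_amap omap_corner_functor image_iff)
  qed
qed

end

section \<open>Induction from the corner\<close>

text \<open>
  A model of the induced module \<open>Re \<otimes> V\<close> that needs no tensor product.  In such a product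
  \<open>x = \<Sum>\<^sub>k a\<^sub>k (b\<^sub>k x)\<close> is determined by the vector of the \<open>b\<^sub>k x \<in> V\<close>, and \<open>s\<close> changes this vector by the
  matrix \<open>(b\<^sub>k s a\<^sub>l)\<close> over \<open>eRe\<close>.  Since \<open>1 = \<Sum>\<^sub>k a\<^sub>k b\<^sub>k\<close>, these matrices multiply like the elements
  \<open>s\<close>; the matrix of \<open>1\<close> is idempotent but need not be the identity matrix, so the module is its image
  on the vectors, not the set of all vectors.
\<close>

locale induced_module = full_corner R B \<psi> e I a b + V: left_module B V
  for R :: "('r, 's) ring_scheme" (structure) and B :: "('b, 't) ring_scheme" and \<psi> e
    and I :: "'i set" and a b and V :: "('b, 'm) module"
begin

definition cact :: "'r \<Rightarrow> 'm \<Rightarrow> 'm" (infixr "\<bullet>" 75) where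
  "c \<bullet> x = inv_into (carrier B) \<psi> c \<odot>\<^bsub>V\<^esub> x"

lemma \<psi>_cact: "c \<in> carrier B \<Longrightarrow> \<psi> c \<bullet> x = c \<odot>\<^bsub>V\<^esub> x"
  using \<psi>_bij by (simp add: cact_def bij_betw_def inv_into_f_f)

lemma cact_closed: "\<lbrakk>c \<in> corner; x \<in> carrier V\<rbrakk> \<Longrightarrow> c \<bullet> x \<in> carrier V"
  using \<psi>_surj[of c] by (auto simp: \<psi>_cact V.smult_closed)

lemma cact_mult:
  assumes "c \<in> corner" "d \<in> corner" "x \<in> carrier V"
  shows "c \<bullet> d \<bullet> x = (c \<otimes> d) \<bullet> x"
proof -
  obtain c' d' where *: "c' \<in> carrier B" "d' \<in> carrier B" "c = \<psi> c'" "d = \<psi> d'"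
    using \<psi>_surj assms by metis
  then have "(c \<otimes> d) \<bullet> x = (c' \<otimes>\<^bsub>B\<^esub> d') \<odot>\<^bsub>V\<^esub> x"
    using B_closed by (simp add: \<psi>_cact flip: \<psi>_mult)
  then show ?thesis using * assms by (simp add: \<psi>_cact V.smult_assoc)
qed

lemma cact_add_left:
  assumes "c \<in> corner" "d \<in> corner" "x \<in> carrier V"
  shows "(c \<oplus> d) \<bullet> x = c \<bullet> x \<oplus>\<^bsub>V\<^esub> d \<bullet> x"
proof -
  obtain c' d' where *: "c' \<in> carrier B" "d' \<in> carrier B" "c = \<psi> c'" "d = \<psi> d'"
    using \<psi>_surj assms by metis
  then have "(c \<oplus> d) \<bullet> x = (c' \<oplus>\<^bsub>B\<^esub> d') \<odot>\<^bsub>V\<^esub> x"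
    using B_closed by (simp add: \<psi>_cact flip: \<psi>_add)
  then show ?thesis using * assms by (simp add: \<psi>_cact V.smult_l_distr)
qed

lemma cact_add_right:
  "\<lbrakk>c \<in> corner; x \<in> carrier V; y \<in> carrier V\<rbrakk> \<Longrightarrow> c \<bullet> (x \<oplus>\<^bsub>V\<^esub> y) = c \<bullet> x \<oplus>\<^bsub>V\<^esub> c \<bullet> y"
  using \<psi>_surj[of c] by (auto simp: \<psi>_cact V.smult_r_distr)

lemma cact_e: "x \<in> carrier V \<Longrightarrow> e \<bullet> x = x"
  using \<psi>_cact[OF B_closed(1)] by (simp add: \<psi>_one V.smult_one)

lemma cact_zero: "x \<in> carrier V \<Longrightarrow> \<zero> \<bullet> x = \<zero>\<^bsub>V\<^esub>"
  using \<psi>_cact[OF B_closed(2)] by (simp add: \<psi>_zero V.smult_l_null)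

lemma cact_finsum_right:
  assumes "finite J" "c \<in> corner" "g \<in> J \<rightarrow> carrier V"
  shows "c \<bullet> finsum V g J = (\<Oplus>\<^bsub>V\<^esub>j\<in>J. c \<bullet> g j)"
  using assms V.M.abelian_group_axioms by (intro finsum_hom) (auto simp: cact_closed cact_add_right)

lemma cact_finsum_left:
  assumes J: "finite J" "g \<in> J \<rightarrow> corner" and x: "x \<in> carrier V"
  shows "finsum R g J \<in> corner \<and> finsum R g J \<bullet> x = (\<Oplus>\<^bsub>V\<^esub>j\<in>J. g j \<bullet> x)"
  using J
proof (induction J)
  case (insert j J)
  then have "g \<in> J \<rightarrow> carrier R" "g j \<in> carrier R" "(\<lambda>j. g j \<bullet> x) \<in> J \<rightarrow> carrier V" "g j \<bullet> x \<in> carrier V"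
    using cornerD x cact_closed by (auto simp: Pi_def)
  then show ?case using insert x by (simp add: corner_closed cact_add_left)
qed (simp add: corner_closed x cact_zero)

lemma bsa_corner: "\<lbrakk>k \<in> I; s \<in> carrier R; l \<in> I\<rbrakk> \<Longrightarrow> b k \<otimes> s \<otimes> a l \<in> corner"
  using a_R b_R e_closed by (intro corner_sandwich) (auto simp: a_e e_b simp flip: R.m_assoc)

text \<open>
  The sum \<open>\<Sum>\<^sub>l a\<^sub>l b\<^sub>l = 1\<close> in the middle is what makes the matrices multiplicative.
\<close>

lemma bsa_mult:
  assumes "k \<in> I" "m \<in> I" "s \<in> carrier R" "t \<in> carrier R"
  shows "(\<Oplus>l\<in>I. (b k \<otimes> s \<otimes> a l) \<otimes> (b l \<otimes> t \<otimes> a m)) = b k \<otimes> (s \<otimes> t) \<otimes> a m"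
proof -
  have "(\<Oplus>l\<in>I. (b k \<otimes> s \<otimes> a l) \<otimes> (b l \<otimes> t \<otimes> a m)) =
      (\<Oplus>l\<in>I. (b k \<otimes> s) \<otimes> (a l \<otimes> b l) \<otimes> (t \<otimes> a m))"
    using assms a_R b_R by (intro R.finsum_cong') (auto simp: R.m_assoc)
  also have "\<dots> = (b k \<otimes> s) \<otimes> (\<Oplus>l\<in>I. a l \<otimes> b l) \<otimes> (t \<otimes> a m)"
    using assms a_R b_R finite_I by (simp add: R.finsum_ldistr R.finsum_rdistr Pi_def)
  finally show ?thesis using assms a_R b_R by (simp add: sum_ab R.m_assoc)
qed

definition mat :: "'r \<Rightarrow> ('i \<Rightarrow> 'm) \<Rightarrow> 'i \<Rightarrow> 'm" where
  "mat s v = (\<lambda>k\<in>I. \<Oplus>\<^bsub>V\<^esub>l\<in>I. (b k \<otimes> s \<otimes> a l) \<bullet> v l)"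

abbreviation "vecs \<equiv> I \<rightarrow>\<^sub>E carrier V"

definition vadd :: "('i \<Rightarrow> 'm) \<Rightarrow> ('i \<Rightarrow> 'm) \<Rightarrow> 'i \<Rightarrow> 'm" where
  "vadd v w = (\<lambda>k\<in>I. v k \<oplus>\<^bsub>V\<^esub> w k)"

definition vzero :: "'i \<Rightarrow> 'm" where "vzero = (\<lambda>k\<in>I. \<zero>\<^bsub>V\<^esub>)"

lemma mat_term_closed: "\<lbrakk>k \<in> I; l \<in> I; s \<in> carrier R; v \<in> vecs\<rbrakk> \<Longrightarrow> (b k \<otimes> s \<otimes> a l) \<bullet> v l \<in> carrier V"
  by (intro cact_closed bsa_corner) auto

lemma mat_closed: "\<lbrakk>s \<in> carrier R; v \<in> vecs\<rbrakk> \<Longrightarrow> mat s v \<in> vecs"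
  by (auto simp: mat_def intro!: V.M.finsum_closed mat_term_closed)

lemma mat_mult:
  assumes s: "s \<in> carrier R" and t: "t \<in> carrier R" and v: "v \<in> vecs"
  shows "mat s (mat t v) = mat (s \<otimes> t) v"
proof (rule extensionalityI[of _ I])
  fix k assume k: "k \<in> I"
  let ?c = "\<lambda>l m. (b k \<otimes> s \<otimes> a l) \<otimes> (b l \<otimes> t \<otimes> a m)"
  have cv: "?c l m \<bullet> v m \<in> carrier V" if "l \<in> I" "m \<in> I" for l m
    using that k s t v by (intro cact_closed corner_closed bsa_corner) auto
  have "(b k \<otimes> s \<otimes> a l) \<bullet> mat t v l = (\<Oplus>\<^bsub>V\<^esub>m\<in>I. ?c l m \<bullet> v m)" if l: "l \<in> I" for l
  proof -
    have "(b k \<otimes> s \<otimes> a l) \<bullet> mat t v l = (\<Oplus>\<^bsub>V\<^esub>m\<in>I. (b k \<otimes> s \<otimes> a l) \<bullet> (b l \<otimes> t \<otimes> a m) \<bullet> v m)"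
      using l k s t v by (simp add: mat_def, intro cact_finsum_right finite_I bsa_corner)
        (auto intro: mat_term_closed)
    also have "\<dots> = (\<Oplus>\<^bsub>V\<^esub>m\<in>I. ?c l m \<bullet> v m)"
      using l k s t v cv by (intro V.M.finsum_cong' cact_mult bsa_corner) auto
    finally show ?thesis .
  qed
  then have "mat s (mat t v) k = (\<Oplus>\<^bsub>V\<^esub>l\<in>I. \<Oplus>\<^bsub>V\<^esub>m\<in>I. ?c l m \<bullet> v m)"
    using k cv by (simp add: mat_def[of s], intro V.M.finsum_cong') (auto intro!: V.M.finsum_closed)
  also have "\<dots> = (\<Oplus>\<^bsub>V\<^esub>m\<in>I. \<Oplus>\<^bsub>V\<^esub>l\<in>I. ?c l m \<bullet> v m)"
    by (intro V.M.finsum_swap finite_I cv)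
  also have "\<dots> = (\<Oplus>\<^bsub>V\<^esub>m\<in>I. (\<Oplus>l\<in>I. ?c l m) \<bullet> v m)"
  proof (intro V.M.finsum_cong' refl)
    fix m assume m: "m \<in> I"
    show "(\<Oplus>\<^bsub>V\<^esub>l\<in>I. ?c l m \<bullet> v m) = (\<Oplus>l\<in>I. ?c l m) \<bullet> v m"
      using k s t v m
      by (intro conjunct2[OF cact_finsum_left, symmetric] finite_I)
        (auto intro: corner_closed(3)[OF bsa_corner bsa_corner])
  qed (use k s t v in \<open>auto simp: bsa_mult intro!: mat_term_closed\<close>)
  also have "\<dots> = mat (s \<otimes> t) v k"
    using k s t v by (simp add: mat_def, intro V.M.finsum_cong')
      (auto simp: bsa_mult intro!: mat_term_closed)
  finally show "mat s (mat t v) k = mat (s \<otimes> t) v k" .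
qed (auto simp: mat_def)

lemma mat_add_left:
  assumes "s \<in> carrier R" "t \<in> carrier R" "v \<in> vecs"
  shows "mat (s \<oplus> t) v = vadd (mat s v) (mat t v)"
proof (rule extensionalityI[of _ I])
  fix k assume k: "k \<in> I"
  have "mat (s \<oplus> t) v k = (\<Oplus>\<^bsub>V\<^esub>l\<in>I. (b k \<otimes> s \<otimes> a l) \<bullet> v l \<oplus>\<^bsub>V\<^esub> (b k \<otimes> t \<otimes> a l) \<bullet> v l)"
    using k assms PiE_mem[OF assms(3)] by (simp add: mat_def, intro V.M.finsum_cong')
      (auto simp: a_R b_R R.l_distr R.r_distr cact_add_left bsa_corner cact_closed)
  also have "\<dots> = vadd (mat s v) (mat t v) k"
    using k assms by (simp add: mat_def vadd_def, intro V.M.finsum_addf) (auto intro!: mat_term_closed)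
  finally show "mat (s \<oplus> t) v k = vadd (mat s v) (mat t v) k" .
qed (auto simp: mat_def vadd_def)

lemma mat_add_right:
  assumes "s \<in> carrier R" "v \<in> vecs" "w \<in> vecs"
  shows "mat s (vadd v w) = vadd (mat s v) (mat s w)"
proof (rule extensionalityI[of _ I])
  fix k assume k: "k \<in> I"
  have "mat s (vadd v w) k = (\<Oplus>\<^bsub>V\<^esub>l\<in>I. (b k \<otimes> s \<otimes> a l) \<bullet> v l \<oplus>\<^bsub>V\<^esub> (b k \<otimes> s \<otimes> a l) \<bullet> w l)"
    using k assms PiE_mem[OF assms(2)] PiE_mem[OF assms(3)]
    by (simp add: mat_def vadd_def, intro V.M.finsum_cong')
      (auto simp: cact_add_right bsa_corner cact_closed)
  also have "\<dots> = vadd (mat s v) (mat s w) k"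
    using k assms by (simp add: mat_def vadd_def, intro V.M.finsum_addf) (auto intro!: mat_term_closed)
  finally show "mat s (vadd v w) k = vadd (mat s v) (mat s w) k" .
qed (auto simp: mat_def vadd_def)

lemma mat_zero: "v \<in> vecs \<Longrightarrow> mat \<zero> v = vzero"
  using PiE_mem[of v I "\<lambda>_. carrier V"]
  by (auto simp: mat_def vzero_def fun_eq_iff a_R b_R cact_zero intro!: V.M.add.finprod_one_eqI)

definition induced :: "('r, 'i \<Rightarrow> 'm) module" where
  "induced = \<lparr>carrier = {v \<in> vecs. mat \<one> v = v}, mult = undefined, one = undefined,
    zero = vzero, add = vadd, smult = mat\<rparr>"

lemma induced_simps:
  "v \<in> carrier induced \<longleftrightarrow> v \<in> vecs \<and> mat \<one> v = v"
  "\<zero>\<^bsub>induced\<^esub> = vzero" "v \<oplus>\<^bsub>induced\<^esub> w = vadd v w" "s \<odot>\<^bsub>induced\<^esub> v = mat s v"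
  by (simp_all add: induced_def)

lemma vadd_closed: "\<lbrakk>v \<in> vecs; w \<in> vecs\<rbrakk> \<Longrightarrow> vadd v w \<in> vecs"
  by (auto simp: vadd_def)

lemma vzero_closed: "vzero \<in> vecs"
  by (auto simp: vzero_def)

lemma vadd_vzero: "v \<in> vecs \<Longrightarrow> vadd vzero v = v"
  using PiE_mem[of v I "\<lambda>_. carrier V"]
  by (intro extensionalityI[of _ I]) (auto simp: vadd_def vzero_def PiE_def)

lemma vadd_comm: "\<lbrakk>v \<in> vecs; w \<in> vecs\<rbrakk> \<Longrightarrow> vadd v w = vadd w v"
  unfolding vadd_def by (rule restrict_ext, rule V.M.a_comm) auto

lemma vadd_assoc: "\<lbrakk>u \<in> vecs; v \<in> vecs; w \<in> vecs\<rbrakk> \<Longrightarrow> vadd (vadd u v) w = vadd u (vadd v w)"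
  unfolding vadd_def by (rule restrict_ext, simp, rule V.M.a_assoc) auto

text \<open>
  All axioms are identities between matrices acting on vectors.  Negatives come for free as the
  action of \<open>-1\<close>.
\<close>

lemma left_module_induced: "left_module R induced"
proof (intro left_module.intro left_module_axioms.intro R.ring_axioms abelian_groupI;
    (unfold induced_simps)?)
  fix u assume u: "u \<in> vecs \<and> mat \<one> u = u"
  \<comment> \<open>\<open>u\<close> is fixed by the action of \<open>1\<close>, so adding the action of \<open>-1\<close> to it gives the action of \<open>0\<close>\<close>
  have "vadd (mat (\<ominus> \<one>) u) u = vadd (mat (\<ominus> \<one>) u) (mat \<one> u)" using u by simp
  also have "\<dots> = mat (\<ominus> \<one> \<oplus> \<one>) u" using u by (intro mat_add_left[symmetric]) auto
  also have "\<dots> = vzero" using u by (simp add: R.l_neg mat_zero)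
  finally have "vadd (mat (\<ominus> \<one>) u) u = vzero" .
  moreover have "mat (\<ominus> \<one>) u \<in> carrier induced"
    using u by (simp add: induced_simps mat_mult mat_closed del: PiE_iff)
  ultimately show "\<exists>v\<in>carrier induced. vadd v u = vzero" by blast
next
  show "vzero \<in> vecs \<and> mat \<one> vzero = vzero"
    using vzero_closed mat_mult[of \<one> \<zero> vzero] by (simp add: mat_zero)
qed (auto simp: mat_mult mat_closed mat_add_left mat_add_right vadd_closed vadd_vzero vadd_assoc
    intro: vadd_comm simp del: PiE_iff)

definition unit_map :: "'m \<Rightarrow> 'i \<Rightarrow> 'm" where
  "unit_map x = (\<lambda>k\<in>I. (b k \<otimes> e) \<bullet> x)"

definition counit_map :: "('i \<Rightarrow> 'm) \<Rightarrow> 'm" where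
  "counit_map v = (\<Oplus>\<^bsub>V\<^esub>l\<in>I. (e \<otimes> a l) \<bullet> v l)"

lemma be_corner: "k \<in> I \<Longrightarrow> b k \<otimes> e \<in> corner" and ea_corner: "k \<in> I \<Longrightarrow> e \<otimes> a k \<in> corner"
  using a_R b_R e_closed by (auto intro!: corner_sandwich simp: a_e e_b e_idem)

lemma unit_map_closed: "x \<in> carrier V \<Longrightarrow> unit_map x \<in> vecs"
  by (auto simp: unit_map_def be_corner cact_closed)

lemma mat_unit_map:
  assumes s: "s \<in> carrier R" and x: "x \<in> carrier V"
  shows "mat s (unit_map x) = (\<lambda>k\<in>I. (b k \<otimes> s \<otimes> e) \<bullet> x)"
proof (rule extensionalityI[of _ I])
  fix k assume k: "k \<in> I"
  have *: "(b k \<otimes> s \<otimes> a l) \<otimes> (b l \<otimes> e) \<in> corner" if "l \<in> I" for l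
    using that k s by (intro corner_closed bsa_corner be_corner)
  have "mat s (unit_map x) k = (\<Oplus>\<^bsub>V\<^esub>l\<in>I. ((b k \<otimes> s \<otimes> a l) \<otimes> (b l \<otimes> e)) \<bullet> x)"
    using k s x * by (simp add: mat_def, intro V.M.finsum_cong')
      (auto simp: unit_map_def bsa_corner be_corner cact_mult cact_closed)
  also have "\<dots> = (\<Oplus>l\<in>I. (b k \<otimes> s \<otimes> a l) \<otimes> (b l \<otimes> e)) \<bullet> x"
    using * x by (intro conjunct2[OF cact_finsum_left, symmetric] finite_I) auto
  also have "(\<Oplus>l\<in>I. (b k \<otimes> s \<otimes> a l) \<otimes> (b l \<otimes> e)) = (\<Oplus>l\<in>I. (b k \<otimes> s) \<otimes> (a l \<otimes> b l) \<otimes> e)"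
    using k s a_R b_R e_closed by (intro R.finsum_cong') (auto simp: R.m_assoc)
  also have "\<dots> = (b k \<otimes> s) \<otimes> (\<Oplus>l\<in>I. a l \<otimes> b l) \<otimes> e"
    using k s a_R b_R e_closed finite_I by (simp add: R.finsum_ldistr R.finsum_rdistr Pi_def)
  finally show "mat s (unit_map x) k = (\<lambda>k\<in>I. (b k \<otimes> s \<otimes> e) \<bullet> x) k"
    using k s b_R e_closed by (simp add: sum_ab)
qed (auto simp: mat_def)

text \<open>
  The corner of the induced module consists of its vectors fixed by the matrix of \<open>e\<close>, so there this
  composite is the identity.
\<close>

lemma unit_map_counit_map:
  assumes v: "v \<in> vecs"
  shows "unit_map (counit_map v) = mat e v"
proof (rule extensionalityI[of _ I])
  fix k assume k: "k \<in> I"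
  have ea: "(e \<otimes> a l) \<bullet> v l \<in> carrier V" if "l \<in> I" for l
    using that v ea_corner by (intro cact_closed) auto
  have "unit_map (counit_map v) k = (\<Oplus>\<^bsub>V\<^esub>l\<in>I. (b k \<otimes> e) \<bullet> (e \<otimes> a l) \<bullet> v l)"
    using k ea by (simp add: unit_map_def counit_map_def, intro cact_finsum_right finite_I be_corner) auto
  also have "\<dots> = (\<Oplus>\<^bsub>V\<^esub>l\<in>I. (b k \<otimes> e \<otimes> a l) \<bullet> v l)"
  proof (intro V.M.finsum_cong' refl)
    fix l assume l: "l \<in> I"
    have "(b k \<otimes> e) \<otimes> (e \<otimes> a l) = b k \<otimes> (e \<otimes> e) \<otimes> a l"
      using k l a_R b_R e_closed by (simp only: R.m_assoc R.m_closed)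
    then show "(b k \<otimes> e) \<bullet> (e \<otimes> a l) \<bullet> v l = (b k \<otimes> e \<otimes> a l) \<bullet> v l"
      using k l v be_corner ea_corner by (subst cact_mult) (auto simp: e_idem)
  qed (use k v e_closed in \<open>auto intro!: mat_term_closed\<close>)
  finally show "unit_map (counit_map v) k = mat e v k" using k by (simp add: mat_def)
qed (auto simp: mat_def unit_map_def)

lemma counit_map_unit_map:
  assumes x: "x \<in> carrier V"
  shows "counit_map (unit_map x) = x"
proof -
  have *: "(e \<otimes> a l) \<otimes> (b l \<otimes> e) \<in> corner" if "l \<in> I" for l
    using that by (intro corner_closed be_corner ea_corner)
  have "counit_map (unit_map x) = (\<Oplus>\<^bsub>V\<^esub>l\<in>I. ((e \<otimes> a l) \<otimes> (b l \<otimes> e)) \<bullet> x)"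
    using x * unfolding counit_map_def
    by (intro V.M.finsum_cong') (auto simp: unit_map_def ea_corner be_corner cact_mult cact_closed)
  also have "\<dots> = (\<Oplus>l\<in>I. (e \<otimes> a l) \<otimes> (b l \<otimes> e)) \<bullet> x"
    using * x by (intro conjunct2[OF cact_finsum_left, symmetric] finite_I) auto
  also have "(\<Oplus>l\<in>I. (e \<otimes> a l) \<otimes> (b l \<otimes> e)) = (\<Oplus>l\<in>I. e \<otimes> (a l \<otimes> b l) \<otimes> e)"
    using a_R b_R e_closed by (intro R.finsum_cong') (auto simp: R.m_assoc)
  also have "\<dots> = e \<otimes> (\<Oplus>l\<in>I. a l \<otimes> b l) \<otimes> e"
    using a_R b_R e_closed finite_I by (simp add: R.finsum_ldistr R.finsum_rdistr Pi_def)
  also have "\<dots> = e" using e_closed by (simp add: sum_ab e_idem)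
  finally show ?thesis using x by (simp add: cact_e)
qed

lemma counit_map_closed: "v \<in> vecs \<Longrightarrow> counit_map v \<in> carrier V"
  using ea_corner by (auto simp: counit_map_def intro!: V.M.finsum_closed cact_closed)

lemma unit_map_add:
  "\<lbrakk>x \<in> carrier V; y \<in> carrier V\<rbrakk> \<Longrightarrow> unit_map (x \<oplus>\<^bsub>V\<^esub> y) = vadd (unit_map x) (unit_map y)"
  by (auto simp: unit_map_def vadd_def fun_eq_iff be_corner cact_add_right)

lemma unit_map_smult:
  assumes c: "c \<in> carrier B" and x: "x \<in> carrier V"
  shows "unit_map (c \<odot>\<^bsub>V\<^esub> x) = mat (\<psi> c) (unit_map x)"
proof (rule extensionalityI[of _ I])
  fix k assume k: "k \<in> I"
  have \<psi>: "\<psi> c \<in> corner" using c by (rule \<psi>_closed)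
  have "unit_map (c \<odot>\<^bsub>V\<^esub> x) k = (b k \<otimes> e) \<bullet> \<psi> c \<bullet> x"
    using k c by (simp add: unit_map_def \<psi>_cact)
  also have "\<dots> = (b k \<otimes> e \<otimes> \<psi> c) \<bullet> x" using k \<psi> x by (intro cact_mult be_corner)
  also have "b k \<otimes> e \<otimes> \<psi> c = b k \<otimes> \<psi> c \<otimes> e"
    using k e_closed b_R cornerD[OF \<psi>] by (simp add: R.m_assoc)
  finally show "unit_map (c \<odot>\<^bsub>V\<^esub> x) k = mat (\<psi> c) (unit_map x) k"
    using k c x by (simp add: mat_unit_map \<psi>_R)
qed (auto simp: unit_map_def mat_def)

text \<open>
  The map \<open>x \<mapsto> (b\<^sub>k e x)\<^sub>k\<close> identifies \<open>V\<close> with the corner of its induced module.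
\<close>

lemma induced_module_corner_iso:
  fixes j :: "('i \<Rightarrow> 'm) \<Rightarrow> 'm"
  assumes j: "inj_on j vecs"
  shows "\<exists>W. left_module R W \<and> (\<exists>h. iso_arrow (Left_Mod B) (corner_omap W) V h)"
proof -
  define W where "W = transport_module j induced"
  have ind: "carrier induced = {v \<in> vecs. mat \<one> v = v}"
    "smult induced = mat" "add induced = vadd" by (simp_all add: induced_def)
  have j': "inj_on j (carrier induced)"
    using j by (rule inj_on_subset) (auto simp: ind)
  note ts = transport_module_simps[OF j', folded W_def, unfolded ind(2,3)]
  have W: "left_module R W"
    unfolding W_def by (intro left_module_transport left_module_induced j')
  have u_ind: "unit_map x \<in> carrier induced" and u_e: "mat e (unit_map x) = unit_map x"
    if "x \<in> carrier V" for x
    using that b_R e_closed unit_map_closed[OF that]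
    by (auto simp: ind mat_unit_map e_idem R.m_assoc) (auto simp: unit_map_def fun_eq_iff e_idem R.m_assoc)
  have cW: "carrier (corner_omap W) = (\<lambda>x. j (unit_map x)) ` carrier V" (is "?l = ?r")
  proof (intro equalityI subsetI)
    fix y assume "y \<in> ?l"
    then obtain v where v: "v \<in> carrier induced" "y = j v" "j (mat e v) = j v"
      using W by (auto simp: carrier_corner_omap ts)
    have "mat e v \<in> carrier induced"
      using left_moduleD(2)[OF left_module_induced e_closed v(1)] by (simp add: ind)
    then have "mat e v = v" using v j' by (simp add: inj_on_def)
    moreover have "v \<in> vecs" using v by (simp add: ind)
    ultimately show "y \<in> ?r"
      using v(2) unit_map_counit_map[of v] counit_map_closed[of v] by (intro image_eqI[of _ _ "counit_map v"]) auto
  next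
    fix y assume "y \<in> ?r"
    then show "y \<in> ?l" using u_ind u_e by (auto simp: carrier_corner_omap[OF W] ts)
  qed
  define f where "f = (\<lambda>x\<in>carrier V. j (unit_map x))"
  have f_hom: "f \<in> module_homs B V (corner_omap W)"
    by (intro module_homsI)
      (auto simp: f_def cW corner_omap_simps ts u_ind unit_map_add unit_map_smult V.smult_closed)
  have "inj_on f (carrier V)"
  proof (rule inj_onI)
    fix x y assume xy: "x \<in> carrier V" "y \<in> carrier V" "f x = f y"
    then have "unit_map x = unit_map y" using j' u_ind by (auto simp: f_def inj_on_def)
    then show "x = y" using xy counit_map_unit_map by metis
  qed
  then have "bij_betw f (carrier V) (carrier (corner_omap W))"
    by (auto simp: bij_betw_def cW f_def)
  from iso_arrow_inverse_of_bij_hom[OF V.left_module_axioms f_hom this] W show ?thesis by blast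
qed

end

text \<open>
  Module categories over a fixed type contain only modules that fit into the type.  The
  assumption \<open>large\<close> provides the space that the induced modules take up.
\<close>

theorem (in full_corner) equivalence_corner:
  assumes large: "\<And>V :: ('b, 'm) module. left_module B V \<Longrightarrow> \<exists>j :: ('i \<Rightarrow> 'm) \<Rightarrow> 'm. inj_on j (I \<rightarrow>\<^sub>E carrier V)"
  shows "equivalence_of_categories (Left_Mod R) (Left_Mod B)
    (corner_functor :: (('r, 'm) module, 'm \<Rightarrow> 'm, ('b, 'm) module, 'm \<Rightarrow> 'm) func)"
proof (rule fully_faithful.equivalence_if_essentially_surjective[OF fully_faithful_corner])
  fix V :: "('b, 'm) module" assume "V \<in> Obj (Left_Mod B)"
  then have V: "left_module B V" by simp
  then interpret induced_module R B \<psi> e I a b V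
    by (intro induced_module.intro full_corner_axioms)
  obtain j :: "('i \<Rightarrow> 'm) \<Rightarrow> 'm" where "inj_on j vecs" using large[OF V] by blast
  from induced_module_corner_iso[OF this]
  show "\<exists>W\<in>Obj (Left_Mod R). \<exists>h. iso_arrow (Left_Mod B) (omap corner_functor W) V h"
    by (auto simp: omap_corner_functor)
qed

section \<open>The extended affine Weyl group acting on tuples\<close>

lemma weyl_carrier:
  "w \<in> carrier (ext_affine_weyl r) \<longleftrightarrow> fst w permutes {1..r} \<and> snd w \<in> tuples r"
  by (cases w) (simp add: ext_affine_weyl_def sym_group_carrier)

lemma weyl_mult:
  "v \<otimes>\<^bsub>ext_affine_weyl r\<^esub> w = (fst v \<circ> fst w, \<lambda>t\<in>{1..r}. snd v (fst w t) + snd w t)"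
  by (cases v; cases w) (simp add: ext_affine_weyl_def sym_group_mult)

lemma weyl_one: "\<one>\<^bsub>ext_affine_weyl r\<^esub> = (id, \<lambda>t\<in>{1..r}. 0)"
  by (simp add: ext_affine_weyl_def sym_group_one)

lemma tuples_ext: "\<lbrakk>i \<in> tuples r; j \<in> tuples r; \<And>t. t \<in> {1..r} \<Longrightarrow> i t = j t\<rbrakk> \<Longrightarrow> i = j"
  unfolding tuples_def by (rule PiE_ext)

lemma restrict_tuples [simp]: "restrict f {1..r} \<in> tuples r" "restrict f {Suc 0..r} \<in> tuples r"
  by (simp_all add: tuples_def)

lemma permutes_le:
  "\<lbrakk>\<sigma> permutes {Suc 0..r}; Suc 0 \<le> t; t \<le> r\<rbrakk> \<Longrightarrow> Suc 0 \<le> \<sigma> t \<and> \<sigma> t \<le> r"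
  using permutes_in_image[of \<sigma> "{Suc 0..r}" t] by auto

lemma group_weyl: "group (ext_affine_weyl r)" (is "group ?G")
proof (rule groupI)
  fix v assume v: "v \<in> carrier ?G"
  show "\<one>\<^bsub>?G\<^esub> \<otimes>\<^bsub>?G\<^esub> v = v"
    using v by (intro prod_eqI tuples_ext[of _ r])
      (auto simp: weyl_carrier weyl_mult weyl_one dest: permutes_le)
  let ?\<sigma> = "fst v"
  \<comment> \<open>the inverse of the product \<open>\<sigma>\<epsilon>\<close> is \<open>(-\<epsilon>)\<sigma>\<^sup>-\<^sup>1\<close>, and moving the shift to the right permutes it\<close>
  define w where "w = (inv_into UNIV ?\<sigma>, \<lambda>t\<in>{1..r}. - snd v (inv_into UNIV ?\<sigma> t))"
  have \<sigma>: "?\<sigma> permutes {1..r}" using v by (simp add: weyl_carrier)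
  have "w \<in> carrier ?G" using \<sigma> by (simp add: w_def weyl_carrier permutes_inv)
  moreover have "w \<otimes>\<^bsub>?G\<^esub> v = \<one>\<^bsub>?G\<^esub>"
    using \<sigma> permutes_inverses[OF \<sigma>] permutes_inv_o[OF \<sigma>]
    by (intro prod_eqI tuples_ext[of _ r]) (auto simp: weyl_mult weyl_one w_def permutes_le)
  ultimately show "\<exists>w\<in>carrier ?G. w \<otimes>\<^bsub>?G\<^esub> v = \<one>\<^bsub>?G\<^esub>" by blast
  fix w assume w: "w \<in> carrier ?G"
  show "v \<otimes>\<^bsub>?G\<^esub> w \<in> carrier ?G"
    using v w by (simp add: weyl_carrier weyl_mult permutes_compose)
  fix x assume x: "x \<in> carrier ?G"
  show "v \<otimes>\<^bsub>?G\<^esub> w \<otimes>\<^bsub>?G\<^esub> x = v \<otimes>\<^bsub>?G\<^esub> (w \<otimes>\<^bsub>?G\<^esub> x)"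
    using x
    by (intro prod_eqI tuples_ext[of _ r]) (auto simp: weyl_carrier weyl_mult o_assoc permutes_le)
qed (auto simp: weyl_carrier weyl_one permutes_id)

locale schur_data =
  fixes n r :: nat
  assumes n_pos: "0 < n"
begin

abbreviation "G \<equiv> ext_affine_weyl r"
abbreviation "T \<equiv> tuples r"
abbreviation "ac \<equiv> act n r"

sublocale G: group G by (rule group_weyl)

lemma act_closed [simp]: "ac i w \<in> T"
  by (simp add: act_def)

lemma act_one: "i \<in> T \<Longrightarrow> ac i \<one>\<^bsub>G\<^esub> = i"
  by (rule tuples_ext[of _ r]) (auto simp: act_def weyl_one)

lemma act_mult: "w \<in> carrier G \<Longrightarrow> ac (ac i v) w = ac i (v \<otimes>\<^bsub>G\<^esub> w)"
  by (intro tuples_ext[of _ r]) (auto simp: act_def weyl_mult weyl_carrier permutes_le algebra_simps)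

lemma act_inv: "\<lbrakk>i \<in> T; w \<in> carrier G\<rbrakk> \<Longrightarrow> ac (ac i w) (inv\<^bsub>G\<^esub> w) = i"
  "\<lbrakk>i \<in> T; w \<in> carrier G\<rbrakk> \<Longrightarrow> ac (ac i (inv\<^bsub>G\<^esub> w)) w = i"
  by (simp_all add: act_mult act_one)

lemma act_cancel: "\<lbrakk>i \<in> T; j \<in> T; w \<in> carrier G\<rbrakk> \<Longrightarrow> ac i w = ac j w \<longleftrightarrow> i = j"
  by (metis act_inv(1))

text \<open>
  The shift of a transporting element is determined by its permutation because \<open>n > 0\<close>.  All sums in
  the convolution algebra are finite for this reason.
\<close>

lemma finite_transporter: "finite {w \<in> carrier G. ac i w = j}"
proof -
  let ?h = "\<lambda>\<sigma>. (\<sigma>, \<lambda>t\<in>{1..r}. (j t - i (\<sigma> t)) div int n)"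
  have "w = ?h (fst w)" if "w \<in> carrier G" "ac i w = j" for w
    using that n_pos
    by (intro prod_eqI tuples_ext[of _ r]) (auto simp: weyl_carrier act_def)
  then have "{w \<in> carrier G. ac i w = j} \<subseteq> ?h ` {\<sigma>. \<sigma> permutes {1..r}}"
    by (auto simp: weyl_carrier intro!: image_eqI)
  then show ?thesis by (rule finite_subset) (simp add: finite_permutations)
qed

section \<open>The affine Schur algebra as a convolution algebra\<close>

definition orb :: "(nat \<Rightarrow> int) \<Rightarrow> (nat \<Rightarrow> int) \<Rightarrow> tuple_pair set" where
  "orb p q = same_orbit n r `` {(p, q)}"

lemma same_orbit_iff:
  "((i, j), (k, l)) \<in> same_orbit n r \<longleftrightarrow>
    i \<in> T \<and> j \<in> T \<and> (\<exists>w \<in> carrier G. k = ac i w \<and> l = ac j w)"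
  by (simp add: same_orbit_def)

lemma equiv_same_orbit: "equiv (T \<times> T) (same_orbit n r)"
proof (rule equivI)
  show "same_orbit n r \<subseteq> (T \<times> T) \<times> (T \<times> T)" by (auto simp: same_orbit_def)
  show "refl_on (T \<times> T) (same_orbit n r)"
    by (auto simp: refl_on_def same_orbit_def act_one intro!: bexI[of _ "\<one>\<^bsub>G\<^esub>"])
  show "sym (same_orbit n r)"
    unfolding sym_def by (force simp: same_orbit_def act_inv intro: bexI[OF _ G.inv_closed])
  show "trans (same_orbit n r)"
    unfolding trans_def by (force simp: same_orbit_def act_mult)
qed

lemma orb_eq_iff:
  assumes "p \<in> T" "q \<in> T" "p' \<in> T" "q' \<in> T"
  shows "orb p q = orb p' q' \<longleftrightarrow> (\<exists>w \<in> carrier G. p' = ac p w \<and> q' = ac q w)"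
  using eq_equiv_class_iff[OF equiv_same_orbit, of "(p, q)" "(p', q')"] assms
  by (simp add: orb_def same_orbit_iff)

lemma orb_act: "\<lbrakk>p \<in> T; q \<in> T; w \<in> carrier G\<rbrakk> \<Longrightarrow> orb (ac p w) (ac q w) = orb p q"
  using orb_eq_iff[of p q "ac p w" "ac q w"] by auto

lemma same_orbit_orb:
  assumes "p \<in> T" "q \<in> T" "p' \<in> T" "q' \<in> T"
  shows "((p, q), (p', q')) \<in> same_orbit n r \<longleftrightarrow> orb p q = orb p' q'"
  using orb_eq_iff[OF assms] assms by (simp add: same_orbit_iff)

lemma orb_closed: "\<lbrakk>p \<in> T; q \<in> T\<rbrakk> \<Longrightarrow> orb p q \<in> pair_orbits n r"
  by (auto simp: orb_def pair_orbits_def intro!: quotientI)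

lemma pair_orbitsE:
  assumes "A \<in> pair_orbits n r"
  obtains p q where "p \<in> T" "q \<in> T" "A = orb p q" "orbit_rep A = (p, q)"
proof -
  obtain i j where ij: "i \<in> T" "j \<in> T" "A = orb i j"
    using assms by (auto simp: pair_orbits_def orb_def elim!: quotientE)
  then have "(i, j) \<in> A"
    using equiv_class_self[OF equiv_same_orbit, of "(i, j)"] by (simp add: orb_def)
  then have "orbit_rep A \<in> A" unfolding orbit_rep_def by (rule someI)
  moreover obtain p q where pq: "orbit_rep A = (p, q)" by fastforce
  ultimately have *: "((i, j), (p, q)) \<in> same_orbit n r" using ij by (simp add: orb_def)
  then have "p \<in> T" "q \<in> T" by (auto simp: same_orbit_iff)
  moreover from this * ij have "A = orb p q" by (simp add: same_orbit_orb)
  ultimately show thesis using that pq by blast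
qed

lemma finite_orb_right: "p \<in> T \<Longrightarrow> finite {s \<in> T. orb p s = A}"
proof (cases "\<exists>s0 \<in> T. orb p s0 = A")
  case True
  then obtain s0 where s0: "s0 \<in> T" "orb p s0 = A" by blast
  assume p: "p \<in> T"
  have "{s \<in> T. orb p s = A} \<subseteq> ac s0 ` {w \<in> carrier G. ac p w = p}"
  proof clarify
    fix s assume "s \<in> T" "A = orb p s"
    then obtain w where "w \<in> carrier G" "p = ac p w" "s = ac s0 w"
      using p s0 by (auto simp: orb_eq_iff)
    then show "s \<in> ac s0 ` {w \<in> carrier G. ac p w = p}" by auto
  qed
  then show ?thesis by (rule finite_subset) (simp add: finite_transporter)
next
  case False
  then have "{s \<in> T. orb p s = A} = {}" by blast
  then show ?thesis by (simp only: finite.emptyI)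
qed

text \<open>
  An element of the algebra is viewed as the kernel \<open>(p, q) \<mapsto> val f p q\<close> on \<open>I(\<int>, r) \<times> I(\<int>, r)\<close>, invariant
  under the group.  The product then becomes matrix multiplication and the unit the identity matrix,
  and orbit representatives and structure constants no longer occur.
\<close>

definition val :: "(tuple_pair set \<Rightarrow>\<^sub>0 'k::field) \<Rightarrow> (nat \<Rightarrow> int) \<Rightarrow> (nat \<Rightarrow> int) \<Rightarrow> 'k" where
  "val f p q = Poly_Mapping.lookup f (orb p q)"

abbreviation S :: "(tuple_pair set \<Rightarrow>\<^sub>0 'k::field) ring" where "S \<equiv> affine_schur n r"

lemma S_carrier: "f \<in> carrier S \<longleftrightarrow> Poly_Mapping.keys f \<subseteq> pair_orbits n r"
  by (simp add: affine_schur_def)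

lemma S_add [simp]: "f \<oplus>\<^bsub>S\<^esub> g = f + g" and S_zero [simp]: "\<zero>\<^bsub>S\<^esub> = 0"
  by (simp_all add: affine_schur_def)

lemma val_add: "val (f + g) p q = val f p q + val g p q"
  by (simp add: val_def lookup_add)

lemma val_sum: "val (\<Sum>x\<in>X. f x) p q = (\<Sum>x\<in>X. val (f x) p q)"
  by (simp add: val_def lookup_sum)

lemma val_act: "\<lbrakk>p \<in> T; q \<in> T; w \<in> carrier G\<rbrakk> \<Longrightarrow> val f (ac p w) (ac q w) = val f p q"
  by (simp add: val_def orb_act)

lemma S_eqI:
  assumes "f \<in> carrier S" "g \<in> carrier S" "\<And>p q. \<lbrakk>p \<in> T; q \<in> T\<rbrakk> \<Longrightarrow> val f p q = val g p q"
  shows "f = g"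
proof (rule poly_mapping_eqI)
  fix A show "Poly_Mapping.lookup f A = Poly_Mapping.lookup g A"
  proof (cases "A \<in> pair_orbits n r")
    case True
    then show ?thesis using assms(3) by (auto simp: val_def elim!: pair_orbitsE)
  next
    case False
    then show ?thesis using assms(1,2) by (metis S_carrier in_keys_iff subsetD)
  qed
qed

lemma finite_val_support:
  assumes p: "p \<in> T" shows "finite {s \<in> T. val f p s \<noteq> 0}"
proof (rule finite_subset)
  show "{s \<in> T. val f p s \<noteq> 0} \<subseteq> (\<Union>A\<in>Poly_Mapping.keys f. {s \<in> T. orb p s = A})"
    by (auto simp: val_def in_keys_iff)
qed (simp add: finite_orb_right[OF p])

lemma Z_coeff_orb:
  assumes "A \<in> pair_orbits n r" "B \<in> pair_orbits n r" "p \<in> T" "q \<in> T"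
  shows "Z_coeff n r (orbit_rep A) (orbit_rep B) (p, q) = card {s \<in> T. orb p s = A \<and> orb s q = B}"
proof -
  obtain i j where A: "i \<in> T" "j \<in> T" "A = orb i j" "orbit_rep A = (i, j)"
    using assms(1) by (rule pair_orbitsE)
  obtain k l where B: "k \<in> T" "l \<in> T" "B = orb k l" "orbit_rep B = (k, l)"
    using assms(2) by (rule pair_orbitsE)
  show ?thesis
    unfolding Z_coeff_def A(4) B(4) prod.case
    by (rule arg_cong[where f = card]) (auto simp: A B assms same_orbit_orb)
qed

text \<open>
  Without this the sum over \<open>C\<close> in the product, being infinite, would be \<open>0\<close> by convention.  If \<open>C\<close> occurs in
  \<open>\<xi>\<^sub>i\<^sub>j \<cdot> B\<close>, then it can be translated to the form \<open>(i, q)\<close> with \<open>(j, q) \<in> B\<close>, leaving finitely many \<open>q\<close>.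
\<close>

lemma finite_structure_constants:
  assumes A: "A \<in> pair_orbits n r" and B: "B \<in> pair_orbits n r"
  shows "finite {C \<in> pair_orbits n r. Z_coeff n r (orbit_rep A) (orbit_rep B) (orbit_rep C) \<noteq> 0}"
proof -
  obtain i j where ij: "i \<in> T" "j \<in> T" "A = orb i j" using A by (rule pair_orbitsE)
  then have "finite (orb i ` {q \<in> T. orb j q = B})" by (simp add: finite_orb_right)
  moreover have "{C \<in> pair_orbits n r. Z_coeff n r (orbit_rep A) (orbit_rep B) (orbit_rep C) \<noteq> 0}
      \<subseteq> orb i ` {q \<in> T. orb j q = B}"
  proof clarify
    fix C assume C: "C \<in> pair_orbits n r" "0 < Z_coeff n r (orbit_rep A) (orbit_rep B) (orbit_rep C)"
    obtain p q where pq: "p \<in> T" "q \<in> T" "C = orb p q" "orbit_rep C = (p, q)"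
      using C(1) by (rule pair_orbitsE)
    then have "{s \<in> T. orb p s = A \<and> orb s q = B} \<noteq> {}"
      using C(2) Z_coeff_orb[OF A B pq(1,2)] by (metis card.empty less_irrefl)
    then obtain s where s: "s \<in> T" "orb i j = orb p s" "orb s q = B" using ij by auto
    then obtain w where w: "w \<in> carrier G" "p = ac i w" "s = ac j w"
      using ij pq by (auto simp: orb_eq_iff)
    let ?q = "ac q (inv\<^bsub>G\<^esub> w)"
    have "orb i ?q = C" "orb j ?q = B"
      using w pq s ij orb_act[of i ?q w] orb_act[of j ?q w] by (simp_all add: act_inv)
    then show "C \<in> orb i ` {q \<in> T. orb j q = B}" by auto
  qed
  ultimately show ?thesis by (rule finite_subset[rotated])
qed

lemma lookup_S_mult:
  assumes f: "f \<in> carrier S" and g: "g \<in> carrier S"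
  shows "Poly_Mapping.lookup (f \<otimes>\<^bsub>S\<^esub> g) C = (if C \<in> pair_orbits n r then
    \<Sum>A\<in>Poly_Mapping.keys f. \<Sum>B\<in>Poly_Mapping.keys g. Poly_Mapping.lookup f A * Poly_Mapping.lookup g B *
      of_nat (Z_coeff n r (orbit_rep A) (orbit_rep B) (orbit_rep C)) else 0)"
proof -
  have *: "(\<Sum>D\<in>{D \<in> pair_orbits n r. Z_coeff n r (orbit_rep A) (orbit_rep B) (orbit_rep D) \<noteq> 0}.
      (c * of_nat (Z_coeff n r (orbit_rep A) (orbit_rep B) (orbit_rep D)) when D = C)) =
    (if C \<in> pair_orbits n r then c * of_nat (Z_coeff n r (orbit_rep A) (orbit_rep B) (orbit_rep C)) else 0)"
    if "A \<in> Poly_Mapping.keys f" "B \<in> Poly_Mapping.keys g" for A B and c :: 'a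
  proof -
    have "A \<in> pair_orbits n r" "B \<in> pair_orbits n r" using that f g by (auto simp: S_carrier)
    from finite_structure_constants[OF this] show ?thesis
      unfolding when_def by (subst sum.delta) auto
  qed
  have "Poly_Mapping.lookup (f \<otimes>\<^bsub>S\<^esub> g) C =
    (\<Sum>A\<in>Poly_Mapping.keys f. \<Sum>B\<in>Poly_Mapping.keys g.
      \<Sum>D\<in>{D \<in> pair_orbits n r. Z_coeff n r (orbit_rep A) (orbit_rep B) (orbit_rep D) \<noteq> 0}.
      (Poly_Mapping.lookup f A * Poly_Mapping.lookup g B *
        of_nat (Z_coeff n r (orbit_rep A) (orbit_rep B) (orbit_rep D)) when D = C))"
    by (simp add: affine_schur_def lookup_sum lookup_single)
  also have "\<dots> = (\<Sum>A\<in>Poly_Mapping.keys f. \<Sum>B\<in>Poly_Mapping.keys g. if C \<in> pair_orbits n r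
      then Poly_Mapping.lookup f A * Poly_Mapping.lookup g B *
        of_nat (Z_coeff n r (orbit_rep A) (orbit_rep B) (orbit_rep C)) else 0)"
    by (intro sum.cong refl *)
  finally show ?thesis by simp
qed

lemma conv_act:
  assumes p: "p \<in> T" "q \<in> T" and w: "w \<in> carrier G"
  shows "(\<Sum>s\<in>{s \<in> T. val f (ac p w) s \<noteq> 0}. val f (ac p w) s * val g s (ac q w)) =
    (\<Sum>s\<in>{s \<in> T. val f p s \<noteq> 0}. val f p s * val g s q)"
  using assms
  by (intro sum.reindex_bij_witness[of _ "\<lambda>s. ac s w" "\<lambda>s. ac s (inv\<^bsub>G\<^esub> w)"])
    (auto simp: act_inv val_act dest: val_act[of p _ w f], (metis act_closed act_inv(2) val_act)+)

text \<open>
  At the chosen representative \<open>(p', q')\<close> of the orbit the structure constant counts the \<open>s\<close> with prescribed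
  orbits of \<open>(p', s)\<close> and \<open>(s, q')\<close>, so summing over all pairs of orbits gives the sum over all \<open>s\<close>.
  Invariance (\<open>conv_act\<close>) then moves the formula to an arbitrary \<open>(p, q)\<close>.
\<close>

lemma val_mult:
  assumes f: "f \<in> carrier S" and g: "g \<in> carrier S" and pq: "p \<in> T" "q \<in> T"
  shows "val (f \<otimes>\<^bsub>S\<^esub> g) p q = (\<Sum>s\<in>{s \<in> T. val f p s \<noteq> 0}. val f p s * val g s q)"
proof -
  have C: "orb p q \<in> pair_orbits n r" using pq by (rule orb_closed)
  then obtain p' q' where pq': "p' \<in> T" "q' \<in> T" "orb p q = orb p' q'" "orbit_rep (orb p q) = (p', q')"
    by (rule pair_orbitsE)
  let ?F = "Poly_Mapping.keys f" and ?G = "Poly_Mapping.keys g"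
  let ?f = "Poly_Mapping.lookup f" and ?g = "Poly_Mapping.lookup g"
  define X where "X = {s \<in> T. val f p' s \<noteq> 0}"
  have X: "finite X" unfolding X_def using pq'(1) by (rule finite_val_support)
  have Z: "of_nat (Z_coeff n r (orbit_rep A) (orbit_rep B) (p', q')) =
      (\<Sum>s\<in>X. if orb p' s = A then if orb s q' = B then 1 else 0 else 0 :: 'a)"
    if A: "A \<in> ?F" and B: "B \<in> ?G" for A B
  proof -
    have "Z_coeff n r (orbit_rep A) (orbit_rep B) (p', q') = card {s \<in> T. orb p' s = A \<and> orb s q' = B}"
      using A B f g pq' by (intro Z_coeff_orb) (auto simp: S_carrier)
    also have "{s \<in> T. orb p' s = A \<and> orb s q' = B} = {s \<in> X. orb p' s = A \<and> orb s q' = B}"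
      using A by (auto simp: X_def val_def in_keys_iff)
    finally show ?thesis
      using X by (simp add: sum.If_cases if_if_eq_conj cong: if_cong) (simp add: Int_def conj_comms)
  qed
  have "val (f \<otimes>\<^bsub>S\<^esub> g) p q = (\<Sum>A\<in>?F. \<Sum>B\<in>?G. \<Sum>s\<in>X.
      if orb p' s = A then if orb s q' = B then ?f A * ?g B else 0 else 0)"
  proof -
    have "val (f \<otimes>\<^bsub>S\<^esub> g) p q = (\<Sum>A\<in>?F. \<Sum>B\<in>?G. ?f A * ?g B *
        of_nat (Z_coeff n r (orbit_rep A) (orbit_rep B) (p', q')))"
      using C by (simp add: val_def lookup_S_mult[OF f g] pq'(4))
    also have "\<dots> = (\<Sum>A\<in>?F. \<Sum>B\<in>?G. \<Sum>s\<in>X.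
        if orb p' s = A then if orb s q' = B then ?f A * ?g B else 0 else 0)"
      by (intro sum.cong refl, subst Z, assumption, assumption, subst sum_distrib_left)
        (intro sum.cong refl, simp)
    finally show ?thesis .
  qed
  also have "\<dots> = (\<Sum>A\<in>?F. \<Sum>s\<in>X. \<Sum>B\<in>?G.
      if orb p' s = A then if orb s q' = B then ?f A * ?g B else 0 else 0)"
    by (intro sum.cong refl sum.swap)
  also have "\<dots> = (\<Sum>s\<in>X. \<Sum>A\<in>?F. \<Sum>B\<in>?G.
      if orb p' s = A then if orb s q' = B then ?f A * ?g B else 0 else 0)"
    by (rule sum.swap)
  also have "\<dots> = (\<Sum>s\<in>X. val f p' s * val g s q')"
  proof (intro sum.cong refl)
    fix s assume "s \<in> X"
    have "(\<Sum>A\<in>?F. \<Sum>B\<in>?G. if orb p' s = A then if orb s q' = B then ?f A * ?g B else 0 else 0) =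
      (\<Sum>A\<in>?F. if orb p' s = A then \<Sum>B\<in>?G. if orb s q' = B then ?f A * ?g B else 0 else 0)"
      by (intro sum.cong refl) simp
    then show "(\<Sum>A\<in>?F. \<Sum>B\<in>?G. if orb p' s = A then if orb s q' = B then ?f A * ?g B else 0 else 0) =
      val f p' s * val g s q'"
      by (simp add: val_def in_keys_iff)
  qed
  also have "\<dots> = (\<Sum>s\<in>{s \<in> T. val f p s \<noteq> 0}. val f p s * val g s q)"
  proof -
    obtain w where "w \<in> carrier G" "p' = ac p w" "q' = ac q w"
      using pq pq' by (auto simp: orb_eq_iff)
    then show ?thesis using conv_act[OF pq] by (simp add: X_def)
  qed
  finally show ?thesis .
qed

lemma val_mult_superset:
  assumes "f \<in> carrier S" "g \<in> carrier S" "p \<in> T" "q \<in> T"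
    and X: "finite X" "X \<subseteq> T" "\<And>s. \<lbrakk>s \<in> T; val f p s \<noteq> 0; val g s q \<noteq> 0\<rbrakk> \<Longrightarrow> s \<in> X"
  shows "val (f \<otimes>\<^bsub>S\<^esub> g) p q = (\<Sum>s\<in>X. val f p s * val g s q)"
  unfolding val_mult[OF assms(1-4)]
  by (rule sum.mono_neutral_cong) (use X finite_val_support[OF assms(3)] in auto)

lemma S_mult_closed: "\<lbrakk>f \<in> carrier S; g \<in> carrier S\<rbrakk> \<Longrightarrow> f \<otimes>\<^bsub>S\<^esub> g \<in> carrier S"
  by (auto simp: S_carrier[of "f \<otimes>\<^bsub>S\<^esub> g"] in_keys_iff lookup_S_mult split: if_splits)

lemma S_add_closed: "\<lbrakk>f \<in> carrier S; g \<in> carrier S\<rbrakk> \<Longrightarrow> f + g \<in> carrier S"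
  unfolding S_carrier using keys_add[of f g] by blast

lemma S_zero_closed: "0 \<in> carrier S" and S_uminus_closed: "f \<in> carrier S \<Longrightarrow> - f \<in> carrier S"
  by (simp_all add: S_carrier)

lemma single_closed: "\<lbrakk>p \<in> T; q \<in> T\<rbrakk> \<Longrightarrow> Poly_Mapping.single (orb p q) c \<in> carrier S"
  using orb_closed by (auto simp: S_carrier)

lemma sum_closed_S: "(\<And>x. x \<in> X \<Longrightarrow> f x \<in> carrier S) \<Longrightarrow> (\<Sum>x\<in>X. f x) \<in> carrier S"
  by (induction X rule: infinite_finite_induct) (auto intro: S_add_closed S_zero_closed)

lemma \<xi>_single: "\<xi> n r i j = Poly_Mapping.single (orb i j) 1"
  by (simp add: \<xi>_def orb_def)

lemma val_single: "val (Poly_Mapping.single (orb i j) c) p q = (if orb i j = orb p q then c else 0)"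
  by (simp add: val_def lookup_single when_def)

lemma bounded_tuples_iff: "i \<in> bounded_tuples n r \<longleftrightarrow> i \<in> T \<and> (\<forall>t\<in>{1..r}. i t \<in> {1..int n})"
  by (auto simp: bounded_tuples_def tuples_def PiE_iff)

lemma finite_bounded_tuples: "finite (bounded_tuples n r)"
  by (simp add: bounded_tuples_def finite_PiE)

text \<open>
  Each place permutation can be completed by exactly one shift that moves \<open>p\<close> into the box \<open>I(n, r)\<close>:
  shifts move an entry by multiples of \<open>n\<close>, and the box has \<open>n\<close> consecutive values.
\<close>

lemma bounded_translate:
  assumes "w \<in> carrier G"
  shows "ac p w \<in> bounded_tuples n r \<longleftrightarrow>
    snd w = (\<lambda>t\<in>{1..r}. - ((p (fst w t) - 1) div int n))"
proof -
  let ?f = "\<lambda>t. - ((p (fst w t) - 1) div int n)"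
  have *: "1 \<le> x + int n * y \<and> x + int n * y \<le> int n \<longleftrightarrow> y = - ((x - 1) div int n)" for x y :: int
  proof -
    have "1 \<le> x + int n * y \<and> x + int n * y \<le> int n \<longleftrightarrow> ((x - 1) + int n * y) div int n = 0"
      using n_pos
      by (auto simp: zdiv_eq_0_iff simp del: div_mult_self1 div_mult_self2 div_mult_self3 div_mult_self4)
    also have "\<dots> \<longleftrightarrow> y = - ((x - 1) div int n)" using n_pos by auto
    finally show ?thesis .
  qed
  have "ac p w \<in> bounded_tuples n r \<longleftrightarrow> (\<forall>t\<in>{1..r}.
      1 \<le> p (fst w t) + int n * snd w t \<and> p (fst w t) + int n * snd w t \<le> int n)"
    by (auto simp: bounded_tuples_iff) (auto simp: act_def)
  also have "\<dots> \<longleftrightarrow> (\<forall>t\<in>{1..r}. snd w t = ?f t)" by (simp only: *)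
  also have "\<dots> \<longleftrightarrow> snd w = (\<lambda>t\<in>{1..r}. ?f t)"
  proof
    assume "\<forall>t\<in>{1..r}. snd w t = ?f t"
    then show "snd w = (\<lambda>t\<in>{1..r}. ?f t)"
      using assms by (intro tuples_ext[of _ r]) (auto simp: weyl_carrier)
  qed (metis restrict_apply')
  finally show ?thesis .
qed

lemma ex_bounded_translate: "\<exists>w \<in> carrier G. ac p w \<in> bounded_tuples n r"
proof -
  let ?w = "(id, \<lambda>t\<in>{1..r}. - ((p t - 1) div int n))"
  have w: "?w \<in> carrier G" by (simp add: weyl_carrier permutes_id)
  then have "ac p ?w \<in> bounded_tuples n r" by (simp add: bounded_translate)
  with w show ?thesis by blast
qed

lemma S_one: "\<one>\<^bsub>S\<^esub> = (\<Sum>A\<in>(\<lambda>i. orb i i) ` bounded_tuples n r. Poly_Mapping.single A 1)"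
proof -
  have inj: "inj_on (\<lambda>A. Poly_Mapping.single A (1::'a)) X" for X :: "tuple_pair set set"
    by (rule inj_onI) (metis lookup_single_eq lookup_single_not_eq zero_neq_one)
  have "\<one>\<^bsub>S\<^esub> = (\<Sum>e\<in>(\<lambda>A. Poly_Mapping.single A (1::'a)) ` (\<lambda>i. orb i i) ` bounded_tuples n r. e)"
    by (simp add: affine_schur_def \<xi>_single image_image)
  also have "\<dots> = (\<Sum>A\<in>(\<lambda>i. orb i i) ` bounded_tuples n r. Poly_Mapping.single A 1)"
    using inj by (subst sum.reindex) auto
  finally show ?thesis .
qed

lemma S_one_closed: "\<one>\<^bsub>S\<^esub> \<in> carrier S"
  unfolding S_one by (intro sum_closed_S) (auto simp: bounded_tuples_iff intro: single_closed)

lemma val_one: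
  assumes "p \<in> T" "q \<in> T"
  shows "val \<one>\<^bsub>S\<^esub> p q = (if p = q then 1 else 0)"
proof -
  have "orb p q \<in> (\<lambda>i. orb i i) ` bounded_tuples n r \<longleftrightarrow> p = q"
  proof
    assume "orb p q \<in> (\<lambda>i. orb i i) ` bounded_tuples n r"
    then obtain i w where "w \<in> carrier G" "i = ac p w" "i = ac q w"
      using assms by (auto simp: orb_eq_iff bounded_tuples_iff)
    then show "p = q" using assms act_cancel by metis
  next
    assume "p = q"
    obtain w where "w \<in> carrier G" "ac p w \<in> bounded_tuples n r" using ex_bounded_translate by blast
    then show "orb p q \<in> (\<lambda>i. orb i i) ` bounded_tuples n r"
      using \<open>p = q\<close> assms orb_act[of p p w] by (intro image_eqI[of _ _ "ac p w"]) auto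
  qed
  then show ?thesis
    using finite_bounded_tuples
    by (simp add: S_one val_def lookup_sum lookup_single when_def)
qed

lemma ring_S: "ring S"
proof (intro ringI abelian_groupI monoidI; (unfold S_add S_zero)?)
  fix f :: "tuple_pair set \<Rightarrow>\<^sub>0 'a" assume f: "f \<in> carrier S"
  show "\<exists>g\<in>carrier S. g + f = 0" using f by (intro bexI[of _ "- f"]) (auto simp: S_uminus_closed)
  show "\<one>\<^bsub>S\<^esub> \<otimes>\<^bsub>S\<^esub> f = f"
  proof (rule S_eqI)
    fix p q assume pq: "p \<in> T" "q \<in> T"
    then have "val (\<one>\<^bsub>S\<^esub> \<otimes>\<^bsub>S\<^esub> f) p q = (\<Sum>s\<in>{p}. val \<one>\<^bsub>S\<^esub> p s * val f s q)"
      by (intro val_mult_superset S_one_closed f) (auto simp: val_one split: if_splits)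
    then show "val (\<one>\<^bsub>S\<^esub> \<otimes>\<^bsub>S\<^esub> f) p q = val f p q" using pq by (simp add: val_one)
  qed (auto intro: S_mult_closed S_one_closed f)
  show "f \<otimes>\<^bsub>S\<^esub> \<one>\<^bsub>S\<^esub> = f"
  proof (rule S_eqI)
    fix p q assume pq: "p \<in> T" "q \<in> T"
    then have "val (f \<otimes>\<^bsub>S\<^esub> \<one>\<^bsub>S\<^esub>) p q = (\<Sum>s\<in>{q}. val f p s * val \<one>\<^bsub>S\<^esub> s q)"
      by (intro val_mult_superset S_one_closed f) (auto simp: val_one split: if_splits)
    then show "val (f \<otimes>\<^bsub>S\<^esub> \<one>\<^bsub>S\<^esub>) p q = val f p q" using pq by (simp add: val_one)
  qed (auto intro: S_mult_closed S_one_closed f)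
  fix g h :: "tuple_pair set \<Rightarrow>\<^sub>0 'a" assume g: "g \<in> carrier S" and h: "h \<in> carrier S"
  show "(f + g) \<otimes>\<^bsub>S\<^esub> h = f \<otimes>\<^bsub>S\<^esub> h + g \<otimes>\<^bsub>S\<^esub> h"
  proof (rule S_eqI)
    fix p q assume pq: "p \<in> T" "q \<in> T"
    \<comment> \<open>the supports of \<open>f\<close>, \<open>g\<close> and \<open>f + g\<close> differ, so all three products are summed over a common set\<close>
    let ?X = "{s \<in> T. val f p s \<noteq> 0} \<union> {s \<in> T. val g p s \<noteq> 0}"
    have X: "finite ?X" using pq by (simp add: finite_val_support)
    have "val (k \<otimes>\<^bsub>S\<^esub> h) p q = (\<Sum>s\<in>?X. val k p s * val h s q)"
      if "k \<in> {f, g, f + g}" for k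
      using that f g h pq X by (intro val_mult_superset) (auto simp: val_add S_add_closed)
    then show "val ((f + g) \<otimes>\<^bsub>S\<^esub> h) p q = val (f \<otimes>\<^bsub>S\<^esub> h + g \<otimes>\<^bsub>S\<^esub> h) p q"
      by (simp add: val_add distrib_right sum.distrib)
  qed (intro S_mult_closed S_add_closed f g h)+
  show "h \<otimes>\<^bsub>S\<^esub> (f + g) = h \<otimes>\<^bsub>S\<^esub> f + h \<otimes>\<^bsub>S\<^esub> g"
  proof (rule S_eqI)
    fix p q assume pq: "p \<in> T" "q \<in> T"
    then show "val (h \<otimes>\<^bsub>S\<^esub> (f + g)) p q = val (h \<otimes>\<^bsub>S\<^esub> f + h \<otimes>\<^bsub>S\<^esub> g) p q"
      using f g h by (simp add: val_mult val_add S_add_closed distrib_left sum.distrib)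
  qed (intro S_mult_closed S_add_closed f g h)+
  show "(f \<otimes>\<^bsub>S\<^esub> g) \<otimes>\<^bsub>S\<^esub> h = f \<otimes>\<^bsub>S\<^esub> (g \<otimes>\<^bsub>S\<^esub> h)"
  proof (rule S_eqI)
    fix p q assume pq: "p \<in> T" "q \<in> T"
    let ?X = "{s \<in> T. val f p s \<noteq> 0}"
    \<comment> \<open>contains every \<open>t\<close> that can contribute on either side of the double sum\<close>
    let ?Y = "\<Union>s\<in>?X. {t \<in> T. val g s t \<noteq> 0}"
    have X: "finite ?X" using pq(1) by (rule finite_val_support)
    then have Y: "finite ?Y" by (auto simp: finite_val_support)
    have fg: "val (f \<otimes>\<^bsub>S\<^esub> g) p t = (\<Sum>s\<in>?X. val f p s * val g s t)" if "t \<in> T" for t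
      using f g pq that by (intro val_mult)
    have "val ((f \<otimes>\<^bsub>S\<^esub> g) \<otimes>\<^bsub>S\<^esub> h) p q = (\<Sum>t\<in>?Y. val (f \<otimes>\<^bsub>S\<^esub> g) p t * val h t q)"
    proof (rule val_mult_superset)
      fix t assume t: "t \<in> T" "val (f \<otimes>\<^bsub>S\<^esub> g) p t \<noteq> 0"
      then obtain s where "s \<in> ?X" "val f p s * val g s t \<noteq> 0"
        using fg by (metis (no_types, lifting) sum.neutral)
      then show "t \<in> ?Y" using t by auto
    qed (use Y pq in \<open>auto intro: S_mult_closed f g h\<close>)
    also have "\<dots> = (\<Sum>t\<in>?Y. \<Sum>s\<in>?X. val f p s * (val g s t * val h t q))"
      by (intro sum.cong refl) (auto simp: fg sum_distrib_right mult.assoc)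
    also have "\<dots> = (\<Sum>s\<in>?X. \<Sum>t\<in>?Y. val f p s * (val g s t * val h t q))"
      by (rule sum.swap)
    also have "\<dots> = (\<Sum>s\<in>?X. val f p s * val (g \<otimes>\<^bsub>S\<^esub> h) s q)"
    proof (intro sum.cong refl)
      fix s assume s: "s \<in> ?X"
      then have "val (g \<otimes>\<^bsub>S\<^esub> h) s q = (\<Sum>t\<in>?Y. val g s t * val h t q)"
        using Y pq by (intro val_mult_superset g h) auto
      then show "(\<Sum>t\<in>?Y. val f p s * (val g s t * val h t q)) = val f p s * val (g \<otimes>\<^bsub>S\<^esub> h) s q"
        by (simp add: sum_distrib_left)
    qed
    also have "\<dots> = val (f \<otimes>\<^bsub>S\<^esub> (g \<otimes>\<^bsub>S\<^esub> h)) p q"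
      using pq by (intro val_mult[symmetric] S_mult_closed f g h)
    finally show "val ((f \<otimes>\<^bsub>S\<^esub> g) \<otimes>\<^bsub>S\<^esub> h) p q = val (f \<otimes>\<^bsub>S\<^esub> (g \<otimes>\<^bsub>S\<^esub> h)) p q" .
  qed (intro S_mult_closed f g h)+
qed (auto intro: S_add_closed S_mult_closed S_zero_closed S_one_closed simp: add_ac)

end

section \<open>The idempotent of a regular tuple\<close>

locale regular_schur_data = schur_data +
  assumes r_le_n: "r \<le> n"
begin

abbreviation "u \<equiv> u_tuple r"
abbreviation "ux \<equiv> act n r (u_tuple r)"

lemma u_closed: "u \<in> T"
  by (simp add: u_tuple_def)

text \<open>
  The entries of \<open>u\<close> are pairwise incongruent modulo \<open>n\<close> because \<open>r \<le> n\<close>, so its stabiliser is trivial.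
\<close>

lemma ux_inj:
  assumes v: "v \<in> carrier G" and w: "w \<in> carrier G" and eq: "ux v = ux w"
  shows "v = w"
proof -
  have *: "fst v t = fst w t \<and> snd v t = snd w t" if t: "t \<in> {1..r}" for t
  proof -
    have le: "1 \<le> fst v t" "fst v t \<le> r" "1 \<le> fst w t" "fst w t \<le> r"
      using v w t permutes_le[of "fst v" r t] permutes_le[of "fst w" r t] by (auto simp: weyl_carrier)
    have eq_t: "int (fst v t) + int n * snd v t = int (fst w t) + int n * snd w t"
      using fun_cong[OF eq, of t] t le by (simp add: act_def u_tuple_def)
    then have "(int (fst v t) - 1) mod int n = (int (fst w t) - 1) mod int n"
      by (metis add_diff_eq diff_add_eq mod_mult_self2)
    then have "fst v t = fst w t" using le r_le_n by simp
    then show ?thesis using eq_t n_pos by simp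
  qed
  have "fst v = fst w"
  proof
    fix t show "fst v t = fst w t"
      using * v w by (cases "t \<in> {1..r}") (auto simp: weyl_carrier permutes_not_in)
  qed
  moreover have "snd v = snd w"
    using * v w by (intro tuples_ext[of _ r]) (auto simp: weyl_carrier)
  ultimately show ?thesis by (rule prod_eqI)
qed

lemma ux_eq_iff: "\<lbrakk>v \<in> carrier G; w \<in> carrier G\<rbrakk> \<Longrightarrow> ux v = ux w \<longleftrightarrow> v = w"
  using ux_inj by blast

lemma ux_one: "ux \<one>\<^bsub>G\<^esub> = u"
  by (rule act_one[OF u_closed])

text \<open>
  The regular orbit is a copy of the group, and the orbits of pairs in it are classified by the
  quotient of the two entries.  Under this identification a kernel supported on the regular orbit is a
  function on the group, and composition of kernels is the group algebra product.
\<close>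

lemma orb_ux_eq_iff:
  assumes "v \<in> carrier G" "w \<in> carrier G" "x \<in> carrier G" "y \<in> carrier G"
  shows "orb (ux v) (ux w) = orb (ux x) (ux y) \<longleftrightarrow> v \<otimes>\<^bsub>G\<^esub> inv\<^bsub>G\<^esub> w = x \<otimes>\<^bsub>G\<^esub> inv\<^bsub>G\<^esub> y"
proof -
  have *: "orb (ux v) (ux w) = orb (ux (v \<otimes>\<^bsub>G\<^esub> inv\<^bsub>G\<^esub> w)) u" if "v \<in> carrier G" "w \<in> carrier G" for v w
    using that orb_act[of "ux v" "ux w" "inv\<^bsub>G\<^esub> w"] by (simp add: act_mult ux_one)
  have "orb (ux v) u = orb (ux w) u \<longleftrightarrow> v = w" if vw: "v \<in> carrier G" "w \<in> carrier G" for v w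
  proof
    assume "orb (ux v) u = orb (ux w) u"
    then obtain z where z: "z \<in> carrier G" "ux w = ac (ux v) z" "u = ux z"
      using u_closed by (auto simp: orb_eq_iff)
    then have "z = \<one>\<^bsub>G\<^esub>" using ux_inj[of z "\<one>\<^bsub>G\<^esub>"] ux_one by simp
    then show "v = w" using z vw by (simp add: act_one ux_eq_iff)
  qed simp
  then show ?thesis using assms by (simp add: *)
qed

abbreviation e :: "tuple_pair set \<Rightarrow>\<^sub>0 'k::field" where "e \<equiv> \<xi> n r u u"

lemma e_closed: "e \<in> carrier S"
  unfolding \<xi>_single using u_closed by (intro single_closed)

lemma val_e:
  assumes "p \<in> T" "q \<in> T"
  shows "val e p q = (if p = q \<and> p \<in> ux ` carrier G then 1 else 0)"
  using assms u_closed by (auto simp: \<xi>_single val_single orb_eq_iff)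

text \<open>
  The kernel of \<open>e\<close> is the identity matrix restricted to the regular orbit, so multiplying by \<open>e\<close>
  cuts a kernel down to the rows, or the columns, in that orbit.
\<close>

lemma val_e_mult:
  assumes f: "f \<in> carrier S" and pq: "p \<in> T" "q \<in> T"
  shows "val (e \<otimes>\<^bsub>S\<^esub> f) p q = (if p \<in> ux ` carrier G then val f p q else 0)"
proof -
  have "val (e \<otimes>\<^bsub>S\<^esub> f) p q = (\<Sum>s\<in>{p}. val e p s * val f s q)"
    using pq by (intro val_mult_superset e_closed f) (auto simp: val_e split: if_splits)
  then show ?thesis using pq by (simp add: val_e)
qed

lemma val_mult_e:
  assumes f: "f \<in> carrier S" and pq: "p \<in> T" "q \<in> T"
  shows "val (f \<otimes>\<^bsub>S\<^esub> e) p q = (if q \<in> ux ` carrier G then val f p q else 0)"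
proof -
  have "val (f \<otimes>\<^bsub>S\<^esub> e) p q = (\<Sum>s\<in>{q}. val f p s * val e s q)"
    using pq by (intro val_mult_superset e_closed f) (auto simp: val_e split: if_splits)
  then show ?thesis using pq by (simp add: val_e)
qed

lemma e_mult_eq_iff:
  assumes f: "f \<in> carrier S"
  shows "e \<otimes>\<^bsub>S\<^esub> f = f \<longleftrightarrow> (\<forall>p\<in>T. \<forall>q\<in>T. val f p q \<noteq> 0 \<longrightarrow> p \<in> ux ` carrier G)"
proof
  assume *: "e \<otimes>\<^bsub>S\<^esub> f = f"
  show "\<forall>p\<in>T. \<forall>q\<in>T. val f p q \<noteq> 0 \<longrightarrow> p \<in> ux ` carrier G"
  proof (intro ballI impI, rule ccontr)
    fix p q assume pq: "p \<in> T" "q \<in> T" "val f p q \<noteq> 0" and "p \<notin> ux ` carrier G"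
    then have "val (e \<otimes>\<^bsub>S\<^esub> f) p q = 0" by (simp add: val_e_mult[OF f])
    then show False unfolding * using pq by simp
  qed
next
  assume "\<forall>p\<in>T. \<forall>q\<in>T. val f p q \<noteq> 0 \<longrightarrow> p \<in> ux ` carrier G"
  then show "e \<otimes>\<^bsub>S\<^esub> f = f"
    by (intro S_eqI S_mult_closed e_closed f) (auto simp: val_e_mult[OF f])
qed

lemma mult_e_eq_iff:
  assumes f: "f \<in> carrier S"
  shows "f \<otimes>\<^bsub>S\<^esub> e = f \<longleftrightarrow> (\<forall>p\<in>T. \<forall>q\<in>T. val f p q \<noteq> 0 \<longrightarrow> q \<in> ux ` carrier G)"
proof
  assume *: "f \<otimes>\<^bsub>S\<^esub> e = f"
  show "\<forall>p\<in>T. \<forall>q\<in>T. val f p q \<noteq> 0 \<longrightarrow> q \<in> ux ` carrier G"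
  proof (intro ballI impI, rule ccontr)
    fix p q assume pq: "p \<in> T" "q \<in> T" "val f p q \<noteq> 0" and "q \<notin> ux ` carrier G"
    then have "val (f \<otimes>\<^bsub>S\<^esub> e) p q = 0" by (simp add: val_mult_e[OF f])
    then show False unfolding * using pq by simp
  qed
next
  assume "\<forall>p\<in>T. \<forall>q\<in>T. val f p q \<noteq> 0 \<longrightarrow> q \<in> ux ` carrier G"
  then show "f \<otimes>\<^bsub>S\<^esub> e = f"
    by (intro S_eqI S_mult_closed e_closed f) (auto simp: val_mult_e[OF f])
qed

section \<open>The corner is the group algebra\<close>

abbreviation A :: "(weyl \<Rightarrow>\<^sub>0 'k::field) ring" where "A \<equiv> group_algebra G"

lemma A_simps:
  "f \<in> carrier A \<longleftrightarrow> Poly_Mapping.keys f \<subseteq> carrier G"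
  "f \<oplus>\<^bsub>A\<^esub> g = f + g" "\<zero>\<^bsub>A\<^esub> = 0" "\<one>\<^bsub>A\<^esub> = Poly_Mapping.single \<one>\<^bsub>G\<^esub> 1"
  by (simp_all add: group_algebra_def)

lemma A_lookup:
  assumes "f \<in> carrier A" "w \<notin> carrier G"
  shows "Poly_Mapping.lookup f w = 0"
proof -
  have "w \<notin> Poly_Mapping.keys f" using assms by (auto simp only: A_simps)
  then show ?thesis by (simp add: in_keys_iff)
qed

lemma lookup_A_mult:
  assumes f: "f \<in> carrier A" and g: "g \<in> carrier A" and w: "w \<in> carrier G"
  shows "Poly_Mapping.lookup (f \<otimes>\<^bsub>A\<^esub> g) w =
    (\<Sum>x\<in>Poly_Mapping.keys f. Poly_Mapping.lookup f x * Poly_Mapping.lookup g (inv\<^bsub>G\<^esub> x \<otimes>\<^bsub>G\<^esub> w))"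
proof -
  have "Poly_Mapping.lookup (f \<otimes>\<^bsub>A\<^esub> g) w = (\<Sum>x\<in>Poly_Mapping.keys f. \<Sum>y\<in>Poly_Mapping.keys g.
      (Poly_Mapping.lookup f x * Poly_Mapping.lookup g y when x \<otimes>\<^bsub>G\<^esub> y = w))"
    by (simp add: group_algebra_def lookup_sum lookup_single)
  also have "\<dots> = (\<Sum>x\<in>Poly_Mapping.keys f. Poly_Mapping.lookup f x * Poly_Mapping.lookup g (inv\<^bsub>G\<^esub> x \<otimes>\<^bsub>G\<^esub> w))"
  proof (intro sum.cong refl)
    fix x assume "x \<in> Poly_Mapping.keys f"
    then have x: "x \<in> carrier G" using f by (auto simp: A_simps)
    have "(\<Sum>y\<in>Poly_Mapping.keys g. (Poly_Mapping.lookup f x * Poly_Mapping.lookup g y when x \<otimes>\<^bsub>G\<^esub> y = w)) =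
      (\<Sum>y\<in>Poly_Mapping.keys g. if y = inv\<^bsub>G\<^esub> x \<otimes>\<^bsub>G\<^esub> w then Poly_Mapping.lookup f x * Poly_Mapping.lookup g y else 0)"
    proof (intro sum.cong refl)
      fix y assume "y \<in> Poly_Mapping.keys g"
      then have "y \<in> carrier G" using g by (auto simp: A_simps)
      then have "x \<otimes>\<^bsub>G\<^esub> y = w \<longleftrightarrow> y = inv\<^bsub>G\<^esub> x \<otimes>\<^bsub>G\<^esub> w"
        using x w by (metis G.inv_solve_left)
      then show "(Poly_Mapping.lookup f x * Poly_Mapping.lookup g y when x \<otimes>\<^bsub>G\<^esub> y = w) =
        (if y = inv\<^bsub>G\<^esub> x \<otimes>\<^bsub>G\<^esub> w then Poly_Mapping.lookup f x * Poly_Mapping.lookup g y else 0)"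
        by (simp add: when_def)
    qed
    then show "(\<Sum>y\<in>Poly_Mapping.keys g. (Poly_Mapping.lookup f x * Poly_Mapping.lookup g y when x \<otimes>\<^bsub>G\<^esub> y = w)) =
        Poly_Mapping.lookup f x * Poly_Mapping.lookup g (inv\<^bsub>G\<^esub> x \<otimes>\<^bsub>G\<^esub> w)"
      by (simp add: in_keys_iff)
  qed
  finally show ?thesis .
qed

lemma A_mult_closed:
  assumes f: "f \<in> carrier A" and g: "g \<in> carrier A"
  shows "f \<otimes>\<^bsub>A\<^esub> g \<in> carrier A"
proof -
  have "Poly_Mapping.keys (f \<otimes>\<^bsub>A\<^esub> g) \<subseteq> (\<Union>x\<in>Poly_Mapping.keys f. \<Union>y\<in>Poly_Mapping.keys g. {x \<otimes>\<^bsub>G\<^esub> y})"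
    unfolding group_algebra_def ring.simps monoid.simps
    by (intro order.trans[OF keys_sum] UN_mono order_refl) auto
  also have "\<dots> \<subseteq> carrier G"
  proof (intro UN_least)
    fix x y assume "x \<in> Poly_Mapping.keys f" "y \<in> Poly_Mapping.keys g"
    then have "x \<in> carrier G" "y \<in> carrier G" using f g by (auto simp: A_simps)
    then show "{x \<otimes>\<^bsub>G\<^esub> y} \<subseteq> carrier G" by simp
  qed
  finally show ?thesis by (simp add: A_simps)
qed

abbreviation \<psi> :: "(weyl \<Rightarrow>\<^sub>0 'k::field) \<Rightarrow> (tuple_pair set \<Rightarrow>\<^sub>0 'k)" where "\<psi> \<equiv> group_to_schur n r"

lemma \<psi>_eq: "\<psi> f = (\<Sum>w\<in>Poly_Mapping.keys f.
    Poly_Mapping.single (orb u (ux (inv\<^bsub>G\<^esub> w))) (Poly_Mapping.lookup f w))"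
  by (simp add: group_to_schur_def \<xi>_single)

lemma \<psi>_closed: "\<psi> f \<in> carrier S"
  unfolding \<psi>_eq using u_closed by (intro sum_closed_S single_closed) auto

text \<open>
  The inverse in the definition of the identification turns \<open>\<psi> f\<close> into the kernel \<open>(x, y) \<mapsto> f (x y\<^sup>-\<^sup>1)\<close>, for
  which convolution is the product of the group algebra in the same order.
\<close>

lemma val_\<psi>:
  assumes f: "f \<in> carrier A" and x: "x \<in> carrier G" and y: "y \<in> carrier G"
  shows "val (\<psi> f) (ux x) (ux y) = Poly_Mapping.lookup f (x \<otimes>\<^bsub>G\<^esub> inv\<^bsub>G\<^esub> y)"
proof -
  have "val (\<psi> f) (ux x) (ux y) = (\<Sum>w\<in>Poly_Mapping.keys f.
      if w = x \<otimes>\<^bsub>G\<^esub> inv\<^bsub>G\<^esub> y then Poly_Mapping.lookup f w else 0)"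
    unfolding \<psi>_eq val_sum
  proof (intro sum.cong refl)
    fix w assume "w \<in> Poly_Mapping.keys f"
    then have w: "w \<in> carrier G" using f by (auto simp: A_simps)
    then have "orb u (ux (inv\<^bsub>G\<^esub> w)) = orb (ux x) (ux y) \<longleftrightarrow> w = x \<otimes>\<^bsub>G\<^esub> inv\<^bsub>G\<^esub> y"
      using x y orb_ux_eq_iff[of "\<one>\<^bsub>G\<^esub>" "inv\<^bsub>G\<^esub> w" x y] by (simp add: ux_one)
    then show "val (Poly_Mapping.single (orb u (ux (inv\<^bsub>G\<^esub> w))) (Poly_Mapping.lookup f w)) (ux x) (ux y) =
        (if w = x \<otimes>\<^bsub>G\<^esub> inv\<^bsub>G\<^esub> y then Poly_Mapping.lookup f w else 0)"
      by (simp add: val_single)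
  qed
  then show ?thesis by (simp add: in_keys_iff)
qed

lemma val_\<psi>_nonzero:
  assumes f: "f \<in> carrier A" and pq: "p \<in> T" "q \<in> T" and nz: "val (\<psi> f) p q \<noteq> 0"
  shows "p \<in> ux ` carrier G" "q \<in> ux ` carrier G"
proof -
  from nz obtain w where w: "w \<in> Poly_Mapping.keys f" "orb u (ux (inv\<^bsub>G\<^esub> w)) = orb p q"
    unfolding \<psi>_eq val_sum
    by (rule sum.not_neutral_contains_not_neutral) (auto simp: val_single split: if_splits)
  then have wG: "w \<in> carrier G" using f by (auto simp: A_simps)
  obtain v where v: "v \<in> carrier G" "p = ux v" "q = ac (ux (inv\<^bsub>G\<^esub> w)) v"
    using w(2) pq u_closed by (auto simp: orb_eq_iff)
  then show "p \<in> ux ` carrier G" "q \<in> ux ` carrier G" using wG by (auto simp: act_mult)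
qed

lemma \<psi>_corner:
  assumes "f \<in> carrier A"
  shows "e \<otimes>\<^bsub>S\<^esub> \<psi> f = \<psi> f" "\<psi> f \<otimes>\<^bsub>S\<^esub> e = \<psi> f"
  unfolding e_mult_eq_iff[OF \<psi>_closed] mult_e_eq_iff[OF \<psi>_closed]
  by (intro ballI impI, rule val_\<psi>_nonzero[OF assms], assumption+)+

lemma corner_eqI:
  assumes f: "f \<in> carrier S" "e \<otimes>\<^bsub>S\<^esub> f = f" "f \<otimes>\<^bsub>S\<^esub> e = f"
    and g: "g \<in> carrier S" "e \<otimes>\<^bsub>S\<^esub> g = g" "g \<otimes>\<^bsub>S\<^esub> e = g"
    and eq: "\<And>x y. \<lbrakk>x \<in> carrier G; y \<in> carrier G\<rbrakk> \<Longrightarrow> val f (ux x) (ux y) = val g (ux x) (ux y)"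
  shows "f = g"
proof (rule S_eqI[OF f(1) g(1)])
  fix p q assume pq: "p \<in> T" "q \<in> T"
  show "val f p q = val g p q"
  proof (cases "p \<in> ux ` carrier G \<and> q \<in> ux ` carrier G")
    case True
    then show ?thesis using eq by auto
  next
    case False
    then have "val f p q = 0" "val g p q = 0"
      using f g pq e_mult_eq_iff mult_e_eq_iff by metis+
    then show ?thesis by simp
  qed
qed

lemma \<psi>_add:
  assumes "f \<in> carrier A" "g \<in> carrier A"
  shows "\<psi> (f + g) = \<psi> f + \<psi> g"
proof -
  have fg: "f + g \<in> carrier A" using assms keys_add[of f g] by (auto simp: A_simps)
  interpret S: ring S by (rule ring_S)
  show ?thesis
  proof (rule corner_eqI)
    show "e \<otimes>\<^bsub>S\<^esub> (\<psi> f + \<psi> g) = \<psi> f + \<psi> g" "(\<psi> f + \<psi> g) \<otimes>\<^bsub>S\<^esub> e = \<psi> f + \<psi> g"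
      using S.r_distr[OF \<psi>_closed \<psi>_closed e_closed, of f g] S.l_distr[OF \<psi>_closed \<psi>_closed e_closed, of f g] assms
      by (simp_all add: \<psi>_corner)
  qed (use assms fg in \<open>auto simp: \<psi>_corner \<psi>_closed S_add_closed val_\<psi> val_add lookup_add\<close>)
qed

lemma \<psi>_mult:
  assumes f: "f \<in> carrier A" and g: "g \<in> carrier A"
  shows "\<psi> (f \<otimes>\<^bsub>A\<^esub> g) = \<psi> f \<otimes>\<^bsub>S\<^esub> \<psi> g"
proof -
  have fg: "f \<otimes>\<^bsub>A\<^esub> g \<in> carrier A" using f g by (rule A_mult_closed)
  interpret S: ring S by (rule ring_S)
  show ?thesis
  proof (rule corner_eqI)
    show "e \<otimes>\<^bsub>S\<^esub> (\<psi> f \<otimes>\<^bsub>S\<^esub> \<psi> g) = \<psi> f \<otimes>\<^bsub>S\<^esub> \<psi> g"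
      using f g by (simp add: \<psi>_corner \<psi>_closed e_closed flip: S.m_assoc)
    show "(\<psi> f \<otimes>\<^bsub>S\<^esub> \<psi> g) \<otimes>\<^bsub>S\<^esub> e = \<psi> f \<otimes>\<^bsub>S\<^esub> \<psi> g"
      using f g by (simp add: \<psi>_corner \<psi>_closed e_closed S.m_assoc)
    fix x y assume x: "x \<in> carrier G" and y: "y \<in> carrier G"
    have keys: "z \<in> carrier G" if "z \<in> Poly_Mapping.keys f" for z
      using that f by (auto simp: A_simps)
    let ?h = "\<lambda>z. ux (inv\<^bsub>G\<^esub> z \<otimes>\<^bsub>G\<^esub> x)"
    have inj: "inj_on ?h (Poly_Mapping.keys f)"
      using x keys by (intro inj_onI) (simp add: ux_eq_iff G.inv_eq_imp_eq)
    have "val (\<psi> f \<otimes>\<^bsub>S\<^esub> \<psi> g) (ux x) (ux y) =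
        (\<Sum>s\<in>?h ` Poly_Mapping.keys f. val (\<psi> f) (ux x) s * val (\<psi> g) s (ux y))"
    proof (rule val_mult_superset)
      fix s assume s: "s \<in> T" "val (\<psi> f) (ux x) s \<noteq> 0"
      then obtain t where t: "t \<in> carrier G" "s = ux t" using val_\<psi>_nonzero[OF f, of "ux x" s] by auto
      then have "x \<otimes>\<^bsub>G\<^esub> inv\<^bsub>G\<^esub> t \<in> Poly_Mapping.keys f"
        using s x f by (simp add: val_\<psi> in_keys_iff)
      moreover have "s = ?h (x \<otimes>\<^bsub>G\<^esub> inv\<^bsub>G\<^esub> t)"
        using t x by (simp add: G.inv_mult_group G.m_assoc)
      ultimately show "s \<in> ?h ` Poly_Mapping.keys f" by blast
    qed (auto simp: \<psi>_closed)
    also have "\<dots> = (\<Sum>z\<in>Poly_Mapping.keys f. val (\<psi> f) (ux x) (?h z) * val (\<psi> g) (?h z) (ux y))"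
      using inj by (simp add: sum.reindex)
    also have "\<dots> = (\<Sum>z\<in>Poly_Mapping.keys f.
        Poly_Mapping.lookup f z * Poly_Mapping.lookup g (inv\<^bsub>G\<^esub> z \<otimes>\<^bsub>G\<^esub> (x \<otimes>\<^bsub>G\<^esub> inv\<^bsub>G\<^esub> y)))"
    proof (intro sum.cong refl)
      fix z assume "z \<in> Poly_Mapping.keys f"
      then have z: "z \<in> carrier G" by (rule keys)
      then have "x \<otimes>\<^bsub>G\<^esub> inv\<^bsub>G\<^esub> (inv\<^bsub>G\<^esub> z \<otimes>\<^bsub>G\<^esub> x) = z"
        using x by (simp add: G.inv_mult_group flip: G.m_assoc)
      then show "val (\<psi> f) (ux x) (?h z) * val (\<psi> g) (?h z) (ux y) =
          Poly_Mapping.lookup f z * Poly_Mapping.lookup g (inv\<^bsub>G\<^esub> z \<otimes>\<^bsub>G\<^esub> (x \<otimes>\<^bsub>G\<^esub> inv\<^bsub>G\<^esub> y))"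
        using x y z f g by (simp add: val_\<psi> G.m_assoc)
    qed
    also have "\<dots> = val (\<psi> (f \<otimes>\<^bsub>A\<^esub> g)) (ux x) (ux y)"
      using x y f g fg by (simp add: val_\<psi> lookup_A_mult)
    finally show "val (\<psi> (f \<otimes>\<^bsub>A\<^esub> g)) (ux x) (ux y) = val (\<psi> f \<otimes>\<^bsub>S\<^esub> \<psi> g) (ux x) (ux y)" ..
  qed (use f g fg in \<open>auto simp: \<psi>_corner \<psi>_closed intro: S_mult_closed\<close>)
qed

lemma \<psi>_one: "\<psi> \<one>\<^bsub>A\<^esub> = e"
  by (simp add: \<psi>_eq A_simps \<xi>_single ux_one)

lemma \<psi>_zero: "\<psi> \<zero>\<^bsub>A\<^esub> = 0"
  by (simp add: \<psi>_eq A_simps)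

text \<open>
  A kernel \<open>c\<close> in the corner is the image of the function \<open>w \<mapsto> c (u w, u)\<close>: by invariance its value at
  \<open>(u x, u y)\<close> equals that at \<open>(u x y\<^sup>-\<^sup>1, u)\<close>.
\<close>

lemma \<psi>_bij:
  "bij_betw \<psi> (carrier A) {c \<in> carrier S. e \<otimes>\<^bsub>S\<^esub> c = c \<and> c \<otimes>\<^bsub>S\<^esub> e = c}"
  unfolding bij_betw_def
proof (intro conjI equalityI subsetI inj_onI)
  fix f g :: "weyl \<Rightarrow>\<^sub>0 'a" assume fg: "f \<in> carrier A" "g \<in> carrier A" "\<psi> f = \<psi> g"
  show "f = g"
  proof (rule poly_mapping_eqI)
    fix w show "Poly_Mapping.lookup f w = Poly_Mapping.lookup g w"
      using fg val_\<psi>[of f w "\<one>\<^bsub>G\<^esub>"] val_\<psi>[of g w "\<one>\<^bsub>G\<^esub>"]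
      by (cases "w \<in> carrier G") (auto simp: A_lookup)
  qed
next
  fix c :: "tuple_pair set \<Rightarrow>\<^sub>0 'a" assume "c \<in> \<psi> ` carrier A"
  then show "c \<in> {c \<in> carrier S. e \<otimes>\<^bsub>S\<^esub> c = c \<and> c \<otimes>\<^bsub>S\<^esub> e = c}"
    by (auto simp: \<psi>_corner \<psi>_closed)
next
  fix c :: "tuple_pair set \<Rightarrow>\<^sub>0 'a" assume "c \<in> {c \<in> carrier S. e \<otimes>\<^bsub>S\<^esub> c = c \<and> c \<otimes>\<^bsub>S\<^esub> e = c}"
  then have c: "c \<in> carrier S" "e \<otimes>\<^bsub>S\<^esub> c = c" "c \<otimes>\<^bsub>S\<^esub> e = c" by auto
  \<comment> \<open>finitely supported, since the orbits of the pairs \<open>(u w, u)\<close> are distinct\<close>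
  define F where "F w = (if w \<in> carrier G then val c (ux w) u else 0)" for w
  have "{w. F w \<noteq> 0} \<subseteq> {w \<in> carrier G. orb (ux w) u \<in> Poly_Mapping.keys c}"
    by (auto simp: F_def val_def in_keys_iff split: if_splits)
  moreover have "inj_on (\<lambda>w. orb (ux w) u) (carrier G)"
    using orb_ux_eq_iff[of _ "\<one>\<^bsub>G\<^esub>" _ "\<one>\<^bsub>G\<^esub>"] by (intro inj_onI) (simp add: ux_one)
  then have "finite {w \<in> carrier G. orb (ux w) u \<in> Poly_Mapping.keys c}"
    using finite_vimage_IntI[of "Poly_Mapping.keys c" "\<lambda>w. orb (ux w) u" "carrier G"]
    by (simp add: vimage_def Int_def conj_commute)
  ultimately have "finite {w. F w \<noteq> 0}" by (rule finite_subset)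
  define f where "f = Abs_poly_mapping F"
  have lookup_f: "Poly_Mapping.lookup f = F"
    unfolding f_def using \<open>finite {w. F w \<noteq> 0}\<close> by (rule lookup_Abs_poly_mapping)
  have f: "f \<in> carrier A"
    by (auto simp: A_simps in_keys_iff lookup_f F_def split: if_splits)
  have "\<psi> f = c"
  proof (rule corner_eqI)
    fix x y assume xy: "x \<in> carrier G" "y \<in> carrier G"
    then show "val (\<psi> f) (ux x) (ux y) = val c (ux x) (ux y)"
      using f val_act[of "ux x" "ux y" "inv\<^bsub>G\<^esub> y" c]
      by (simp add: val_\<psi> lookup_f F_def act_mult ux_one)
  qed (use c f in \<open>auto simp: \<psi>_corner \<psi>_closed\<close>)
  then show "c \<in> \<psi> ` carrier A" using f by blast
qed

section \<open>The idempotent is full\<close>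

text \<open>
  Both sides count the group elements moving \<open>p\<close> into the box: the left one by the tuple \<open>i\<close> that is
  reached, the right one by the permutation part, which determines the shift.  Summing over the
  whole box thus replaces the stabiliser orders, which depend on \<open>i\<close>, by the constant \<open>r!\<close>.
\<close>

lemma card_translates_into_box:
  assumes p: "p \<in> T"
  shows "(\<Sum>i\<in>bounded_tuples n r. card {w \<in> carrier G. ac i w = p}) = fact r"
proof -
  let ?X = "{w \<in> carrier G. ac p w \<in> bounded_tuples n r}"
  let ?h = "\<lambda>\<sigma>. (\<sigma>, \<lambda>t\<in>{1..r}. - ((p (\<sigma> t) - 1) div int n))"
  have X: "?X = ?h ` {\<sigma>. \<sigma> permutes {1..r}}"
  proof (intro equalityI subsetI)
    fix w assume "w \<in> ?X"
    then have w: "w \<in> carrier G" "ac p w \<in> bounded_tuples n r" by simp_all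
    have "snd w = snd (?h (fst w))"
      unfolding snd_conv by (rule bounded_translate[OF w(1), THEN iffD1, OF w(2)])
    then have "w = ?h (fst w)" by (intro prod_eqI) (simp_all only: fst_conv)
    moreover have "fst w permutes {1..r}" using w(1) by (simp add: weyl_carrier)
    ultimately show "w \<in> ?h ` {\<sigma>. \<sigma> permutes {1..r}}" by blast
  next
    fix w assume "w \<in> ?h ` {\<sigma>. \<sigma> permutes {1..r}}"
    then obtain \<sigma> where "\<sigma> permutes {1..r}" "w = ?h \<sigma>" by blast
    then have w: "w \<in> carrier G" "snd w = (\<lambda>t\<in>{1..r}. - ((p (fst w t) - 1) div int n))"
      by (simp_all add: weyl_carrier)
    have "ac p w \<in> bounded_tuples n r" by (rule bounded_translate[OF w(1), THEN iffD2, OF w(2)])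
    with w(1) show "w \<in> ?X" by blast
  qed
  then have "finite ?X" by (simp add: finite_permutations)
  have "card ?X = fact r"
    unfolding X by (subst card_image) (auto simp: inj_on_def card_permutations)
  have "(\<Sum>i\<in>bounded_tuples n r. card {w \<in> carrier G. ac i w = p}) =
      (\<Sum>i\<in>bounded_tuples n r. card {w \<in> ?X. ac p w = i})"
  proof (intro sum.cong refl)
    fix i assume i: "i \<in> bounded_tuples n r"
    then have iT: "i \<in> T" by (simp add: bounded_tuples_iff)
    have "bij_betw (\<lambda>w. inv\<^bsub>G\<^esub> w) {w \<in> carrier G. ac i w = p} {w \<in> ?X. ac p w = i}"
      by (rule bij_betw_byWitness[where f' = "\<lambda>w. inv\<^bsub>G\<^esub> w"]) (use i iT p in \<open>auto simp: act_inv\<close>)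
    then show "card {w \<in> carrier G. ac i w = p} = card {w \<in> ?X. ac p w = i}"
      by (rule bij_betw_same_card)
  qed
  also have "\<dots> = (\<Sum>i\<in>bounded_tuples n r. \<Sum>w\<in>{w \<in> ?X. ac p w = i}. 1)" by simp
  also have "\<dots> = (\<Sum>w\<in>?X. 1)"
    using \<open>finite ?X\<close> finite_bounded_tuples by (intro sum.group) auto
  finally show ?thesis using \<open>card ?X = fact r\<close> by simp
qed

text \<open>
  The elements \<open>\<xi>\<^sub>i\<^sub>u / r!\<close> and \<open>\<xi>\<^sub>u\<^sub>i\<close>, which take the roles of the \<open>a\<^sub>k\<close> and \<open>b\<^sub>k\<close> for the idempotent \<open>\<xi>\<^sub>u\<^sub>u\<close>.
\<close>

definition col :: "(nat \<Rightarrow> int) \<Rightarrow> (tuple_pair set \<Rightarrow>\<^sub>0 'k::field)" where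
  "col i = Poly_Mapping.single (orb i u) (1 / of_nat (fact r))"

definition row :: "(nat \<Rightarrow> int) \<Rightarrow> (tuple_pair set \<Rightarrow>\<^sub>0 'k::field)" where
  "row i = \<xi> n r u i"

lemma col_row_closed: "i \<in> T \<Longrightarrow> col i \<in> carrier S" "i \<in> T \<Longrightarrow> row i \<in> carrier S"
  using u_closed by (simp_all add: col_def row_def \<xi>_single single_closed)

lemma val_col_ux:
  assumes "i \<in> T" "p \<in> T" "w \<in> carrier G"
  shows "val (col i) p (ux w) = (if ac i w = p then 1 / of_nat (fact r) else 0)"
proof -
  have "orb i u = orb p (ux w) \<longleftrightarrow> ac i w = p"
    using assms u_closed ux_eq_iff by (auto simp: orb_eq_iff)
  then show ?thesis by (simp add: col_def val_single)
qed

lemma val_row_ux: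
  assumes "i \<in> T" "q \<in> T" "w \<in> carrier G"
  shows "val (row i) (ux w) q = (if ac i w = q then 1 else 0)"
proof -
  have "orb u i = orb (ux w) q \<longleftrightarrow> ac i w = q"
    using assms u_closed ux_eq_iff by (auto simp: orb_eq_iff)
  then show ?thesis by (simp add: row_def \<xi>_single val_single)
qed

lemma col_e: "i \<in> T \<Longrightarrow> col i \<otimes>\<^bsub>S\<^esub> e = col i"
  using u_closed by (auto simp: mult_e_eq_iff col_row_closed) (auto simp: col_def val_single orb_eq_iff split: if_splits)

lemma e_row: "i \<in> T \<Longrightarrow> e \<otimes>\<^bsub>S\<^esub> row i = row i"
  using u_closed by (auto simp: e_mult_eq_iff col_row_closed) (auto simp: row_def \<xi>_single val_single orb_eq_iff split: if_splits)

text \<open>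
  The intermediate tuples are the \<open>s = u w\<close> with \<open>i w = p\<close> and \<open>i w = q\<close>; by regularity of \<open>u\<close> they correspond
  to the elements \<open>w\<close>.
\<close>

lemma val_col_row:
  assumes i: "i \<in> T" and pq: "p \<in> T" "q \<in> T"
  shows "val (col i \<otimes>\<^bsub>S\<^esub> row i) p q =
    (if p = q then of_nat (card {w \<in> carrier G. ac i w = p}) / of_nat (fact r) else 0)"
proof -
  let ?W = "{w \<in> carrier G. ac i w = p}"
  have "inj_on ux ?W" by (auto simp: inj_on_def ux_eq_iff)
  have "val (col i \<otimes>\<^bsub>S\<^esub> row i) p q = (\<Sum>s\<in>ux ` ?W. val (col i) p s * val (row i) s q)"
  proof (rule val_mult_superset)
    fix s assume s: "s \<in> T" "val (col i) p s \<noteq> 0"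
    then obtain w where "w \<in> carrier G" "s = ux w"
      using col_e[OF i] mult_e_eq_iff[OF col_row_closed(1)[OF i]] pq by (metis imageE)
    then show "s \<in> ux ` ?W" using s i pq by (auto simp: val_col_ux split: if_splits)
  qed (use i pq in \<open>auto simp: col_row_closed finite_transporter\<close>)
  also have "\<dots> = (\<Sum>w\<in>?W. if p = q then 1 / of_nat (fact r) else 0)"
    using \<open>inj_on ux ?W\<close> i pq by (auto simp: sum.reindex val_col_ux val_row_ux intro!: sum.cong)
  finally show ?thesis by (simp split: if_splits)
qed

lemma finsum_S:
  assumes "\<And>x. x \<in> X \<Longrightarrow> f x \<in> carrier S"
  shows "finsum S f X = (\<Sum>x\<in>X. f x)"
proof -
  interpret S: ring S by (rule ring_S)
  show ?thesis
    using assms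
    by (induction X rule: infinite_finite_induct) (auto simp: Pi_def)
qed

lemma sum_col_row:
  assumes "of_nat (fact r) \<noteq> (0::'k::field)"
  shows "(\<Oplus>\<^bsub>S\<^esub>i\<in>bounded_tuples n r. col i \<otimes>\<^bsub>S\<^esub> row i) = (\<one>\<^bsub>S\<^esub> :: tuple_pair set \<Rightarrow>\<^sub>0 'k)"
proof -
  have bT: "i \<in> T" if "i \<in> bounded_tuples n r" for i using that by (simp add: bounded_tuples_iff)
  have cl: "(col i \<otimes>\<^bsub>S\<^esub> row i :: tuple_pair set \<Rightarrow>\<^sub>0 'k) \<in> carrier S" if "i \<in> bounded_tuples n r" for i
    using bT[OF that] by (intro S_mult_closed col_row_closed)
  define X where "X = (\<Sum>i\<in>bounded_tuples n r. col i \<otimes>\<^bsub>S\<^esub> row i :: tuple_pair set \<Rightarrow>\<^sub>0 'k)"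
  have "X = \<one>\<^bsub>S\<^esub>"
  proof (rule S_eqI)
    fix p q assume pq: "p \<in> T" "q \<in> T"
    have "val X p q = (\<Sum>i\<in>bounded_tuples n r.
        if p = q then of_nat (card {w \<in> carrier G. ac i w = p}) / of_nat (fact r) else (0::'k))"
      unfolding X_def val_sum using pq bT by (intro sum.cong refl val_col_row)
    also have "\<dots> = (if p = q then
        of_nat (\<Sum>i\<in>bounded_tuples n r. card {w \<in> carrier G. ac i w = p}) / of_nat (fact r) else 0)"
      by (simp add: sum_divide_distrib)
    also have "\<dots> = val \<one>\<^bsub>S\<^esub> p q"
      unfolding card_translates_into_box[OF pq(1)] using assms pq by (simp add: val_one)
    finally show "val X p q = val \<one>\<^bsub>S\<^esub> p q" .
  qed (auto simp: X_def intro: sum_closed_S cl S_one_closed)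
  then show ?thesis unfolding X_def by (simp only: finsum_S[OF cl])
qed

theorem full_corner_regular:
  assumes "of_nat (fact r) \<noteq> (0::'k::field)"
  shows "full_corner (S :: (tuple_pair set \<Rightarrow>\<^sub>0 'k) ring) A \<psi> e (bounded_tuples n r) col row"
proof (intro full_corner.intro full_corner_axioms.intro ring_S)
  interpret S: ring S by (rule ring_S)
  show "e \<otimes>\<^bsub>S\<^esub> e = e" by (auto simp: e_mult_eq_iff e_closed val_e split: if_splits)
  show "(\<Oplus>\<^bsub>S\<^esub>i\<in>bounded_tuples n r. col i \<otimes>\<^bsub>S\<^esub> row i) = (\<one>\<^bsub>S\<^esub> :: tuple_pair set \<Rightarrow>\<^sub>0 'k)"
    using assms by (rule sum_col_row)
  show "\<psi> \<one>\<^bsub>A\<^esub> = e" "\<psi> \<zero>\<^bsub>A\<^esub> = \<zero>\<^bsub>S\<^esub>" by (simp_all add: \<psi>_one \<psi>_zero)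
  fix f g :: "weyl \<Rightarrow>\<^sub>0 'k" assume fg: "f \<in> carrier A" "g \<in> carrier A"
  then show "f \<otimes>\<^bsub>A\<^esub> g \<in> carrier A" by (rule A_mult_closed)
  show "f \<oplus>\<^bsub>A\<^esub> g \<in> carrier A" "\<psi> (f \<oplus>\<^bsub>A\<^esub> g) = \<psi> f \<oplus>\<^bsub>S\<^esub> \<psi> g"
    using fg keys_add[of f g] by (auto simp: A_simps \<psi>_add)
  show "\<psi> (f \<otimes>\<^bsub>A\<^esub> g) = \<psi> f \<otimes>\<^bsub>S\<^esub> \<psi> g" using fg by (rule \<psi>_mult)
qed (auto simp: \<psi>_bij e_closed finite_bounded_tuples bounded_tuples_iff
    col_row_closed col_e e_row A_simps)

section \<open>Room for the induced modules\<close>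

text \<open>
  A nonzero module is a nonzero vector space over an infinite field.  Over a finite field the
  theorem could fail for a finite type of elements, where an induced module need not fit.
\<close>

lemma infinite_carrier_if_nonzero:
  assumes K: "infinite (UNIV :: 'k::field set)"
    and V: "left_module (A :: (weyl \<Rightarrow>\<^sub>0 'k) ring) V" and x: "x \<in> carrier V" "x \<noteq> \<zero>\<^bsub>V\<^esub>"
  shows "infinite (carrier V)"
proof -
  interpret V: left_module A V by fact
  define c :: "'k \<Rightarrow> weyl \<Rightarrow>\<^sub>0 'k" where "c k = Poly_Mapping.single \<one>\<^bsub>G\<^esub> k" for k
  have c: "c k \<in> carrier A" for k by (simp add: c_def A_simps)
  have c_add: "c (k + l) = c k \<oplus>\<^bsub>A\<^esub> c l" for k l by (simp add: c_def A_simps single_add)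
  have c_mult: "c k \<otimes>\<^bsub>A\<^esub> c l = c (k * l)" for k l
    by (cases "k = 0"; cases "l = 0") (simp_all add: c_def group_algebra_def)
  have "inj (\<lambda>k. c k \<odot>\<^bsub>V\<^esub> x)"
  proof (rule injI, rule ccontr)
    fix k l assume eq: "c k \<odot>\<^bsub>V\<^esub> x = c l \<odot>\<^bsub>V\<^esub> x" and "k \<noteq> l"
    have "c (k - l) \<odot>\<^bsub>V\<^esub> x \<oplus>\<^bsub>V\<^esub> c l \<odot>\<^bsub>V\<^esub> x = c l \<odot>\<^bsub>V\<^esub> x"
      unfolding V.smult_l_distr[OF c c x(1), symmetric] c_add[symmetric] by (simp add: eq)
    then have "c (k - l) \<odot>\<^bsub>V\<^esub> x = \<zero>\<^bsub>V\<^esub>"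
      using x c by (simp add: V.smult_closed V.M.add.r_cancel_one)
    then have "c (1 / (k - l)) \<odot>\<^bsub>V\<^esub> (c (k - l) \<odot>\<^bsub>V\<^esub> x) = \<zero>\<^bsub>V\<^esub>" using c by (simp add: V.smult_r_null)
    moreover have "c (1 / (k - l)) \<odot>\<^bsub>V\<^esub> (c (k - l) \<odot>\<^bsub>V\<^esub> x) = \<one>\<^bsub>A\<^esub> \<odot>\<^bsub>V\<^esub> x"
      using V.smult_assoc[OF c c x(1), of "1 / (k - l)" "k - l"] \<open>k \<noteq> l\<close>
      by (simp add: c_mult) (simp add: c_def A_simps)
    ultimately show False using x by (simp add: V.smult_one)
  qed
  then have "infinite (range (\<lambda>k. c k \<odot>\<^bsub>V\<^esub> x))" using K finite_imageD by blast
  moreover have "range (\<lambda>k. c k \<odot>\<^bsub>V\<^esub> x) \<subseteq> carrier V" using x c by (auto intro: V.smult_closed)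
  ultimately show ?thesis using finite_subset by blast
qed

end

text \<open>
  With this the vectors over an infinite module embed into the module itself, and so does the
  induced module.
\<close>

lemma infinite_finite_power_lepoll:
  assumes V: "infinite V" and "finite I"
  shows "(I \<rightarrow>\<^sub>E V) \<lesssim> V"
  using \<open>finite I\<close>
proof (induction I)
  case empty
  have "{\<lambda>_. undefined} \<lesssim> V" using V by (intro finite_lepoll_infinite) auto
  then show ?case by simp
next
  case (insert i I)
  have "inj_on (\<lambda>f. (f i, restrict f I)) (insert i I \<rightarrow>\<^sub>E V)"
  proof (rule inj_onI)
    fix f g assume f: "f \<in> insert i I \<rightarrow>\<^sub>E V" and g: "g \<in> insert i I \<rightarrow>\<^sub>E V"
      and eq: "(f i, restrict f I) = (g i, restrict g I)"
    have "f x = g x" if "x \<in> insert i I" for x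
      using that eq by (metis Pair_inject insertE restrict_apply')
    then show "f = g" using f g by (intro PiE_ext)
  qed
  moreover have "(\<lambda>f. (f i, restrict f I)) ` (insert i I \<rightarrow>\<^sub>E V) \<subseteq> V \<times> (I \<rightarrow>\<^sub>E V)" by auto
  ultimately have "(insert i I \<rightarrow>\<^sub>E V) \<lesssim> V \<times> (I \<rightarrow>\<^sub>E V)" unfolding lepoll_def by blast
  also have "V \<times> (I \<rightarrow>\<^sub>E V) \<lesssim> V \<times> V" by (intro times_lepoll_mono lepoll_refl insert)
  also have "V \<times> V \<lesssim> V"
    using card_of_Times_same_infinite[OF V] ordIso_imp_ordLeq card_of_ordLeq[of "V \<times> V" V]
    unfolding lepoll_def by blast
  finally show ?case .
qed

theorem theorem3p12:
  fixes n r :: nat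
  assumes "infinite (UNIV :: 'k::field set)"
    and "1 \<le> r" and "r \<le> n"
    and "CHAR('k) > r \<or> CHAR('k) = 0"
  shows "equivalence_of_categories
    (Left_Mod (affine_schur n r :: (tuple_pair set \<Rightarrow>\<^sub>0 'k) ring))
    (Left_Mod (group_algebra (ext_affine_weyl r) :: (weyl \<Rightarrow>\<^sub>0 'k) ring))
    (schur_functor n r ::
      ((tuple_pair set \<Rightarrow>\<^sub>0 'k, 'm) module, 'm \<Rightarrow> 'm, (weyl \<Rightarrow>\<^sub>0 'k, 'm) module, 'm \<Rightarrow> 'm) func)"
proof -
  interpret regular_schur_data n r using assms by unfold_locales auto
  have "of_nat (fact r) \<noteq> (0::'k)"
  proof
    assume "of_nat (fact r) = (0::'k)"
    then have "(\<Prod>i\<in>{1..r}. of_nat i) = (0::'k)" by (simp only: fact_prod of_nat_prod of_nat_id)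
    then obtain i where "i \<in> {1..r}" "CHAR('k) dvd i"
      by (auto simp: of_nat_eq_0_iff_char_dvd)
    then show False using assms(4) by (auto dest: dvd_imp_le)
  qed
  then interpret full_corner "S :: (tuple_pair set \<Rightarrow>\<^sub>0 'k) ring" A \<psi> e "bounded_tuples n r" col row
    by (rule full_corner_regular)
  have functor_eq: "schur_functor n r = (corner_functor ::
      ((tuple_pair set \<Rightarrow>\<^sub>0 'k, 'm) module, 'm \<Rightarrow> 'm, (weyl \<Rightarrow>\<^sub>0 'k, 'm) module, 'm \<Rightarrow> 'm) func)"
    by (simp add: schur_functor_def corner_functor_def schur_omap_def corner_omap_def fun_eq_iff)
  have room: "\<exists>j :: ((nat \<Rightarrow> int) \<Rightarrow> 'm) \<Rightarrow> 'm. inj_on j (bounded_tuples n r \<rightarrow>\<^sub>E carrier V)"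
    if V: "left_module A V" for V :: "(weyl \<Rightarrow>\<^sub>0 'k, 'm) module"
  proof (cases "carrier V = {\<zero>\<^bsub>V\<^esub>}")
    case True
    then have "inj_on (\<lambda>f. \<zero>\<^bsub>V\<^esub>) (bounded_tuples n r \<rightarrow>\<^sub>E carrier V)"
      by (auto intro!: inj_onI PiE_ext)
    then show ?thesis by blast
  next
    case False
    interpret V: left_module A V by fact
    obtain x where "x \<in> carrier V" "x \<noteq> \<zero>\<^bsub>V\<^esub>" using False V.M.zero_closed by blast
    then have "infinite (carrier V)" using assms(1) V by (intro infinite_carrier_if_nonzero)
    then have "(bounded_tuples n r \<rightarrow>\<^sub>E carrier V) \<lesssim> carrier V"
      by (intro infinite_finite_power_lepoll finite_bounded_tuples)
    then show ?thesis by (auto simp: lepoll_def)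
  qed
  show ?thesis unfolding functor_eq by (rule equivalence_corner) (rule room)
qed

end
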